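(* Every automorphism in $\mathrm{Aut}_V(\mathbb{H}^2)$ can be approximated uniformly on compacts by finite compositions of shears and overshears, and every automorphism with volume $1$ (i.e. every element of $\mathrm{Aut}_1(\mathbb{H}^2)$) can be approximated uniformly on compacts by finite compositions of shears.
   Context: $\mathbb{H}$ is the algebra of quaternions; $z,w$ are two non-commuting quaternionic variables. Power series. $\mathcal{H}[z,w]$ denotes the set of functions given by absolutely convergent series $\sum_d f_d(z,w)$, where each $f_d$ is a finite sum of monomials of degree $d$ of the form $a_0*a_1*\cdots*a_d$ with $a_m\in\mathbb{H}$, each $*$ being replaced by one of the variables $z,w$; the coefficients $a_0,\dots,a_{d-1}$ may be normalized to be unit quaternions chosen from a fixed set of representatives of $S^3/\{-1,1\}$. Functions are assumed to be defined on all of $\mathbb{H}^2$, and formal uniqueness of the power series expansion is assumed: two such functions are the same if and only if the corresponding power series coincide. Partial derivatives. For $h\in\mathbb{H}$, $\widehat{\partial}_z f(z,w)[h]=\lim_{t\to0}\frac1t\,(f(z+th,w)-f(z,w))$ ($t$ real), and similarly $\widehat{\partial}_w f(z,w)[h]$ with respect to $w$. Vector fields and flows. A vector field on $\mathbb{H}^2$ is a mapping $X=(f,g)$ with $f,g\in\mathcal{H}[z,w]$. Put $\mathrm{Div}X(z,w)[h]=\widehat{\partial}_zf(z,w)[h]+\widehat{\partial}_wg(z,w)[h]$. $X$ has divergence if there is a function, denoted $\mathrm{div}X(z,w)$, such that $\mathrm{Div}X(z,w)[h]=h\,\mathrm{div}X(z,w)$. A flow of $X$ is a function $\Phi^X(z,w,t)$,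 defined on an open subset of $\mathbb{H}^2\times\mathbb{R}$ containing $\mathbb{H}^2\times\{0\}$, with $\frac{d}{dt}\Phi^X(z,w,t)=X(\Phi^X(z,w,t))$ and $\Phi^X(z,w,0)=(z,w)$. Automorphisms with volume. The space of automorphisms with volume, $\mathrm{Aut}_V(\mathbb{H}^2)$, is the set of time-one maps $(z,w)\mapsto\Phi^X(z,w,1)$ (automorphisms of $\mathbb{H}^2$), where $X$ is a vector field with flow $\Phi^X$ and $\mathrm{Div}X(z,w)[h]=h\,\mathrm{div}X(z,w)$. The space of automorphisms with volume $1$, $\mathrm{Aut}_1(\mathbb{H}^2)$, is the set of such time-one maps $\Phi^X(z,w,1)$ with $\mathrm{Div}X(z,w)[h]=0$. Shears and overshears. Let $\Lambda:\mathbb{H}^2\to\mathbb{H}$ be a right $\mathbb{H}$-linear functional represented by a real matrix, let $(v_1,v_2)\in\ker\Lambda$ with $v_1,v_2\in\mathbb{R}$ and $\|(v_1,v_2)\|=1$, and let $f$ be a slice-regular function on $\mathbb{H}$, i.e. $f(u)=\sum_n u^na_n$ with $a_n\in\mathbb{H}$, convergent on $\mathbb{H}$. A shear is a map $(z,w)\mapsto(z,w)+(v_1,v_2)f(\Lambda(z,w))$. An overshear is a map $(z,w)\mapsto(z,w)+(v_1,v_2)(\bar v_1z+\bar v_2w)(e^{f(\Lambda(z,w))}-1)$, where $e^q=\sum_{n\ge0}q^n/n!$. *)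

theory Defs
  imports "HOL-Analysis.Analysis"
begin

section \<open>The quaternions as a Euclidean division algebra\<close>

datatype quat = Quat (qRe: real) (qI: real) (qJ: real) (qK: real)

lemma quat_eq_iff: "x = y \<longleftrightarrow> qRe x = qRe y \<and> qI x = qI y \<and> qJ x = qJ y \<and> qK x = qK y"
  by (cases x; cases y) auto

lemma quat_eqI:
  "\<lbrakk>qRe x = qRe y; qI x = qI y; qJ x = qJ y; qK x = qK y\<rbrakk> \<Longrightarrow> x = y"
  by (simp add: quat_eq_iff)

instantiation quat :: ab_group_add
begin
definition zero_quat :: quat where "0 = Quat 0 0 0 0"
definition uminus_quat :: "quat \<Rightarrow> quat" where
  "- x = Quat (- qRe x) (- qI x) (- qJ x) (- qK x)"
definition plus_quat :: "quat \<Rightarrow> quat \<Rightarrow> quat" where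
  "x + y = Quat (qRe x + qRe y) (qI x + qI y) (qJ x + qJ y) (qK x + qK y)"
definition minus_quat :: "quat \<Rightarrow> quat \<Rightarrow> quat" where
  "x - y = Quat (qRe x - qRe y) (qI x - qI y) (qJ x - qJ y) (qK x - qK y)"
instance
  by standard (simp_all add: zero_quat_def uminus_quat_def plus_quat_def minus_quat_def)
end

lemma quat_zero_sel [simp]: "qRe 0 = 0" "qI 0 = 0" "qJ 0 = 0" "qK 0 = 0"
  by (simp_all add: zero_quat_def)

lemma quat_uminus_sel [simp]:
  "qRe (- x) = - qRe x" "qI (- x) = - qI x" "qJ (- x) = - qJ x" "qK (- x) = - qK x"
  by (simp_all add: uminus_quat_def)

lemma quat_plus_sel [simp]:
  "qRe (x + y) = qRe x + qRe y" "qI (x + y) = qI x + qI y"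
  "qJ (x + y) = qJ x + qJ y" "qK (x + y) = qK x + qK y"
  by (simp_all add: plus_quat_def)

lemma quat_minus_sel [simp]:
  "qRe (x - y) = qRe x - qRe y" "qI (x - y) = qI x - qI y"
  "qJ (x - y) = qJ x - qJ y" "qK (x - y) = qK x - qK y"
  by (simp_all add: minus_quat_def)

instantiation quat :: real_vector
begin
definition scaleR_quat :: "real \<Rightarrow> quat \<Rightarrow> quat" where
  "r *\<^sub>R x = Quat (r * qRe x) (r * qI x) (r * qJ x) (r * qK x)"
instance
  by standard (simp_all add: scaleR_quat_def quat_eq_iff algebra_simps)
end

lemma quat_scaleR_sel [simp]:
  "qRe (r *\<^sub>R x) = r * qRe x" "qI (r *\<^sub>R x) = r * qI x"
  "qJ (r *\<^sub>R x) = r * qJ x" "qK (r *\<^sub>R x) = r * qK x"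
  by (simp_all add: scaleR_quat_def)

instantiation quat :: real_algebra_1
begin
definition one_quat :: quat where "1 = Quat 1 0 0 0"
definition times_quat :: "quat \<Rightarrow> quat \<Rightarrow> quat" where
  "x * y = Quat
     (qRe x * qRe y - qI x * qI y - qJ x * qJ y - qK x * qK y)
     (qRe x * qI y + qI x * qRe y + qJ x * qK y - qK x * qJ y)
     (qRe x * qJ y - qI x * qK y + qJ x * qRe y + qK x * qI y)
     (qRe x * qK y + qI x * qJ y - qJ x * qI y + qK x * qRe y)"
instance
  by standard (simp_all add: one_quat_def times_quat_def quat_eq_iff algebra_simps)
end

lemma quat_one_sel [simp]: "qRe 1 = 1" "qI 1 = 0" "qJ 1 = 0" "qK 1 = 0"
  by (simp_all add: one_quat_def)

lemma quat_times_sel [simp]: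
  "qRe (x * y) = qRe x * qRe y - qI x * qI y - qJ x * qJ y - qK x * qK y"
  "qI (x * y) = qRe x * qI y + qI x * qRe y + qJ x * qK y - qK x * qJ y"
  "qJ (x * y) = qRe x * qJ y - qI x * qK y + qJ x * qRe y + qK x * qI y"
  "qK (x * y) = qRe x * qK y + qI x * qJ y - qJ x * qI y + qK x * qRe y"
  by (simp_all add: times_quat_def)

lemma quat_sum_squares_eq_0_iff:
  "(qRe x)\<^sup>2 + (qI x)\<^sup>2 + (qJ x)\<^sup>2 + (qK x)\<^sup>2 = 0 \<longleftrightarrow> x = 0"
  by (simp add: quat_eq_iff add_nonneg_eq_0_iff)

instantiation quat :: real_div_algebra
begin
definition inverse_quat :: "quat \<Rightarrow> quat" where
  "inverse x = (1 / ((qRe x)\<^sup>2 + (qI x)\<^sup>2 + (qJ x)\<^sup>2 + (qK x)\<^sup>2)) *\<^sub>R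
     Quat (qRe x) (- qI x) (- qJ x) (- qK x)"
definition divide_quat :: "quat \<Rightarrow> quat \<Rightarrow> quat" where
  "x div y = (x :: quat) * inverse y"
instance
proof
  fix x y :: quat
  show "x div y = x * inverse y"
    by (simp add: divide_quat_def)
  show "inverse (0 :: quat) = 0"
    by (simp add: inverse_quat_def)
  assume "x \<noteq> 0"
  then have nz: "(qRe x)\<^sup>2 + (qI x)\<^sup>2 + (qJ x)\<^sup>2 + (qK x)\<^sup>2 \<noteq> 0"
    by (simp add: quat_sum_squares_eq_0_iff)
  then show "inverse x * x = 1" "x * inverse x = 1"
    unfolding inverse_quat_def quat_eq_iff
    by (simp_all add: add_divide_distrib[symmetric] diff_divide_distrib[symmetric] power2_eq_square)
qed
end

instantiation quat :: real_inner
begin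
definition inner_quat :: "quat \<Rightarrow> quat \<Rightarrow> real" where
  "x \<bullet> y = qRe x * qRe y + qI x * qI y + qJ x * qJ y + qK x * qK y"
definition norm_quat :: "quat \<Rightarrow> real" where
  "norm x = sqrt ((qRe x)\<^sup>2 + (qI x)\<^sup>2 + (qJ x)\<^sup>2 + (qK x)\<^sup>2)"
definition sgn_quat :: "quat \<Rightarrow> quat" where
  "sgn x = (x :: quat) /\<^sub>R norm x"
definition dist_quat :: "quat \<Rightarrow> quat \<Rightarrow> real" where
  "dist x y = norm (x - y :: quat)"
definition uniformity_quat :: "(quat \<times> quat) filter" where
  "uniformity = (INF e\<in>{0 <..}. principal {(x, y :: quat). dist x y < e})"
definition open_quat :: "quat set \<Rightarrow> bool" where
  "open (U :: quat set) \<longleftrightarrow> (\<forall>x\<in>U. eventually (\<lambda>(x', y). x' = x \<longrightarrow> y \<in> U) uniformity)"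
instance
proof
  fix x y z :: quat and r :: real and U :: "quat set"
  show "dist x y = norm (x - y)"
    by (simp add: dist_quat_def)
  show "sgn x = x /\<^sub>R norm x"
    by (simp add: sgn_quat_def)
  show "uniformity = (INF e\<in>{0 <..}. principal {(x, y :: quat). dist x y < e})"
    by (simp add: uniformity_quat_def)
  show "open U \<longleftrightarrow> (\<forall>x\<in>U. eventually (\<lambda>(x', y). x' = x \<longrightarrow> y \<in> U) uniformity)"
    by (simp add: open_quat_def)
  show "x \<bullet> y = y \<bullet> x" "(x + y) \<bullet> z = x \<bullet> z + y \<bullet> z" "(r *\<^sub>R x) \<bullet> y = r * (x \<bullet> y)"
    by (simp_all add: inner_quat_def algebra_simps)
  show "0 \<le> x \<bullet> x"
    by (simp add: inner_quat_def)
  show "x \<bullet> x = 0 \<longleftrightarrow> x = 0"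
    using quat_sum_squares_eq_0_iff[of x] by (simp add: inner_quat_def power2_eq_square)
  show "norm x = sqrt (x \<bullet> x)"
    by (simp add: inner_quat_def norm_quat_def power2_eq_square)
qed
end

instance quat :: real_normed_div_algebra
proof
  fix x y :: quat
  show "norm (x * y) = norm x * norm y"
    unfolding norm_quat_def real_sqrt_mult[symmetric]
    by (rule arg_cong[of _ _ sqrt], simp only: quat_times_sel) algebra
qed

instantiation quat :: euclidean_space
begin
definition Basis_quat :: "quat set" where
  "Basis = {Quat 1 0 0 0, Quat 0 1 0 0, Quat 0 0 1 0, Quat 0 0 0 1}"
instance
proof
  show "(Basis :: quat set) \<noteq> {}" "finite (Basis :: quat set)"
    by (simp_all add: Basis_quat_def)
  show "\<And>u v :: quat. \<lbrakk>u \<in> Basis; v \<in> Basis\<rbrakk> \<Longrightarrow> u \<bullet> v = (if u = v then 1 else 0)"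
    unfolding Basis_quat_def inner_quat_def by fastforce
  show "\<And>x :: quat. (\<forall>u\<in>Basis. x \<bullet> u = 0) \<longleftrightarrow> x = 0"
    by (simp add: Basis_quat_def inner_quat_def) (simp add: quat_eq_iff)
qed
end

section \<open>Power series in two non-commuting quaternionic variables\<close>

text \<open>\<open>hmonomial d m\<close>: \<open>m\<close> is of the form \<open>a\<^sub>0 * a\<^sub>1 * \<dots> * a\<^sub>d\<close>, each \<open>*\<close> being
  replaced by \<open>z\<close> or \<open>w\<close>. The coefficients are not normalized.\<close>

inductive hmonomial :: "nat \<Rightarrow> (quat \<times> quat \<Rightarrow> quat) \<Rightarrow> bool" where
  const: "hmonomial 0 (\<lambda>(z, w). a)"
| var_z: "hmonomial d m \<Longrightarrow> hmonomial (Suc d) (\<lambda>(z, w). m (z, w) * z * a)"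
| var_w: "hmonomial d m \<Longrightarrow> hmonomial (Suc d) (\<lambda>(z, w). m (z, w) * w * a)"

definition homogeneous_poly :: "nat \<Rightarrow> (quat \<times> quat \<Rightarrow> quat) \<Rightarrow> bool" where
  "homogeneous_poly d f \<longleftrightarrow>
     (\<exists>ms. (\<forall>m\<in>set ms. hmonomial d m) \<and> f = (\<lambda>p. \<Sum>m\<leftarrow>ms. m p))"

text \<open>The elements are functions on the whole of \<open>\<bbbH>\<^sup>2\<close>, so two series with the same sum are
  the same element.\<close>

definition Hseries :: "(quat \<times> quat \<Rightarrow> quat) set" where
  "Hseries = {f. \<exists>F. (\<forall>d. homogeneous_poly d (F d)) \<and>
     (\<forall>p. summable (\<lambda>d. norm (F d p)) \<and> (\<lambda>d. F d p) sums f p)}"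

section \<open>Vector fields, divergence and flows\<close>

type_synonym vfield = "quat \<times> quat \<Rightarrow> quat \<times> quat"

text \<open>For functions in \<open>Hseries\<close> these limits always exist.\<close>

definition dz :: "(quat \<times> quat \<Rightarrow> quat) \<Rightarrow> quat \<times> quat \<Rightarrow> quat \<Rightarrow> quat" where
  "dz f = (\<lambda>(z, w) h. Lim (at 0) (\<lambda>t::real. (1 / t) *\<^sub>R (f (z + t *\<^sub>R h, w) - f (z, w))))"

definition dw :: "(quat \<times> quat \<Rightarrow> quat) \<Rightarrow> quat \<times> quat \<Rightarrow> quat \<Rightarrow> quat" where
  "dw f = (\<lambda>(z, w) h. Lim (at 0) (\<lambda>t::real. (1 / t) *\<^sub>R (f (z, w + t *\<^sub>R h) - f (z, w))))"

definition vector_field :: "vfield \<Rightarrow> bool" where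
  "vector_field X \<longleftrightarrow> fst \<circ> X \<in> Hseries \<and> snd \<circ> X \<in> Hseries"

definition Div :: "vfield \<Rightarrow> quat \<times> quat \<Rightarrow> quat \<Rightarrow> quat" where
  "Div X p h = dz (fst \<circ> X) p h + dw (snd \<circ> X) p h"

definition has_divergence :: "vfield \<Rightarrow> bool" where
  "has_divergence X \<longleftrightarrow> (\<exists>\<delta> :: quat \<times> quat \<Rightarrow> quat. \<forall>p h. Div X p h = h * \<delta> p)"

text \<open>\<open>\<Phi>\<close> is a flow of \<open>X\<close> with domain \<open>U\<close>; values of \<open>\<Phi>\<close> outside \<open>U\<close> are irrelevant. As usual
  for flow domains, each trajectory is defined on an interval of times: on a component of a time
  slice that does not contain \<open>0\<close> the initial condition would say nothing about \<open>\<Phi>\<close>.\<close>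

definition is_flow ::
  "vfield \<Rightarrow> ((quat \<times> quat) \<times> real) set \<Rightarrow> ((quat \<times> quat) \<times> real \<Rightarrow> quat \<times> quat) \<Rightarrow> bool" where
  "is_flow X U \<Phi> \<longleftrightarrow>
     open U \<and> UNIV \<times> {0} \<subseteq> U \<and> (\<forall>p. is_interval {t. (p, t) \<in> U}) \<and>
     (\<forall>p. \<Phi> (p, 0) = p) \<and>
     (\<forall>(p, t)\<in>U. ((\<lambda>s. \<Phi> (p, s)) has_vector_derivative X (\<Phi> (p, t))) (at t))"

definition time_one_map :: "vfield \<Rightarrow> (quat \<times> quat \<Rightarrow> quat \<times> quat) \<Rightarrow> bool" where
  "time_one_map X F \<longleftrightarrow>
     (\<exists>U \<Phi>. is_flow X U \<Phi> \<and> UNIV \<times> {1} \<subseteq> U \<and> F = (\<lambda>p. \<Phi> (p, 1)))"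

definition Aut_V :: "(quat \<times> quat \<Rightarrow> quat \<times> quat) set" where
  "Aut_V = {F. bij F \<and> (\<exists>X. vector_field X \<and> has_divergence X \<and> time_one_map X F)}"

definition Aut_1 :: "(quat \<times> quat \<Rightarrow> quat \<times> quat) set" where
  "Aut_1 = {F. bij F \<and> (\<exists>X. vector_field X \<and> (\<forall>p h. Div X p h = 0) \<and> time_one_map X F)}"

section \<open>Shears and overshears\<close>

definition slice_regular :: "(quat \<Rightarrow> quat) \<Rightarrow> bool" where
  "slice_regular f \<longleftrightarrow> (\<exists>a :: nat \<Rightarrow> quat. \<forall>u. (\<lambda>n. u ^ n * a n) sums f u)"

definition right_linear :: "(quat \<times> quat \<Rightarrow> quat) \<Rightarrow> bool" where
  "right_linear \<Lambda> \<longleftrightarrow> (\<forall>p q. \<Lambda> (p + q) = \<Lambda> p + \<Lambda> q) \<and>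
     (\<forall>z w a. \<Lambda> (z * a, w * a) = \<Lambda> (z, w) * a)"

definition real_functional :: "(quat \<times> quat \<Rightarrow> quat) \<Rightarrow> bool" where
  "real_functional \<Lambda> \<longleftrightarrow> right_linear \<Lambda> \<and>
     (\<exists>l1 l2 :: real. \<forall>z w. \<Lambda> (z, w) = of_real l1 * z + of_real l2 * w)"

definition shears :: "(quat \<times> quat \<Rightarrow> quat \<times> quat) set" where
  "shears = {S. \<exists>\<Lambda> v1 v2 f. real_functional \<Lambda> \<and> \<Lambda> (of_real v1, of_real v2) = 0 \<and>
     norm (v1 :: real, v2 :: real) = 1 \<and> slice_regular f \<and>
     S = (\<lambda>(z, w). (z, w) + (of_real v1 * f (\<Lambda> (z, w)), of_real v2 * f (\<Lambda> (z, w))))}"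

text \<open>Since \<open>v\<^sub>1\<close> and \<open>v\<^sub>2\<close> are real, the conjugates in \<open>v\<^sub>1 z + v\<^sub>2 w\<close> are dropped.\<close>

definition overshears :: "(quat \<times> quat \<Rightarrow> quat \<times> quat) set" where
  "overshears = {S. \<exists>\<Lambda> v1 v2 f. real_functional \<Lambda> \<and> \<Lambda> (of_real v1, of_real v2) = 0 \<and>
     norm (v1 :: real, v2 :: real) = 1 \<and> slice_regular f \<and>
     S = (\<lambda>(z, w). let q = (of_real v1 * z + of_real v2 * w) * (exp (f (\<Lambda> (z, w))) - 1)
                   in (z, w) + (of_real v1 * q, of_real v2 * q))}"

definition finite_compositions :: "('a \<Rightarrow> 'a) set \<Rightarrow> ('a \<Rightarrow> 'a) set" where
  "finite_compositions G = {foldr (\<circ>) gs id | gs. set gs \<subseteq> G}"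

definition approximable_on_compacts ::
  "('a::metric_space \<Rightarrow> 'b::metric_space) \<Rightarrow> ('a \<Rightarrow> 'b) set \<Rightarrow> bool" where
  "approximable_on_compacts F G \<longleftrightarrow>
     (\<forall>K. compact K \<longrightarrow> (\<forall>\<epsilon>>0. \<exists>g\<in>G. \<forall>p\<in>K. dist (F p) (g p) < \<epsilon>))"

end

theory Submission
  imports Defs
begin

text \<open>The quaternions serve to produce sufficiently many maps; the approximation itself takes place in
\<open>\<real>\<^sup>8\<close>.  Call a continuous field \<open>X\<close> tangent to a monoid \<open>G\<close> of maps if, for every small real \<open>t\<close>
of either sign, some \<open>g \<in> G\<close> agrees with \<open>x + t X(x)\<close> up to \<open>o(t)\<close>, uniformly on balls.  Composing
the \<open>g\<close> belonging to \<open>t = 1/n\<close> with itself \<open>n\<close> times is a perturbed Euler scheme, so the time-one map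
of a locally Lipschitz tangent field is approximated by \<open>G\<close> (\<open>flow_approximable\<close>).  It therefore
suffices to find enough tangent fields.

Tangent fields form a linear space that is closed under locally uniform limits and under
push-forward by affine maps in the closure of \<open>G\<close> (\<open>tangent_fields_affine_push\<close>).  This takes the
place of brackets of fields: if the affine maps depend on a parameter \<open>s\<close> and the pushed field is a
polynomial in \<open>s\<close>, then all its coefficients are again tangent (\<open>coefficients_in_fun_subspace\<close>).

Let \<open>G\<close> contain the shears.  The fields \<open>(w\<^sup>n a, 0)\<close> and \<open>(0, z\<^sup>n a)\<close> are tangent, and translating
\<open>w\<^sup>2 a\<close> produces \<open>q w a\<close>.  The maps \<open>w \<mapsto> q w a\<close> span all real-linear maps of \<open>\<bbbH>\<close>, and from these
one obtains every transvection field \<open>(k \<bullet> x) c\<close> of \<open>\<real>\<^sup>8\<close> with \<open>k \<bullet> c = 0\<close>.  Pushing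
\<open>w\<^sup>n\<close> along a transvection replaces \<open>w\<close> by \<open>w + s r\<close>, where \<open>r\<close> is a real coordinate of \<open>w\<close>; the
coefficient of \<open>s\<^sup>n\<close> is the real field \<open>r\<^sup>n\<close>.  Transvections act transitively enough to carry
it to all fields \<open>(l \<bullet> x)\<^sup>n b\<close> with \<open>l \<bullet> b = 0\<close>, and these span the polynomial fields whose divergence
in the sense of \<open>\<real>\<^sup>8\<close> vanishes (\<open>divergence_free_polynomial_field\<close>).  If \<open>G\<close> also contains
the overshears, then the field \<open>(z w\<^sup>n, 0)\<close> leads in the same way to tangent fields whose divergence
is any prescribed power of a linear form, so that every polynomial field is tangent.

It remains to pass from a vector field \<open>X\<close> with components in \<open>H[z,w]\<close> to its homogeneous
parts.  Convergence of the series is assumed pointwise only, but on all of \<open>\<bbbH>\<^sup>2\<close>, so by homogeneity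
the degree \<open>d\<close> part decays faster than any \<open>N powr (- d)\<close> at each point.  A Remez inequality turns this into
decay uniform on balls, for the parts and their difference quotients.  Hence \<open>X\<close> is locally
Lipschitz, is the locally uniform limit of its polynomial truncations, and may be differentiated
term by term.  If \<open>Div X\<close> vanishes, then so does its trace in \<open>h\<close>, which is the divergence on
\<open>\<real>\<^sup>8\<close>, and by homogeneity every part of \<open>X\<close> is divergence free.\<close>

section \<open>Vector fields tangent to a monoid of maps\<close>

definition continuous_closure ::
  "('a::euclidean_space \<Rightarrow> 'a) set \<Rightarrow> ('a \<Rightarrow> 'a) set" where
  "continuous_closure G = {F. continuous_on UNIV F \<and> approximable_on_compacts F G}"

text \<open>Admitting both signs of \<open>t\<close> makes this set a linear space and not merely a cone.\<close>

definition tangent_fields ::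
  "('a::euclidean_space \<Rightarrow> 'a) set \<Rightarrow> ('a \<Rightarrow> 'a) set" where
  "tangent_fields G = {X. continuous_on UNIV X \<and>
     (\<forall>R \<epsilon>. 0 < \<epsilon> \<longrightarrow> (\<exists>\<delta>>0. \<forall>t. 0 < \<bar>t\<bar> \<and> \<bar>t\<bar> < \<delta> \<longrightarrow>
        (\<exists>g\<in>G. \<forall>x\<in>cball 0 R. norm (g x - x - t *\<^sub>R X x) \<le> \<epsilon> * \<bar>t\<bar>)))}"

definition fun_subspace :: "('a \<Rightarrow> 'b::real_vector) set \<Rightarrow> bool" where
  "fun_subspace S \<longleftrightarrow> (\<lambda>x. 0) \<in> S \<and>
     (\<forall>f\<in>S. \<forall>g\<in>S. (\<lambda>x. f x + g x) \<in> S) \<and> (\<forall>c. \<forall>f\<in>S. (\<lambda>x. c *\<^sub>R f x) \<in> S)"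

lemma fun_subspaceI:
  assumes "(\<lambda>x. 0) \<in> S" "\<And>f g. f \<in> S \<Longrightarrow> g \<in> S \<Longrightarrow> (\<lambda>x. f x + g x) \<in> S"
    "\<And>c f. f \<in> S \<Longrightarrow> (\<lambda>x. c *\<^sub>R f x) \<in> S"
  shows "fun_subspace S"
  using assms by (simp add: fun_subspace_def)

context
  fixes S :: "('a \<Rightarrow> 'b::real_vector) set"
  assumes S: "fun_subspace S"
begin

lemma fun_subspace_0: "(\<lambda>x. 0) \<in> S"
  and fun_subspace_add: "f \<in> S \<Longrightarrow> g \<in> S \<Longrightarrow> (\<lambda>x. f x + g x) \<in> S"
  and fun_subspace_scale: "f \<in> S \<Longrightarrow> (\<lambda>x. c *\<^sub>R f x) \<in> S"
  using S by (auto simp: fun_subspace_def)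

lemma fun_subspace_diff: "f \<in> S \<Longrightarrow> g \<in> S \<Longrightarrow> (\<lambda>x. f x - g x) \<in> S"
  using fun_subspace_add[of f "\<lambda>x. (-1) *\<^sub>R g x"] fun_subspace_scale[of g "-1"] by simp

lemma fun_subspace_sum: "(\<And>i. i \<in> I \<Longrightarrow> f i \<in> S) \<Longrightarrow> (\<lambda>x. \<Sum>i\<in>I. f i x) \<in> S"
  by (induction I rule: infinite_finite_induct) (auto intro: fun_subspace_0 fun_subspace_add)

end

lemma norm_scaleR_le: "norm v \<le> e \<Longrightarrow> norm (t *\<^sub>R v) \<le> e * \<bar>t\<bar>"
  by (metis abs_ge_zero mult.commute mult_left_mono norm_scaleR)

lemma bounded_on_cball:
  fixes X :: "'a::euclidean_space \<Rightarrow> 'b::real_normed_vector"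
  assumes "continuous_on UNIV X"
  obtains B where "B > 0" "\<And>x. x \<in> cball 0 R \<Longrightarrow> norm (X x) \<le> B"
proof -
  have "compact (X ` cball 0 R)"
    by (intro compact_continuous_image continuous_on_subset[OF assms]) auto
  from compact_imp_bounded[OF this] obtain B where "B > 0" "\<forall>y\<in>X ` cball 0 R. norm y \<le> B"
    unfolding bounded_pos by blast
  then show ?thesis by (intro that[of B]) auto
qed

lemma uniformly_continuous_on_cball:
  fixes X :: "'a::euclidean_space \<Rightarrow> 'b::real_normed_vector"
  assumes "continuous_on UNIV X" "\<epsilon> > 0"
  obtains \<eta> where "\<eta> > 0" "\<And>x y. x \<in> cball 0 R \<Longrightarrow> y \<in> cball 0 R \<Longrightarrow> norm (y - x) < \<eta> \<Longrightarrow>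
     norm (X y - X x) < \<epsilon>"
proof -
  have "uniformly_continuous_on (cball 0 R) X"
    by (intro compact_uniformly_continuous continuous_on_subset[OF assms(1)]) auto
  then obtain d where "d > 0" "\<forall>x\<in>cball 0 R. \<forall>y\<in>cball 0 R. dist y x < d \<longrightarrow> dist (X y) (X x) < \<epsilon>"
    using assms(2) unfolding uniformly_continuous_on_def by blast
  then show ?thesis by (intro that[of d]) (auto simp: dist_norm)
qed

locale map_monoid =
  fixes G :: "('a::euclidean_space \<Rightarrow> 'a) set"
  assumes id_mem: "id \<in> G" and comp_mem: "f \<in> G \<Longrightarrow> g \<in> G \<Longrightarrow> f \<circ> g \<in> G"
begin

lemma tangent_fieldsD:
  assumes "X \<in> tangent_fields G" "0 < \<epsilon>"
  obtains \<delta> where "\<delta> > 0"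
    "\<And>t. 0 < \<bar>t\<bar> \<Longrightarrow> \<bar>t\<bar> < \<delta> \<Longrightarrow> \<exists>g\<in>G. \<forall>x\<in>cball 0 R. norm (g x - x - t *\<^sub>R X x) \<le> \<epsilon> * \<bar>t\<bar>"
  using assms unfolding tangent_fields_def by blast

lemma tangent_fields_cont: "X \<in> tangent_fields G \<Longrightarrow> continuous_on UNIV X"
  by (simp add: tangent_fields_def)

lemma continuous_closureI:
  assumes "continuous_on UNIV F"
    "\<And>R \<epsilon>. \<epsilon> > 0 \<Longrightarrow> \<exists>g\<in>G. \<forall>x\<in>cball 0 R. norm (F x - g x) < \<epsilon>"
  shows "F \<in> continuous_closure G"
  unfolding continuous_closure_def approximable_on_compacts_def
proof (intro CollectI conjI allI impI assms(1))
  fix K :: "'a set" and \<epsilon> :: real assume "compact K" "\<epsilon> > 0"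
  then obtain R where "\<forall>x\<in>K. norm x \<le> R"
    using compact_imp_bounded[of K] unfolding bounded_iff by blast
  then have "K \<subseteq> cball 0 R" by auto
  with assms(2)[OF \<open>\<epsilon> > 0\<close>, of R] show "\<exists>g\<in>G. \<forall>p\<in>K. dist (F p) (g p) < \<epsilon>"
    unfolding dist_norm by blast
qed

lemma continuous_closureD:
  assumes "F \<in> continuous_closure G" "\<epsilon> > 0"
  shows "\<exists>g\<in>G. \<forall>x\<in>cball 0 R. norm (F x - g x) < \<epsilon>"
proof -
  have "\<forall>K. compact K \<longrightarrow> (\<forall>\<epsilon>>0. \<exists>g\<in>G. \<forall>p\<in>K. norm (F p - g p) < \<epsilon>)"
    using assms(1) by (simp add: continuous_closure_def approximable_on_compacts_def dist_norm)
  from this[rule_format, OF compact_cball assms(2)] show ?thesis .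
qed

lemma subset_continuous_closure: "g \<in> G \<Longrightarrow> continuous_on UNIV g \<Longrightarrow> g \<in> continuous_closure G"
  by (rule continuous_closureI) (auto intro: bexI[of _ g])

text \<open>The two approximating maps are composed: the second one moves a point by \<open>O(t)\<close>, over which distance
the first field changes by an arbitrarily small amount, so the composition error is \<open>o(t)\<close>.\<close>

lemma tangent_fields_add:
  assumes X: "X \<in> tangent_fields G" and Y: "Y \<in> tangent_fields G"
  shows "(\<lambda>x. X x + Y x) \<in> tangent_fields G"
  unfolding tangent_fields_def
proof (intro CollectI conjI allI impI)
  note c = tangent_fields_cont[OF X] tangent_fields_cont[OF Y]
  show "continuous_on UNIV (\<lambda>x. X x + Y x)" by (intro continuous_intros c)
  fix R \<epsilon> :: real assume e: "0 < \<epsilon>"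
  then have e3: "\<epsilon>/3 > 0" by simp
  obtain B where B: "B > 0" "\<And>x. x \<in> cball 0 R \<Longrightarrow> norm (Y x) \<le> B"
    using bounded_on_cball c(2) by blast
  obtain \<eta> where eta: "\<eta> > 0" "\<And>x y. x \<in> cball 0 (R+1) \<Longrightarrow> y \<in> cball 0 (R+1) \<Longrightarrow>
      norm (y - x) < \<eta> \<Longrightarrow> norm (X y - X x) < \<epsilon>/3"
    using uniformly_continuous_on_cball[OF c(1) e3] by blast
  obtain d1 where d1: "d1 > 0" "\<And>t. 0 < \<bar>t\<bar> \<Longrightarrow> \<bar>t\<bar> < d1 \<Longrightarrow>
      \<exists>g\<in>G. \<forall>x\<in>cball 0 (R+1). norm (g x - x - t *\<^sub>R X x) \<le> \<epsilon>/3 * \<bar>t\<bar>"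
    using tangent_fieldsD[OF X e3] by metis
  obtain d2 where d2: "d2 > 0" "\<And>t. 0 < \<bar>t\<bar> \<Longrightarrow> \<bar>t\<bar> < d2 \<Longrightarrow>
      \<exists>g\<in>G. \<forall>x\<in>cball 0 R. norm (g x - x - t *\<^sub>R Y x) \<le> \<epsilon>/3 * \<bar>t\<bar>"
    using tangent_fieldsD[OF Y e3] by metis
  \<comment> \<open>The last entry keeps the displacement \<open>\<bar>t\<bar> (B + \<epsilon>/3)\<close> below \<open>1\<close> and below the modulus of continuity.\<close>
  define \<delta> where "\<delta> = min (min d1 d2) (min 1 \<eta> / (B + \<epsilon>/3))"
  have "\<delta> > 0" using d1 d2 B eta e by (simp add: \<delta>_def)
  moreover have "\<exists>g\<in>G. \<forall>x\<in>cball 0 R. norm (g x - x - t *\<^sub>R (X x + Y x)) \<le> \<epsilon> * \<bar>t\<bar>"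
    if t: "0 < \<bar>t\<bar>" "\<bar>t\<bar> < \<delta>" for t
  proof -
    obtain g1 where g1: "g1 \<in> G" "\<And>x. x \<in> cball 0 (R+1) \<Longrightarrow> norm (g1 x - x - t *\<^sub>R X x) \<le> \<epsilon>/3 * \<bar>t\<bar>"
      using d1(2)[of t] t by (auto simp: \<delta>_def)
    obtain g2 where g2: "g2 \<in> G" "\<And>x. x \<in> cball 0 R \<Longrightarrow> norm (g2 x - x - t *\<^sub>R Y x) \<le> \<epsilon>/3 * \<bar>t\<bar>"
      using d2(2)[of t] t by (auto simp: \<delta>_def)
    have small: "\<bar>t\<bar> * (B + \<epsilon>/3) < min 1 \<eta>"
      using t(2) B e by (simp add: \<delta>_def pos_less_divide_eq)
    have "norm ((g1 \<circ> g2) x - x - t *\<^sub>R (X x + Y x)) \<le> \<epsilon> * \<bar>t\<bar>" if x: "x \<in> cball 0 R" for x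
    proof -
      let ?y = "g2 x"
      have "norm (?y - x) \<le> norm (?y - x - t *\<^sub>R Y x) + norm (t *\<^sub>R Y x)"
        by (metis diff_add_cancel norm_triangle_ineq)
      also have "\<dots> \<le> \<epsilon>/3 * \<bar>t\<bar> + \<bar>t\<bar> * B"
        using g2(2)[OF x] B(2)[OF x] by (auto intro!: add_mono mult_left_mono)
      finally have yx: "norm (?y - x) < min 1 \<eta>" using small by (simp add: algebra_simps)
      have "norm ?y \<le> norm x + norm (?y - x)" by (metis norm_triangle_sub)
      then have y: "?y \<in> cball 0 (R+1)" and x': "x \<in> cball 0 (R+1)" using x yx by auto
      have 1: "norm (t *\<^sub>R (X ?y - X x)) \<le> \<epsilon>/3 * \<bar>t\<bar>"
        using eta(2)[OF x' y] yx by (intro norm_scaleR_le) auto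
      have "(g1 \<circ> g2) x - x - t *\<^sub>R (X x + Y x) =
        (g1 ?y - ?y - t *\<^sub>R X ?y) + (?y - x - t *\<^sub>R Y x) + t *\<^sub>R (X ?y - X x)"
        by (simp add: algebra_simps)
      also have "norm \<dots> \<le> \<epsilon>/3 * \<bar>t\<bar> + \<epsilon>/3 * \<bar>t\<bar> + \<epsilon>/3 * \<bar>t\<bar>"
        by (intro norm_triangle_le add_mono g1(2)[OF y] g2(2)[OF x] 1)
      finally show ?thesis by simp
    qed
    then show ?thesis using comp_mem[OF g1(1) g2(1)] by blast
  qed
  ultimately show "\<exists>\<delta>>0. \<forall>t. 0 < \<bar>t\<bar> \<and> \<bar>t\<bar> < \<delta> \<longrightarrow>
     (\<exists>g\<in>G. \<forall>x\<in>cball 0 R. norm (g x - x - t *\<^sub>R (X x + Y x)) \<le> \<epsilon> * \<bar>t\<bar>)" by blast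
qed

lemma tangent_fields_0: "(\<lambda>x. 0) \<in> tangent_fields G"
  unfolding tangent_fields_def using id_mem by (auto intro!: exI[of _ 1] bexI[of _ id])

lemma tangent_fields_scale:
  assumes X: "X \<in> tangent_fields G"
  shows "(\<lambda>x. c *\<^sub>R X x) \<in> tangent_fields G"
proof (cases "c = 0")
  case True
  then show ?thesis using tangent_fields_0 by simp
next
  case False
  show ?thesis
    unfolding tangent_fields_def
  proof (intro CollectI conjI allI impI)
    show "continuous_on UNIV (\<lambda>x. c *\<^sub>R X x)"
      by (intro continuous_intros tangent_fields_cont[OF X])
    fix R \<epsilon> :: real assume "0 < \<epsilon>"
    then have "\<epsilon> / \<bar>c\<bar> > 0" using False by simp
    then obtain d where d: "d > 0" "\<And>t. 0 < \<bar>t\<bar> \<Longrightarrow> \<bar>t\<bar> < d \<Longrightarrow>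
        \<exists>g\<in>G. \<forall>x\<in>cball 0 R. norm (g x - x - t *\<^sub>R X x) \<le> \<epsilon>/\<bar>c\<bar> * \<bar>t\<bar>"
      using tangent_fieldsD[OF X] by metis
    have "\<exists>g\<in>G. \<forall>x\<in>cball 0 R. norm (g x - x - t *\<^sub>R c *\<^sub>R X x) \<le> \<epsilon> * \<bar>t\<bar>"
      if t: "0 < \<bar>t\<bar>" "\<bar>t\<bar> < d / \<bar>c\<bar>" for t
      using d(2)[of "t * c"] t False by (simp add: abs_mult pos_less_divide_eq)
    then show "\<exists>\<delta>>0. \<forall>t. 0 < \<bar>t\<bar> \<and> \<bar>t\<bar> < \<delta> \<longrightarrow>
       (\<exists>g\<in>G. \<forall>x\<in>cball 0 R. norm (g x - x - t *\<^sub>R c *\<^sub>R X x) \<le> \<epsilon> * \<bar>t\<bar>)"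
      using d(1) False by (intro exI[of _ "d / \<bar>c\<bar>"]) auto
  qed
qed

lemma fun_subspace_tangent_fields: "fun_subspace (tangent_fields G)"
  by (intro fun_subspaceI tangent_fields_0 tangent_fields_add tangent_fields_scale)

lemma tangent_fields_limit:
  assumes c: "continuous_on UNIV X"
    and lim: "\<And>R \<epsilon>. \<epsilon> > 0 \<Longrightarrow> \<exists>Y\<in>tangent_fields G. \<forall>x\<in>cball 0 R. norm (Y x - X x) \<le> \<epsilon>"
  shows "X \<in> tangent_fields G"
  unfolding tangent_fields_def
proof (intro CollectI conjI allI impI c)
  fix R \<epsilon> :: real assume e: "0 < \<epsilon>"
  then have e2: "\<epsilon>/2 > 0" by simp
  obtain Y where Y: "Y \<in> tangent_fields G" "\<And>x. x \<in> cball 0 R \<Longrightarrow> norm (Y x - X x) \<le> \<epsilon>/2"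
    using lim[OF e2] by blast
  obtain d where d: "d > 0" "\<And>t. 0 < \<bar>t\<bar> \<Longrightarrow> \<bar>t\<bar> < d \<Longrightarrow>
        \<exists>g\<in>G. \<forall>x\<in>cball 0 R. norm (g x - x - t *\<^sub>R Y x) \<le> \<epsilon>/2 * \<bar>t\<bar>"
    using tangent_fieldsD[OF Y(1) e2] by metis
  have "\<exists>g\<in>G. \<forall>x\<in>cball 0 R. norm (g x - x - t *\<^sub>R X x) \<le> \<epsilon> * \<bar>t\<bar>"
    if t: "0 < \<bar>t\<bar>" "\<bar>t\<bar> < d" for t
  proof -
    obtain g where g: "g \<in> G" "\<And>x. x \<in> cball 0 R \<Longrightarrow> norm (g x - x - t *\<^sub>R Y x) \<le> \<epsilon>/2 * \<bar>t\<bar>"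
      using d(2)[OF t] by blast
    have "norm (g x - x - t *\<^sub>R X x) \<le> \<epsilon> * \<bar>t\<bar>" if x: "x \<in> cball 0 R" for x
    proof -
      have "norm (t *\<^sub>R (Y x - X x)) \<le> \<epsilon>/2 * \<bar>t\<bar>"
        by (rule norm_scaleR_le[OF Y(2)[OF x]])
      then show ?thesis
        using norm_triangle_ineq[of "g x - x - t *\<^sub>R Y x" "t *\<^sub>R (Y x - X x)"] g(2)[OF x]
        by (simp add: algebra_simps)
    qed
    with g(1) show ?thesis by blast
  qed
  with d(1) show "\<exists>\<delta>>0. \<forall>t. 0 < \<bar>t\<bar> \<and> \<bar>t\<bar> < \<delta> \<longrightarrow>
       (\<exists>g\<in>G. \<forall>x\<in>cball 0 R. norm (g x - x - t *\<^sub>R X x) \<le> \<epsilon> * \<bar>t\<bar>)" by blast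
qed

text \<open>If \<open>\<tau> x = c + A x\<close> and \<open>\<sigma>\<close> is its inverse, the conjugates \<open>\<tau> \<circ> g \<circ> \<sigma>\<close> are tangent to the push-forward
\<open>A \<circ> Y \<circ> \<sigma>\<close>.  As \<open>\<tau>\<close> and \<open>\<sigma>\<close> are only limits of elements of \<open>G\<close>, both are replaced by elements
whose error is small compared with \<open>t\<close>.\<close>

lemma tangent_fields_affine_push:
  assumes Y: "Y \<in> tangent_fields G" and A: "linear A"
    and tau: "(\<lambda>x. c + A x) \<in> continuous_closure G" and sig: "\<sigma> \<in> continuous_closure G"
    and inv: "\<And>x. c + A (\<sigma> x) = x"
  shows "(\<lambda>x. A (Y (\<sigma> x))) \<in> tangent_fields G"
  unfolding tangent_fields_def
proof (intro CollectI conjI allI impI)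
  have csig: "continuous_on UNIV \<sigma>" using sig by (simp add: continuous_closure_def)
  have cA: "continuous_on UNIV A" using A by (simp add: linear_continuous_on linear_conv_bounded_linear)
  note cY = tangent_fields_cont[OF Y]
  show "continuous_on UNIV (\<lambda>x. A (Y (\<sigma> x)))"
    by (rule continuous_on_compose2[OF cA continuous_on_compose2[OF cY csig]]) auto
  fix R \<epsilon> :: real assume e: "0 < \<epsilon>"
  obtain B where B: "B > 0" "\<And>x. norm (A x) \<le> B * norm x" using A linear_bounded_pos by blast
  define e' where "e' = \<epsilon> / (3 * B + 1)"
  have e': "e' > 0" using e B by (simp add: e'_def)
  obtain R' where R': "R' > 0" "\<And>x. x \<in> cball 0 R \<Longrightarrow> norm (\<sigma> x) \<le> R'"
    using bounded_on_cball csig by blast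
  obtain R2 where R2: "R2 > 0" "\<And>x. x \<in> cball 0 (R'+1) \<Longrightarrow> norm (Y x) \<le> R2"
    using bounded_on_cball cY by blast
  obtain \<eta> where eta: "\<eta> > 0" "\<And>x y. x \<in> cball 0 (R'+1) \<Longrightarrow> y \<in> cball 0 (R'+1) \<Longrightarrow>
      norm (y - x) < \<eta> \<Longrightarrow> norm (Y y - Y x) < e'"
    using uniformly_continuous_on_cball[OF cY e'] by blast
  obtain d where d: "d > 0" "\<And>t. 0 < \<bar>t\<bar> \<Longrightarrow> \<bar>t\<bar> < d \<Longrightarrow>
        \<exists>g\<in>G. \<forall>x\<in>cball 0 (R'+1). norm (g x - x - t *\<^sub>R Y x) \<le> e' * \<bar>t\<bar>"
    using tangent_fieldsD[OF Y e'] by metis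
  have "\<exists>g\<in>G. \<forall>x\<in>cball 0 R. norm (g x - x - t *\<^sub>R A (Y (\<sigma> x))) \<le> \<epsilon> * \<bar>t\<bar>"
    if t: "0 < \<bar>t\<bar>" "\<bar>t\<bar> < d" for t
  proof -
    obtain g where g: "g \<in> G" "\<And>x. x \<in> cball 0 (R'+1) \<Longrightarrow> norm (g x - x - t *\<^sub>R Y x) \<le> e' * \<bar>t\<bar>"
      using d(2)[OF t] by blast
    obtain s where s: "s \<in> G" "\<And>x. x \<in> cball 0 R \<Longrightarrow> norm (\<sigma> x - s x) < min (min 1 \<eta>) (e' * \<bar>t\<bar>)"
      using continuous_closureD[OF sig, of "min (min 1 \<eta>) (e' * \<bar>t\<bar>)" R] eta e' t by auto
    define R3 where "R3 = R' + 1 + \<bar>t\<bar> * R2 + e' * \<bar>t\<bar>"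
    obtain h where h: "h \<in> G" "\<And>x. x \<in> cball 0 R3 \<Longrightarrow> norm (c + A x - h x) < e' * \<bar>t\<bar>"
      using continuous_closureD[OF tau, of "e' * \<bar>t\<bar>" R3] e' t by auto
    have "norm ((h \<circ> (g \<circ> s)) x - x - t *\<^sub>R A (Y (\<sigma> x))) \<le> \<epsilon> * \<bar>t\<bar>" if x: "x \<in> cball 0 R" for x
    proof -
      let ?x = "s x" and ?y = "g (s x)"
      have sx: "norm (?x - \<sigma> x) < 1" "norm (?x - \<sigma> x) < \<eta>" "norm (?x - \<sigma> x) < e' * \<bar>t\<bar>"
        using s(2)[OF x] by (auto simp: norm_minus_commute)
      have "norm ?x \<le> norm (\<sigma> x) + norm (?x - \<sigma> x)" by (metis norm_triangle_sub)
      then have in1: "?x \<in> cball 0 (R'+1)" "\<sigma> x \<in> cball 0 (R'+1)" using R'(2)[OF x] sx by auto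
      have 1: "norm (t *\<^sub>R (Y ?x - Y (\<sigma> x))) \<le> e' * \<bar>t\<bar>"
        by (rule norm_scaleR_le[OF less_imp_le[OF eta(2)[OF in1(2,1) sx(2)]]])
      have "norm ?y = norm ((?x + t *\<^sub>R Y ?x) + (?y - ?x - t *\<^sub>R Y ?x))" by simp
      also have "\<dots> \<le> (norm ?x + \<bar>t\<bar> * norm (Y ?x)) + norm (?y - ?x - t *\<^sub>R Y ?x)"
        by (intro norm_triangle_le add_mono) auto
      also have "\<dots> \<le> (R' + 1) + \<bar>t\<bar> * R2 + e' * \<bar>t\<bar>"
        using g(2)[OF in1(1)] R2(2)[OF in1(1)] in1(1) by (intro add_mono mult_left_mono) auto
      finally have in2: "?y \<in> cball 0 R3" by (simp add: R3_def)
      have "norm (?y - \<sigma> x - t *\<^sub>R Y (\<sigma> x)) =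
        norm ((?y - ?x - t *\<^sub>R Y ?x) + (?x - \<sigma> x) + t *\<^sub>R (Y ?x - Y (\<sigma> x)))"
        by (simp add: algebra_simps)
      also have "\<dots> \<le> e' * \<bar>t\<bar> + e' * \<bar>t\<bar> + e' * \<bar>t\<bar>"
        using g(2)[OF in1(1)] sx 1 by (intro norm_triangle_le add_mono) auto
      finally have "B * norm (?y - \<sigma> x - t *\<^sub>R Y (\<sigma> x)) \<le> B * (3 * e' * \<bar>t\<bar>)"
        using B by (intro mult_left_mono) auto
      with B(2) have "norm (A (?y - \<sigma> x - t *\<^sub>R Y (\<sigma> x))) \<le> B * (3 * e' * \<bar>t\<bar>)"
        using order_trans by blast
      moreover have "A (\<sigma> x) = x - c" by (metis add_diff_cancel_left' inv)
      then have "A (?y - \<sigma> x - t *\<^sub>R Y (\<sigma> x)) = c + A ?y - x - t *\<^sub>R A (Y (\<sigma> x))"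
        by (simp only: linear_diff[OF A] linear_scale[OF A]) simp
      ultimately have n1: "norm (c + A ?y - x - t *\<^sub>R A (Y (\<sigma> x))) \<le> B * (3 * e' * \<bar>t\<bar>)" by simp
      have n2: "norm (h ?y - (c + A ?y)) \<le> e' * \<bar>t\<bar>"
        using h(2)[OF in2] by (metis less_imp_le norm_minus_commute)
      have "(h \<circ> (g \<circ> s)) x - x - t *\<^sub>R A (Y (\<sigma> x)) =
          (h ?y - (c + A ?y)) + (c + A ?y - x - t *\<^sub>R A (Y (\<sigma> x)))"
        unfolding o_apply by (simp only: diff_add_eq diff_add_cancel add_diff_eq add_diff_cancel)
      then have "norm ((h \<circ> (g \<circ> s)) x - x - t *\<^sub>R A (Y (\<sigma> x))) \<le>
          e' * \<bar>t\<bar> + B * (3 * e' * \<bar>t\<bar>)"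
        using norm_triangle_le[OF add_mono[OF n2 n1]] by metis
      also have "\<dots> = (e' * (3 * B + 1)) * \<bar>t\<bar>" by (simp add: algebra_simps)
      also have "e' * (3 * B + 1) = \<epsilon>" using B by (simp add: e'_def)
      finally show ?thesis .
    qed
    then show ?thesis using comp_mem[OF h(1) comp_mem[OF g(1) s(1)]] by blast
  qed
  with d(1) show "\<exists>\<delta>>0. \<forall>t. 0 < \<bar>t\<bar> \<and> \<bar>t\<bar> < \<delta> \<longrightarrow>
     (\<exists>g\<in>G. \<forall>x\<in>cball 0 R. norm (g x - x - t *\<^sub>R A (Y (\<sigma> x))) \<le> \<epsilon> * \<bar>t\<bar>)" by blast
qed

text \<open>For a shear field \<open>p + t X(p)\<close> is the flow, so there is no error term at all.\<close>

lemma tangent_field_of_exact_flow: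
  assumes "continuous_on UNIV X" "\<And>t. (\<lambda>p. p + t *\<^sub>R X p) \<in> G"
  shows "X \<in> tangent_fields G"
  unfolding tangent_fields_def
proof (intro CollectI conjI allI impI assms(1))
  fix R \<epsilon> :: real assume "0 < \<epsilon>"
  then have "\<exists>g\<in>G. \<forall>x\<in>cball 0 R. norm (g x - x - t *\<^sub>R X x) \<le> \<epsilon> * \<bar>t\<bar>" for t
    by (intro bexI[OF _ assms(2)[of t]]) simp
  then show "\<exists>\<delta>>0. \<forall>t. 0 < \<bar>t\<bar> \<and> \<bar>t\<bar> < \<delta> \<longrightarrow>
      (\<exists>g\<in>G. \<forall>x\<in>cball 0 R. norm (g x - x - t *\<^sub>R X x) \<le> \<epsilon> * \<bar>t\<bar>)"
    by (intro exI[of _ 1]) simp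
qed

end

section \<open>Flows of tangent fields\<close>

text \<open>Local error of one Euler step along a trajectory that stays in a ball.\<close>

lemma flow_step_bound:
  fixes y :: "real \<Rightarrow> 'a::euclidean_space"
  assumes lip: "L-lipschitz_on (cball 0 R) X" and L: "L \<ge> 0"
    and M: "\<And>x. x \<in> cball 0 R \<Longrightarrow> norm (X x) \<le> M"
    and sol: "\<And>t. t \<in> {0..1} \<Longrightarrow> (y has_vector_derivative X (y t)) (at t within {0..1})"
    and inb: "\<And>t. t \<in> {0..1} \<Longrightarrow> y t \<in> cball 0 R"
    and ab: "a \<in> {0..1}" "b \<in> {0..1}" "a \<le> b"
  shows "norm (y b - y a - (b - a) *\<^sub>R X (y a)) \<le> L * M * (b - a)\<^sup>2"
proof -
  have sub: "{a..b} \<subseteq> {0..1}" using ab by auto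
  have sol': "(y has_derivative (\<lambda>h. h *\<^sub>R X (y t))) (at t within {a..b})" if "t \<in> {a..b}" for t
    using sol[of t] that sub has_derivative_subset unfolding has_vector_derivative_def by blast
  have M0: "0 \<le> M" using M[OF inb[OF ab(1)]] norm_ge_zero order_trans by blast
  have 1: "norm (y t - y a) \<le> M * (b - a)" if t: "t \<in> {a..b}" for t
  proof -
    have "norm (y t - y a) \<le> M * norm (t - a)"
    proof (rule differentiable_bound[of "{a..b}" y "\<lambda>t h. h *\<^sub>R X (y t)"])
      show "onorm (\<lambda>h. h *\<^sub>R X (y s)) \<le> M" if "s \<in> {a..b}" for s
      proof (rule onorm_bound[OF M0])
        have "s \<in> {0..1}" using that sub by auto
        then show "norm (h *\<^sub>R X (y s)) \<le> M * norm h" for h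
          unfolding real_norm_def by (intro norm_scaleR_le M inb)
      qed
    qed (use sol' t ab in auto)
    also have "\<dots> \<le> M * (b - a)" using t M0 by (intro mult_left_mono) auto
    finally show ?thesis .
  qed
  let ?z = "\<lambda>t. y t - t *\<^sub>R X (y a)"
  have "norm (?z b - ?z a) \<le> (L * (M * (b - a))) * norm (b - a)"
  proof (rule differentiable_bound[of "{a..b}" ?z "\<lambda>t h. h *\<^sub>R (X (y t) - X (y a))"])
    fix s assume s: "s \<in> {a..b}"
    show "(?z has_derivative (\<lambda>h. h *\<^sub>R (X (y s) - X (y a)))) (at s within {a..b})"
      using sol'[OF s] by (auto intro!: derivative_eq_intros simp: algebra_simps)
    have "norm (X (y s) - X (y a)) \<le> L * norm (y s - y a)"
      using lipschitz_onD[OF lip inb[of s] inb[of a]] s sub ab by (auto simp: dist_norm)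
    also have "\<dots> \<le> L * (M * (b - a))" using 1[OF s] L by (intro mult_left_mono)
    finally show "onorm (\<lambda>h. h *\<^sub>R (X (y s) - X (y a))) \<le> L * (M * (b - a))"
      unfolding real_norm_def using L M0 ab by (intro onorm_bound norm_scaleR_le[folded real_norm_def]) auto
  qed (use ab in auto)
  then show ?thesis using ab by (simp add: algebra_simps power2_eq_square)
qed

text \<open>Gronwall's inequality: \<open>\<parallel>y - z\<parallel>\<^sup>2 exp (- 2 L t)\<close> has nonpositive derivative.  The trajectories are
required to lie in the ball only before the final time, because the lemma is applied at the
first time at which one of them could leave it.\<close>

lemma flow_dist_bound:
  fixes y z :: "real \<Rightarrow> 'a::euclidean_space"
  assumes lip: "L-lipschitz_on (cball 0 R) X"
    and sy: "\<And>t. t \<in> {0..T} \<Longrightarrow> (y has_vector_derivative X (y t)) (at t within {0..T})"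
    and sz: "\<And>t. t \<in> {0..T} \<Longrightarrow> (z has_vector_derivative X (z t)) (at t within {0..T})"
    and inb: "\<And>t. t \<in> {0..<T} \<Longrightarrow> y t \<in> cball 0 R" "\<And>t. t \<in> {0..<T} \<Longrightarrow> z t \<in> cball 0 R"
    and T: "0 \<le> T"
  shows "norm (y T - z T) \<le> norm (y 0 - z 0) * exp (L * T)"
proof -
  define u where "u t = y t - z t" for t
  define v where "v t = X (y t) - X (z t)" for t
  define h where "h t = (u t \<bullet> u t) * exp (- (2 * L) * t)" for t
  have du: "(u has_derivative (\<lambda>s. s *\<^sub>R v t)) (at t within {0..T})" if "t \<in> {0..T}" for t
    unfolding u_def v_def using sy[OF that] sz[OF that] unfolding has_vector_derivative_def
    by (auto intro!: derivative_eq_intros simp: algebra_simps)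
  have dh: "(h has_derivative (\<lambda>s. s * (2 * (u t \<bullet> v t) - 2 * L * (u t \<bullet> u t)) * exp (- (2 * L) * t)))
      (at t within {0..T})" if "t \<in> {0..T}" for t
    unfolding h_def
    by (rule derivative_eq_intros du[OF that] refl)+ (simp add: fun_eq_iff algebra_simps inner_commute)
  have "h T \<le> h 0"
  proof (cases "T = 0")
    case False
    with T have T0: "0 < T" by simp
    have cont: "continuous_on {0..T} h"
      using dh has_derivative_continuous continuous_on_eq_continuous_within by blast
    obtain \<xi> where xi: "0 < \<xi>" "\<xi> < T"
      "h T - h 0 = (T - 0) * (2 * (u \<xi> \<bullet> v \<xi>) - 2 * L * (u \<xi> \<bullet> u \<xi>)) * exp (- (2 * L) * \<xi>)"
    proof -
      have "(h has_derivative (\<lambda>s. s * (2 * (u t \<bullet> v t) - 2 * L * (u t \<bullet> u t)) * exp (- (2 * L) * t))) (at t)"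
        if "0 < t" "t < T" for t
        using dh[of t] that at_within_interior[of t "{0..T}"] by (simp add: interior_atLeastAtMost_real)
      from mvt[OF T0 cont this] that show ?thesis by blast
    qed
    have "u \<xi> \<bullet> v \<xi> \<le> norm (u \<xi>) * norm (v \<xi>)" by (rule norm_cauchy_schwarz)
    also have "\<dots> \<le> norm (u \<xi>) * (L * norm (u \<xi>))"
      using lipschitz_onD[OF lip inb(1)[of \<xi>] inb(2)[of \<xi>]] xi
      by (intro mult_left_mono) (auto simp: u_def v_def dist_norm)
    also have "\<dots> = L * (u \<xi> \<bullet> u \<xi>)" by (simp add: dot_square_norm power2_eq_square)
    finally have "(T - 0) * (2 * (u \<xi> \<bullet> v \<xi>) - 2 * L * (u \<xi> \<bullet> u \<xi>)) * exp (- (2 * L) * \<xi>) \<le> 0"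
      using T by (intro mult_nonpos_nonneg mult_nonneg_nonpos) auto
    with xi(3) show ?thesis by simp
  qed simp
  then have "(norm (u T))\<^sup>2 * exp (- (2 * L) * T) \<le> (norm (u 0))\<^sup>2"
    by (simp add: h_def dot_square_norm)
  then have "(norm (u T))\<^sup>2 * exp (- (2 * L) * T) * exp (2 * L * T) \<le> (norm (u 0))\<^sup>2 * exp (2 * L * T)"
    by (rule mult_right_mono) simp
  also have "(norm (u T))\<^sup>2 * exp (- (2 * L) * T) * exp (2 * L * T) = (norm (u T))\<^sup>2"
    by (simp add: mult.assoc flip: exp_add)
  also have "exp (2 * L * T) = (exp (L * T))\<^sup>2" by (simp add: power2_eq_square flip: exp_add)
  finally have "(norm (u T))\<^sup>2 \<le> (norm (u 0) * exp (L * T))\<^sup>2" by (simp add: power_mult_distrib)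
  then show ?thesis unfolding u_def by (rule power2_le_imp_le) simp
qed

definition lipschitz_on_balls :: "('a::euclidean_space \<Rightarrow> 'a) \<Rightarrow> bool" where
  "lipschitz_on_balls X \<longleftrightarrow> (\<forall>R. \<exists>L. L-lipschitz_on (cball 0 R) X)"

text \<open>Continuity of \<open>\<Phi>\<close> in the initial point has to come from the equation.  A trajectory that starts close to
that of \<open>p0\<close> stays within distance \<open>1\<close> of it: up to the first time at which the distance is \<open>1\<close>
both lie in the ball where the Lipschitz constant \<open>L\<close> is valid, so by Gronwall the distance is
below \<open>exp (- L) exp L = 1\<close> at that time as well.\<close>

lemma trajectories_locally_bounded:
  fixes \<Phi> :: "'a::euclidean_space \<Rightarrow> real \<Rightarrow> 'a"
  assumes X: "lipschitz_on_balls X"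
    and ini: "\<And>p. \<Phi> p 0 = p"
    and sol: "\<And>p t. t \<in> {0..1} \<Longrightarrow> (\<Phi> p has_vector_derivative X (\<Phi> p t)) (at t within {0..1})"
  shows "\<exists>r>0. \<exists>R. \<forall>p\<in>ball p0 r. \<forall>t\<in>{0..1}. norm (\<Phi> p t) \<le> R"
proof -
  have cont: "continuous_on {0..1} (\<Phi> p)" for p
    using sol has_vector_derivative_continuous continuous_on_eq_continuous_within by blast
  have "compact (\<Phi> p0 ` {0..1})" by (intro compact_continuous_image cont) simp
  from compact_imp_bounded[OF this] obtain B where "\<forall>x\<in>\<Phi> p0 ` {0..1}. norm x \<le> B"
    unfolding bounded_iff by blast
  then have B: "\<And>t. t \<in> {0..1} \<Longrightarrow> norm (\<Phi> p0 t) \<le> B" by simp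
  obtain L0 where L0: "L0-lipschitz_on (cball 0 (B+1)) X"
    using X unfolding lipschitz_on_balls_def by blast
  define L where "L = max L0 0"
  have lip: "L-lipschitz_on (cball 0 (B+1)) X" using L0 by (rule lipschitz_on_le) (simp add: L_def)
  have L: "L \<ge> 0" by (simp add: L_def)
  have "norm (\<Phi> p t) \<le> B + 1" if p: "p \<in> ball p0 (exp (- L))" and t: "t \<in> {0..1}" for p t
  proof (rule ccontr)
    assume con: "\<not> norm (\<Phi> p t) \<le> B + 1"
    let ?E = "{s \<in> {0..1}. 1 \<le> norm (\<Phi> p s - \<Phi> p0 s)}"
    have "norm (\<Phi> p t) \<le> norm (\<Phi> p0 t) + norm (\<Phi> p t - \<Phi> p0 t)" by (rule norm_triangle_sub)
    then have tE: "t \<in> ?E" using con B[OF t] t by auto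
    have "closed ?E"
      by (intro continuous_closed_preimage_constant continuous_on_closed_Collect_le continuous_intros cont)
    then have cE: "compact ?E" using compact_Int_closed[of "{0..1}" ?E] by (simp add: Int_absorb1 Collect_mono_iff inf.absorb2 subset_iff)
    then obtain T where T: "T \<in> ?E" "\<And>s. s \<in> ?E \<Longrightarrow> T \<le> s"
      using compact_attains_inf[OF cE] tE by blast
    have T01: "{0..T} \<subseteq> {0..1}" using T by auto
    have near: "norm (\<Phi> p s - \<Phi> p0 s) < 1" if "s \<in> {0..<T}" for s
      using T(2)[of s] that T(1) by fastforce
    have "norm (\<Phi> p T - \<Phi> p0 T) \<le> norm (\<Phi> p 0 - \<Phi> p0 0) * exp (L * T)"
    proof (rule flow_dist_bound[OF lip])
      show "(\<Phi> p has_vector_derivative X (\<Phi> p s)) (at s within {0..T})"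
        "(\<Phi> p0 has_vector_derivative X (\<Phi> p0 s)) (at s within {0..T})" if "s \<in> {0..T}" for s
        using sol[of s] that T01 has_vector_derivative_within_subset by blast+
      show "\<Phi> p0 s \<in> cball 0 (B + 1)" if "s \<in> {0..<T}" for s using B[of s] that T(1) by auto
      show "\<Phi> p s \<in> cball 0 (B + 1)" if "s \<in> {0..<T}" for s
        using B[of s] near[OF that] that T(1) norm_triangle_sub[of "\<Phi> p s" "\<Phi> p0 s"] by auto
    qed (use T(1) in auto)
    also have "\<dots> \<le> norm (p - p0) * exp L"
      using T(1) L by (auto simp: ini intro!: mult_left_mono mult_left_le)
    also have "\<dots> < exp (- L) * exp L"
      using p by (intro mult_strict_right_mono) (auto simp: dist_norm norm_minus_commute)
    also have "\<dots> = 1" by (simp flip: exp_add)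
    finally show False using T(1) by auto
  qed
  then show ?thesis by (intro exI[of _ "exp (- L)"] conjI exI[of _ "B + 1"] ballI) auto
qed

lemma trajectories_bounded:
  fixes \<Phi> :: "'a::euclidean_space \<Rightarrow> real \<Rightarrow> 'a"
  assumes X: "lipschitz_on_balls X"
    and ini: "\<And>p. \<Phi> p 0 = p"
    and sol: "\<And>p t. t \<in> {0..1} \<Longrightarrow> (\<Phi> p has_vector_derivative X (\<Phi> p t)) (at t within {0..1})"
    and K: "compact K"
  obtains R where "\<And>p t. p \<in> K \<Longrightarrow> t \<in> {0..1} \<Longrightarrow> norm (\<Phi> p t) \<le> R"
proof -
  have "\<forall>p0. \<exists>r>0. \<exists>R. \<forall>p\<in>ball p0 r. \<forall>t\<in>{0..1}. norm (\<Phi> p t) \<le> R"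
    using trajectories_locally_bounded[OF X ini sol] by blast
  then obtain r R where r: "\<And>p0. r p0 > 0" "\<And>p0 p t. p \<in> ball p0 (r p0) \<Longrightarrow> t \<in> {0..1} \<Longrightarrow> norm (\<Phi> p t) \<le> R p0"
    by metis
  have "K \<subseteq> (\<Union>p\<in>K. ball p (r p))" using r(1) by auto
  then obtain C where C: "C \<subseteq> K" "finite C" "K \<subseteq> (\<Union>p\<in>C. ball p (r p))"
    using compactE_image[OF K, of K "\<lambda>p. ball p (r p)"] by auto
  have "norm (\<Phi> p t) \<le> (\<Sum>c\<in>C. \<bar>R c\<bar>)" if p: "p \<in> K" and t: "t \<in> {0..1}" for p t
  proof -
    obtain c where c: "c \<in> C" "p \<in> ball c (r c)" using C(3) p by blast
    have "norm (\<Phi> p t) \<le> \<bar>R c\<bar>" using r(2)[OF c(2) t] by simp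
    also have "\<dots> \<le> (\<Sum>c\<in>C. \<bar>R c\<bar>)" using C(2) c(1) by (intro member_le_sum) auto
    finally show ?thesis .
  qed
  then show ?thesis using that by blast
qed

context map_monoid begin

lemma funpow_mem: "g \<in> G \<Longrightarrow> g ^^ n \<in> G"
  by (induction n) (auto simp: id_mem[unfolded id_def] id_mem intro: comp_mem)

text \<open>With \<open>g\<close> tangent to \<open>X\<close> at time \<open>h = 1/n\<close>, the iterates of \<open>g\<close> form an Euler scheme.  Each step adds an error at
most \<open>\<eta> h\<close> and amplifies the previous one by at most \<open>1 + L h \<le> exp (L h)\<close>, so after \<open>n\<close> steps the
error is at most \<open>\<eta> exp L\<close>.\<close>

theorem flow_approximable:
  fixes \<Phi> :: "'a \<Rightarrow> real \<Rightarrow> 'a"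
  assumes XT: "X \<in> tangent_fields G" and X: "lipschitz_on_balls X"
    and ini: "\<And>p. \<Phi> p 0 = p"
    and sol: "\<And>p t. t \<in> {0..1} \<Longrightarrow> (\<Phi> p has_vector_derivative X (\<Phi> p t)) (at t within {0..1})"
  shows "approximable_on_compacts (\<lambda>p. \<Phi> p 1) G"
  unfolding approximable_on_compacts_def
proof (intro allI impI)
  fix K :: "'a set" and \<epsilon> :: real assume K: "compact K" and e: "0 < \<epsilon>"
  obtain R where R: "\<And>p t. p \<in> K \<Longrightarrow> t \<in> {0..1} \<Longrightarrow> norm (\<Phi> p t) \<le> R"
    using trajectories_bounded[OF X ini sol K] by blast
  obtain L0 where L0: "L0-lipschitz_on (cball 0 (R+1)) X"
    using X unfolding lipschitz_on_balls_def by blast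
  \<comment> \<open>The extra radius \<open>1\<close> leaves room for the Euler iterates.\<close>
  define L where "L = max L0 0"
  have lip: "L-lipschitz_on (cball 0 (R+1)) X" using L0 by (rule lipschitz_on_le) (simp add: L_def)
  have L: "L \<ge> 0" by (simp add: L_def)
  obtain M where M: "M > 0" "\<And>x. x \<in> cball 0 (R+1) \<Longrightarrow> norm (X x) \<le> M"
    using bounded_on_cball[OF tangent_fields_cont[OF XT]] by metis
  \<comment> \<open>Half of the budget \<open>\<eta>\<close> is for the error of \<open>g\<close>, half for that of the Euler step.\<close>
  define \<eta> where "\<eta> = min 1 \<epsilon> / (2 * exp L)"
  have eta: "\<eta> > 0" using e by (simp add: \<eta>_def)
  have "\<eta> * exp L = min 1 \<epsilon> / 2" by (simp add: \<eta>_def)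
  also have "\<dots> < min 1 \<epsilon>" using e by (simp add: min_def)
  finally have eta2: "\<eta> * exp L < 1" "\<eta> * exp L < \<epsilon>" by simp_all
  obtain \<delta> where d: "\<delta> > 0" "\<And>t. 0 < \<bar>t\<bar> \<Longrightarrow> \<bar>t\<bar> < \<delta> \<Longrightarrow>
      \<exists>g\<in>G. \<forall>x\<in>cball 0 (R+1). norm (g x - x - t *\<^sub>R X x) \<le> \<eta>/2 * \<bar>t\<bar>"
    using tangent_fieldsD[OF XT, of "\<eta>/2"] eta by (metis half_gt_zero)
  have "min \<delta> (\<eta> / (2 * (L * M + 1))) > 0" using d eta L M by (simp add: add_nonneg_pos)
  then obtain n :: nat where n: "n > 0" "1 / real n < min \<delta> (\<eta> / (2 * (L * M + 1)))"
    using ex_inverse_of_nat_less by (metis inverse_eq_divide)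
  define h where "h = 1 / real n"
  have h: "h > 0" "h < \<delta>" "h * real n = 1" using n by (auto simp: h_def)
  have "h < \<eta> / (2 * (L * M + 1))" using n by (simp add: h_def)
  then have "h * (2 * (L * M + 1)) < \<eta>"
    using L M by (subst (asm) pos_less_divide_eq) (auto intro: add_nonneg_pos)
  then have hLM: "L * M * h \<le> \<eta> / 2" using h by (simp add: algebra_simps)
  obtain g where g: "g \<in> G" "\<And>x. x \<in> cball 0 (R+1) \<Longrightarrow> norm (g x - x - h *\<^sub>R X x) \<le> \<eta>/2 * h"
    using d(2)[of h] h by auto
  have err: "norm ((g ^^ k) p - \<Phi> p (real k * h)) \<le> \<eta> * (real k * h) * exp (L * (real k * h))"
    if p: "p \<in> K" and "k \<le> n" for k p
    using \<open>k \<le> n\<close>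
  proof (induction k)
    case 0
    then show ?case by (simp add: ini)
  next
    case (Suc k)
    define e where "e = norm ((g ^^ k) p - \<Phi> p (real k * h))"
    let ?a = "real k * h" and ?b = "real (Suc k) * h" and ?y = "(g ^^ k) p"
    have kn: "real k * h \<le> 1" "real (Suc k) * h \<le> 1"
    proof -
      have "real (Suc k) * h \<le> real n * h" using Suc.prems h by (intro mult_right_mono) auto
      then show "real (Suc k) * h \<le> 1" using h by (simp add: mult.commute)
      then show "real k * h \<le> 1" using h by (simp add: algebra_simps)
    qed
    have ab: "?a \<in> {0..1}" "?b \<in> {0..1}" "?a \<le> ?b" "?b - ?a = h"
      using kn h by (auto simp: algebra_simps)
    have IH: "e \<le> \<eta> * ?a * exp (L * ?a)" using Suc by (simp add: e_def)
    also have "\<dots> \<le> \<eta> * 1 * exp (L * 1)"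
      using eta L h kn by (intro mult_mono) (auto intro: mult_left_le)
    finally have e1: "e < 1" using eta2 by simp
    have inP: "\<Phi> p ?a \<in> cball 0 (R+1)" using R[OF p ab(1)] by simp
    have "norm ?y \<le> norm (\<Phi> p ?a) + e" unfolding e_def by (rule norm_triangle_sub)
    then have inY: "?y \<in> cball 0 (R+1)" using R[OF p ab(1)] e1 by simp
    have 1: "norm (\<Phi> p ?b - \<Phi> p ?a - h *\<^sub>R X (\<Phi> p ?a)) \<le> L * M * h\<^sup>2"
    proof -
      have "\<Phi> p t \<in> cball 0 (R+1)" if "t \<in> {0..1}" for t using R[OF p that] by simp
      then show ?thesis
        using flow_step_bound[OF lip L M(2) sol _ ab(1-3), of p] unfolding ab(4) by blast
    qed
    have 2: "norm (h *\<^sub>R (X ?y - X (\<Phi> p ?a))) \<le> (L * e) * \<bar>h\<bar>"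
      using lipschitz_onD[OF lip inY inP] by (intro norm_scaleR_le) (simp add: dist_norm e_def)
    have "L * M * h * h \<le> \<eta> / 2 * h" using hLM h by (intro mult_right_mono) auto
    then have sq: "L * M * h\<^sup>2 \<le> \<eta> * h / 2" by (simp add: power2_eq_square mult.assoc)
    have "(g ^^ Suc k) p - \<Phi> p ?b = (g ?y - ?y - h *\<^sub>R X ?y) + (?y - \<Phi> p ?a)
        + h *\<^sub>R (X ?y - X (\<Phi> p ?a)) + (- (\<Phi> p ?b - \<Phi> p ?a - h *\<^sub>R X (\<Phi> p ?a)))"
      by (simp add: algebra_simps)
    moreover have "norm ((g ?y - ?y - h *\<^sub>R X ?y) + (?y - \<Phi> p ?a)
        + h *\<^sub>R (X ?y - X (\<Phi> p ?a)) + (- (\<Phi> p ?b - \<Phi> p ?a - h *\<^sub>R X (\<Phi> p ?a))))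
        \<le> \<eta>/2 * h + e + (L * e) * \<bar>h\<bar> + L * M * h\<^sup>2"
      by (intro norm_triangle_le add_mono g(2) inY 2) (use 1 in \<open>simp_all only: norm_minus_cancel e_def order_refl\<close>)
    ultimately have "norm ((g ^^ Suc k) p - \<Phi> p ?b) \<le> \<eta>/2 * h + e + (L * e) * \<bar>h\<bar> + L * M * h\<^sup>2"
      by metis
    also have "\<dots> \<le> e * (1 + L * h) + \<eta> * h"
      using sq h by (simp add: algebra_simps)
    also have "\<dots> \<le> (\<eta> * ?a * exp (L * ?a)) * exp (L * h) + \<eta> * h * exp (L * ?b)"
    proof (rule add_mono)
      have "0 \<le> e" by (simp add: e_def)
      then show "e * (1 + L * h) \<le> (\<eta> * ?a * exp (L * ?a)) * exp (L * h)"
        using IH L h by (intro mult_mono exp_ge_add_one_self) auto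
      have "0 \<le> L * ?b" using L h by simp
      then show "\<eta> * h \<le> \<eta> * h * exp (L * ?b)"
        using mult_left_mono[of 1 "exp (L * ?b)" "\<eta> * h"] eta h by simp
    qed
    also have "\<dots> = \<eta> * ?b * exp (L * ?b)"
      by (simp add: algebra_simps exp_add)
    finally show ?case .
  qed
  have "dist (\<Phi> p 1) ((g ^^ n) p) < \<epsilon>" if p: "p \<in> K" for p
    using err[OF p order_refl] h(3) eta2(2) by (simp add: dist_norm norm_minus_commute mult.commute)
  then show "\<exists>g\<in>G. \<forall>p\<in>K. dist (\<Phi> p 1) (g p) < \<epsilon>"
    using funpow_mem[OF g(1)] by blast
qed

text \<open>A linear field with \<open>X \<circ> X = 0\<close> is constant along its trajectories, which are straight lines.\<close>

lemma linear_field_flow_mem: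
  assumes XT: "X \<in> tangent_fields G" and X: "linear X" and nil: "\<And>x. X (X x) = 0"
  shows "(\<lambda>x. x + s *\<^sub>R X x) \<in> continuous_closure G"
proof -
  have lin: "bounded_linear (\<lambda>x. s *\<^sub>R X x)"
    using X by (simp add: linear_conv_bounded_linear bounded_linear_scaleR_const bounded_linear_const_scaleR)
  obtain L where L: "0 \<le> L" "\<And>x. norm (s *\<^sub>R X x) \<le> norm x * L"
    using bounded_linear.nonneg_bounded[OF lin] by blast
  have "L-lipschitz_on UNIV (\<lambda>x. s *\<^sub>R X x)"
  proof (rule lipschitz_onI[OF _ L(1)])
    show "dist (s *\<^sub>R X x) (s *\<^sub>R X y) \<le> L * dist x y" for x y
      using L(2)[of "x - y"]
      by (simp add: dist_norm linear_diff[OF X] scaleR_diff_right mult.commute)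
  qed
  then have lip: "lipschitz_on_balls (\<lambda>x. s *\<^sub>R X x)"
    unfolding lipschitz_on_balls_def using lipschitz_on_subset by blast
  have "approximable_on_compacts (\<lambda>x. (\<lambda>p t. p + t *\<^sub>R s *\<^sub>R X p) x 1) G"
  proof (rule flow_approximable[OF tangent_fields_scale[OF XT, of s] lip])
    fix p t
    have "s *\<^sub>R X (p + t *\<^sub>R s *\<^sub>R X p) = s *\<^sub>R X p"
      by (simp add: linear_add[OF X] linear_scale[OF X] nil)
    then show "((\<lambda>t. p + t *\<^sub>R s *\<^sub>R X p) has_vector_derivative s *\<^sub>R X (p + t *\<^sub>R s *\<^sub>R X p)) (at t within {0..1})"
      by (auto intro!: derivative_eq_intros)
  qed simp
  then show ?thesis
    unfolding continuous_closure_def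
    by (auto intro!: continuous_intros linear_continuous_on[OF lin])
qed

end

section \<open>Remez-type bounds and superexponential decay\<close>

text \<open>Take the least point of \<open>E\<close>, discard everything closer than \<open>\<delta>\<close> to it, which costs measure at most \<open>\<delta>\<close>, and repeat.\<close>

lemma separated_points:
  fixes E :: "real set"
  assumes "compact E" "0 < \<delta>" "real k * \<delta> < measure lborel E"
  shows "\<exists>x :: nat \<Rightarrow> real. (\<forall>i\<le>k. x i \<in> E) \<and> (\<forall>i<k. x i + \<delta> \<le> x (Suc i))"
  using assms
proof (induction k arbitrary: E)
  case 0
  then have "E \<noteq> {}" by auto
  then obtain e where "e \<in> E" by blast
  then show ?case by (intro exI[of _ "\<lambda>_. e"]) simp
next
  case (Suc k)
  have "0 \<le> real (Suc k) * \<delta>" using Suc.prems by simp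
  then have "E \<noteq> {}" using Suc.prems(3) by auto
  then obtain a where a: "a \<in> E" "\<And>x. x \<in> E \<Longrightarrow> a \<le> x"
    using compact_attains_inf[OF Suc.prems(1)] by blast
  let ?E = "E \<inter> {a + \<delta>..}"
  have cE: "compact ?E" using Suc.prems(1) by (intro compact_Int_closed) auto
  have sets: "E \<in> sets lborel" "?E \<in> sets lborel"
    using Suc.prems(1) cE by (auto simp: borel_compact)
  have "E \<subseteq> ?E \<union> {a..a + \<delta>}" using a(2) by auto
  then have "measure lborel E \<le> measure lborel (?E \<union> {a..a + \<delta>})"
    using cE by (intro measure_mono_fmeasurable sets fmeasurable.Un fmeasurable_compact fmeasurable_cbox) auto
  also have "\<dots> \<le> measure lborel ?E + measure lborel {a..a + \<delta>}"
    using sets by (intro measure_Un_le) auto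
  also have "measure lborel {a..a + \<delta>} = \<delta>" using Suc.prems(2) by simp
  finally have "real k * \<delta> < measure lborel ?E" using Suc.prems(3) by (simp add: algebra_simps)
  from Suc.IH[OF cE Suc.prems(2) this] obtain x where
    x: "\<forall>i\<le>k. x i \<in> ?E" "\<forall>i<k. x i + \<delta> \<le> x (Suc i)" by blast
  define y where "y i = (case i of 0 \<Rightarrow> a | Suc j \<Rightarrow> x j)" for i
  have "y i \<in> E" if "i \<le> Suc k" for i
    using that x(1) a(1) by (auto simp: y_def split: nat.split)
  moreover have "y i + \<delta> \<le> y (Suc i)" if "i < Suc k" for i
    using that x by (auto simp: y_def split: nat.split)
  ultimately show ?case by blast
qed

lemma separated_dist:
  fixes x :: "nat \<Rightarrow> real"
  assumes "\<And>i. i < k \<Longrightarrow> x i + \<delta> \<le> x (Suc i)" "i \<le> j" "j \<le> k"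
  shows "real (j - i) * \<delta> \<le> x j - x i"
  using assms(2,3)
proof (induction j rule: dec_induct)
  case (step n)
  then show ?case using assms(1)[of n] by (simp add: Suc_diff_le algebra_simps)
qed simp

lemma lagrange_interpolation:
  fixes q :: "real poly"
  assumes "degree q \<le> d" "inj_on x {..d}"
  shows "poly q t = (\<Sum>i\<le>d. poly q (x i) * (\<Prod>j\<in>{..d} - {i}. (t - x j) / (x i - x j)))"
proof -
  define l where "l i = (\<Prod>j\<in>{..d} - {i}. smult (1 / (x i - x j)) [:- x j, 1:])" for i
  define p where "p = (\<Sum>i\<le>d. smult (poly q (x i)) (l i))"
  have l: "poly (l i) t = (\<Prod>j\<in>{..d} - {i}. (t - x j) / (x i - x j))" for i t
    unfolding l_def poly_prod by (intro prod.cong refl) (simp add: diff_divide_distrib)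
  have degl: "degree (l i) \<le> d" if "i \<le> d" for i
  proof -
    have "degree (l i) \<le> (\<Sum>j\<in>{..d} - {i}. degree (smult (1 / (x i - x j)) [:- x j, 1:]))"
      unfolding l_def by (rule order_trans[OF degree_prod_sum_le]) (simp_all only: o_def finite_Diff finite_atMost order_refl)
    also have "\<dots> \<le> (\<Sum>j\<in>{..d} - {i}. 1)"
      by (intro sum_mono order_trans[OF degree_smult_le]) simp
    also have "\<dots> = d" using that by simp
    finally show ?thesis .
  qed
  have lx: "poly (l i) (x k) = (if i = k then 1 else 0)" if "i \<le> d" "k \<le> d" for i k
  proof (cases "i = k")
    case True
    have "x k - x j \<noteq> 0" if "j \<in> {..d} - {k}" for j
      using that \<open>k \<le> d\<close> assms(2) by (auto simp: inj_on_def)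
    then show ?thesis using True by (simp add: l)
  next
    case False
    then show ?thesis using that by (auto simp: l intro!: prod_zero)
  qed
  have "poly p (x k) = poly q (x k)" if "k \<le> d" for k
  proof -
    have "poly p (x k) = (\<Sum>i\<le>d. poly q (x i) * (if i = k then 1 else 0))"
      using that by (simp add: p_def poly_sum lx)
    also have "\<dots> = poly q (x k)" using that by (simp add: mult_delta_right)
    finally show ?thesis .
  qed
  moreover have "degree p \<le> d"
    unfolding p_def by (intro degree_sum_le order_trans[OF degree_smult_le] degl) auto
  moreover have "card (x ` {..d}) = Suc d" using assms(2) by (simp add: card_image)
  ultimately have "q = p" using assms(1)
    by (intro poly_eqI_degree[of "x ` {..d}"]) auto
  then have "poly q t = poly p t" by simp
  then show ?thesis by (simp add: p_def poly_sum l)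
qed

lemma power_le_fact_exp: "0 \<le> x \<Longrightarrow> x ^ n \<le> fact n * exp (x::real)"
proof -
  assume x: "0 \<le> x"
  have "(\<Sum>i\<in>{n}. x ^ i /\<^sub>R fact i) \<le> (\<Sum>i. x ^ i /\<^sub>R fact i)"
    using x by (intro sum_le_suminf summable_exp_generic) auto
  then show ?thesis by (simp add: exp_def divide_simps mult.commute)
qed

text \<open>A set of measure at least \<open>1\<close> contains \<open>d + 1\<close> points with successive gaps at least \<open>1 / (2 (d + 1))\<close>.  In the Lagrange
formula for these nodes the denominators are bounded below by \<open>i! (d - i)!\<close> times a power of the
gap, and \<open>(2 (d + 1))\<^sup>d / d!\<close> grows only exponentially in \<open>d\<close>.  What matters is that the base of the
exponential depends on \<open>R\<close> alone and not on the shape of \<open>E\<close>.\<close>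

lemma remez_bound:
  fixes q :: "real poly"
  assumes E: "compact E" "E \<subseteq> {-R..R}" "1 \<le> measure lborel E"
    and q: "degree q \<le> d" "\<And>x. x \<in> E \<Longrightarrow> \<bar>poly q x\<bar> \<le> M"
    and t: "t \<in> {-R..R}" and R: "R \<ge> 0"
  shows "\<bar>poly q t\<bar> \<le> M * (exp 2 * (8 * R * exp 2) ^ d)"
proof -
  define \<delta> where "\<delta> = 1 / (2 * real (Suc d))"
  have \<delta>: "\<delta> > 0" by (simp add: \<delta>_def)
  have "real d * \<delta> < 1" by (simp add: \<delta>_def)
  then obtain x where x: "\<And>i. i \<le> d \<Longrightarrow> x i \<in> E" "\<And>i. i < d \<Longrightarrow> x i + \<delta> \<le> x (Suc i)"
    using separated_points[OF E(1) \<delta>, of d] E(3) by fastforce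
  have M: "M \<ge> 0" using q(2)[OF x(1)[of 0]] by simp
  have sep: "\<bar>real i - real j\<bar> * \<delta> \<le> \<bar>x i - x j\<bar>" if "i \<le> d" "j \<le> d" for i j
  proof (cases "i \<le> j")
    case True
    then show ?thesis using separated_dist[of d x \<delta> i j, OF x(2)] that by (simp add: of_nat_diff)
  next
    case False
    then show ?thesis using separated_dist[of d x \<delta> j i, OF x(2)] that by (simp add: of_nat_diff)
  qed
  have "inj_on x {..d}"
  proof (rule inj_onI)
    fix i j assume "i \<in> {..d}" "j \<in> {..d}" "x i = x j"
    then show "i = j" using sep[of i j] \<delta> by (auto simp: mult_le_0_iff)
  qed
  note L = lagrange_interpolation[OF q(1) this, of t]
  have term_bound: "\<bar>poly q (x i) * (\<Prod>j\<in>{..d} - {i}. (t - x j) / (x i - x j))\<bar>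
      \<le> M * ((2 * R / \<delta>) ^ d * (2 ^ d / fact d))" if i: "i \<le> d" for i
  proof -
    have "\<bar>\<Prod>j\<in>{..d} - {i}. (t - x j) / (x i - x j)\<bar> \<le>
        (\<Prod>j\<in>{..d} - {i}. (2 * R / \<delta>) * (1 / \<bar>real i - real j\<bar>))"
      unfolding abs_prod
    proof (intro prod_mono conjI)
      fix j assume j: "j \<in> {..d} - {i}"
      have "\<bar>t - x j\<bar> \<le> 2 * R" using t E(2) x(1)[of j] j by fastforce
      moreover have "\<bar>real i - real j\<bar> * \<delta> > 0" using j \<delta> by auto
      ultimately have "\<bar>t - x j\<bar> / \<bar>x i - x j\<bar> \<le> (2 * R) / (\<bar>real i - real j\<bar> * \<delta>)"
        using sep[of i j] i j by (intro frac_le) auto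
      then show "\<bar>(t - x j) / (x i - x j)\<bar> \<le> (2 * R / \<delta>) * (1 / \<bar>real i - real j\<bar>)"
        by (simp add: mult.commute)
    qed auto
    also have "\<dots> = (2 * R / \<delta>) ^ d / (\<Prod>j\<in>{..d} - {i}. \<bar>real i - real j\<bar>)"
      using i by (simp add: prod.distrib prod_dividef power_divide)
    also have "(\<Prod>j\<in>{..d} - {i}. \<bar>real i - real j\<bar>) = fact i * fact (d - i)"
    proof -
      have "{..d} - {i} = {..<i} \<union> {i<..d}" using i by auto
      then have "(\<Prod>j\<in>{..d} - {i}. \<bar>real i - real j\<bar>) =
          (\<Prod>j\<in>{..<i}. \<bar>real i - real j\<bar>) * (\<Prod>j\<in>{i<..d}. \<bar>real i - real j\<bar>)"
        by (simp add: prod.union_disjoint disjoint_iff)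
      also have "(\<Prod>j\<in>{..<i}. \<bar>real i - real j\<bar>) = (\<Prod>k\<in>{1..i}. real k)"
        by (rule prod.reindex_bij_witness[of _ "\<lambda>k. i - k" "\<lambda>j. i - j"]) (auto simp: of_nat_diff)
      also have "(\<Prod>j\<in>{i<..d}. \<bar>real i - real j\<bar>) = (\<Prod>k\<in>{1..d - i}. real k)"
        by (rule prod.reindex_bij_witness[of _ "\<lambda>k. i + k" "\<lambda>j. j - i"]) (auto simp: of_nat_diff)
      finally show ?thesis by (simp add: fact_prod)
    qed
    also have "(2 * R / \<delta>) ^ d / (fact i * fact (d - i)) = (2 * R / \<delta>) ^ d * (real (d choose i) / fact d)"
      using i binomial_fact[OF i, where 'a = real] by simp
    also have "\<dots> \<le> (2 * R / \<delta>) ^ d * (2 ^ d / fact d)"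
    proof (intro mult_left_mono divide_right_mono)
      show "real (d choose i) \<le> 2 ^ d" using binomial_le_pow2[of d i] by (metis of_nat_le_iff of_nat_numeral of_nat_power)
    qed (use R \<delta> in auto)
    finally show ?thesis
      unfolding abs_mult using q(2)[OF x(1)[OF i]] M by (intro mult_mono) auto
  qed
  have "\<bar>poly q t\<bar> \<le> (\<Sum>i\<le>d. M * ((2 * R / \<delta>) ^ d * (2 ^ d / fact d)))"
    unfolding L by (rule order_trans[OF sum_abs]) (intro sum_mono term_bound, simp)
  also have "\<dots> = M * (real (Suc d) * (4 * R) ^ d * ((2 * real (Suc d)) ^ d / fact d))"
  proof -
    have "2 * R / \<delta> * 2 = 4 * R * (2 * real (Suc d))" by (simp add: \<delta>_def)
    then have "(2 * R / \<delta>) ^ d * 2 ^ d = (4 * R) ^ d * (2 * real (Suc d)) ^ d"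
      by (simp only: power_mult_distrib[symmetric])
    then have "(2 * R / \<delta>) ^ d * (2 ^ d / fact d) = (4 * R) ^ d * ((2 * real (Suc d)) ^ d / fact d)"
      by (simp only: times_divide_eq_right)
    then show ?thesis by simp
  qed
  also have "\<dots> \<le> M * (2 ^ d * (4 * R) ^ d * exp (2 * real (Suc d)))"
  proof (intro mult_left_mono[OF _ M] mult_mono)
    have "Suc d \<le> 2 ^ d" by (induction d) auto
    then show "real (Suc d) \<le> 2 ^ d" by (metis of_nat_le_iff of_nat_numeral of_nat_power)
    show "(2 * real (Suc d)) ^ d / fact d \<le> exp (2 * real (Suc d))"
      using power_le_fact_exp[of "2 * real (Suc d)" d] by (simp add: divide_simps mult.commute)
  qed (use R in auto)
  also have "exp (2 * real (Suc d)) = exp 2 * exp 2 ^ d"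
    by (simp add: exp_add algebra_simps flip: exp_of_nat2_mult)
  also have "M * (2 ^ d * (4 * R) ^ d * (exp 2 * exp 2 ^ d)) = M * (exp 2 * (2 * (4 * R) * exp 2) ^ d)"
    unfolding power_mult_distrib by (simp only: mult_ac)
  also have "2 * (4 * R) = 8 * R" by simp
  finally show ?thesis .
qed

text \<open>The sets \<open>E c\<close> on which the decay at rate \<open>N K\<close> holds with constant \<open>c\<close> exhaust the interval, so one of
them has measure at least \<open>1\<close>.  There the Remez inequality applies and costs a factor \<open>K\<^sup>d\<close>, which
the rate \<open>N K\<close> can afford.  Bounding a whole family indexed by \<open>I\<close> at once allows the
iteration over coordinates in the next lemma.\<close>

lemma superexponential_decay_interval:
  fixes q :: "nat \<Rightarrow> 'i \<Rightarrow> real poly"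
  assumes deg: "\<And>d i. i \<in> I \<Longrightarrow> degree (q d i) \<le> d"
    and pw: "\<And>N t. N \<ge> 1 \<Longrightarrow> \<exists>C. \<forall>d. \<forall>i\<in>I. \<bar>poly (q d i) t\<bar> * N ^ d \<le> C"
    and R: "R \<ge> 1" and N: "N \<ge> 1"
  shows "\<exists>C. \<forall>d. \<forall>i\<in>I. \<forall>t\<in>{-R..R}. \<bar>poly (q d i) t\<bar> * N ^ d \<le> C"
proof -
  define K where "K = 8 * R * exp 2"
  have "1 * 1 * 1 \<le> 8 * R * exp 2" using R by (intro mult_mono) auto
  then have K: "K \<ge> 1" by (simp add: K_def)
  have N': "N * K \<ge> 1" using N K mult_mono[of 1 N 1 K] by simp
  define E where "E c = {t \<in> {-R..R}. \<forall>d. \<forall>i\<in>I. \<bar>poly (q d i) t\<bar> * (N * K) ^ d \<le> real c}" for c :: nat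
  have cE: "compact (E c)" for c
  proof -
    have "E c = {-R..R} \<inter> (\<Inter>d. \<Inter>i\<in>I. {t. \<bar>poly (q d i) t\<bar> * (N * K) ^ d \<le> real c})"
      by (auto simp: E_def)
    also have "compact \<dots>"
      by (intro compact_Int_closed closed_INT ballI closed_Collect_le continuous_intros) auto
    finally show ?thesis .
  qed
  have U: "(\<Union>c. E c) = {-R..R}"
  proof -
    have "\<exists>c. t \<in> E c" if t: "t \<in> {-R..R}" for t
    proof -
      obtain C where C: "\<forall>d. \<forall>i\<in>I. \<bar>poly (q d i) t\<bar> * (N * K) ^ d \<le> C" using pw[OF N'] by blast
      obtain c :: nat where "C \<le> real c" using real_arch_simple by blast
      with C t show ?thesis unfolding E_def by (intro exI[of _ c]) (auto intro: order_trans)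
    qed
    then show ?thesis by (auto simp: E_def)
  qed
  have "(\<lambda>c. measure lborel (E c)) \<longlonglongrightarrow> measure lborel (\<Union>c. E c)"
  proof (rule Lim_measure_incseq)
    show "range E \<subseteq> sets lborel" using cE borel_compact by auto
    show "incseq E" by (rule incseq_SucI) (auto simp: E_def intro: add_increasing)
  qed (simp add: U emeasure_lborel_Icc_eq)
  also have "measure lborel (\<Union>c. E c) = 2 * R" using R by (simp add: U)
  finally have "\<forall>\<^sub>F c in sequentially. 1 < measure lborel (E c)"
    using R by (intro order_tendstoD) auto
  then obtain c where c: "1 < measure lborel (E c)"
    by (meson eventually_happens' sequentially_bot)
  have "\<bar>poly (q d i) t\<bar> * N ^ d \<le> real c * exp 2" if i: "i \<in> I" and t: "t \<in> {-R..R}" for d i t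
  proof -
    have pos: "(N * K) ^ d > 0" using N' by simp
    have "\<bar>poly (q d i) t\<bar> \<le> (real c / (N * K) ^ d) * (exp 2 * (8 * R * exp 2) ^ d)"
    proof (rule remez_bound[OF cE _ _ deg[OF i] _ t])
      show "\<bar>poly (q d i) x\<bar> \<le> real c / (N * K) ^ d" if "x \<in> E c" for x
        using that i pos by (simp add: E_def pos_le_divide_eq)
    qed (use c R in \<open>auto simp: E_def\<close>)
    also have "\<dots> = real c * exp 2 / N ^ d"
      using K by (simp add: K_def[symmetric] power_mult_distrib)
    finally show ?thesis using N by (simp add: pos_le_divide_eq)
  qed
  then show ?thesis by blast
qed

text \<open>Induction over the directions in \<open>B\<close>: on every line in a new direction, the functions restricted to the
translates by the directions already treated form a family to which the one-dimensional statement applies.\<close>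

lemma superexponential_decay_box:
  fixes P :: "nat \<Rightarrow> 'a::euclidean_space \<Rightarrow> real"
  assumes B: "finite B"
    and line: "\<And>d p b. b \<in> B \<Longrightarrow> \<exists>q. degree q \<le> d \<and> (\<forall>t. P d (p + t *\<^sub>R b) = poly q t)"
    and pw: "\<And>N p. N \<ge> 1 \<Longrightarrow> \<exists>C. \<forall>d. \<bar>P d p\<bar> * N ^ d \<le> C"
    and R: "R \<ge> 1"
  shows "N \<ge> 1 \<Longrightarrow> \<exists>C. \<forall>d. \<forall>c. (\<forall>b\<in>B. \<bar>c b\<bar> \<le> R) \<longrightarrow> \<bar>P d (p + (\<Sum>b\<in>B. c b *\<^sub>R b))\<bar> * N ^ d \<le> C"
  using B line
proof (induction B arbitrary: p N rule: finite_induct)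
  case empty
  then show ?case using pw by simp
next
  case (insert b B)
  define I where "I = {c. \<forall>b\<in>B. \<bar>c b\<bar> \<le> R}"
  have "\<forall>d c. \<exists>q. degree q \<le> d \<and> (\<forall>t. P d ((p + (\<Sum>b\<in>B. c b *\<^sub>R b)) + t *\<^sub>R b) = poly q t)"
    using insert.prems(2) by blast
  then obtain q where q: "\<And>d c. degree (q d c) \<le> d"
    "\<And>d c t. P d ((p + (\<Sum>b\<in>B. c b *\<^sub>R b)) + t *\<^sub>R b) = poly (q d c) t"
    by metis
  have "\<exists>C. \<forall>d. \<forall>c\<in>I. \<forall>t\<in>{-R..R}. \<bar>poly (q d c) t\<bar> * N ^ d \<le> C"
  proof (rule superexponential_decay_interval[OF q(1) _ R insert.prems(1)])
    fix N' t :: real assume "N' \<ge> 1"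
    then show "\<exists>C. \<forall>d. \<forall>c\<in>I. \<bar>poly (q d c) t\<bar> * N' ^ d \<le> C"
      using insert.IH[of N' "p + t *\<^sub>R b"] insert.prems(2) unfolding I_def q(2)[symmetric]
      by (simp add: algebra_simps)
  qed
  then obtain C where C: "\<And>d c t. c \<in> I \<Longrightarrow> t \<in> {-R..R} \<Longrightarrow> \<bar>poly (q d c) t\<bar> * N ^ d \<le> C" by blast
  have "\<bar>P d (p + (\<Sum>b\<in>insert b B. c b *\<^sub>R b))\<bar> * N ^ d \<le> C" if "\<forall>b\<in>insert b B. \<bar>c b\<bar> \<le> R" for d c
  proof -
    have "c \<in> I" "c b \<in> {-R..R}" using that by (auto simp: I_def)
    moreover have "P d (p + (\<Sum>b\<in>insert b B. c b *\<^sub>R b)) = poly (q d c) (c b)"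
      unfolding q(2)[symmetric] using insert.hyps by (simp add: algebra_simps)
    ultimately show ?thesis using C by metis
  qed
  then show ?case by blast
qed

section \<open>Everywhere convergent series of homogeneous polynomial fields\<close>

text \<open>Being polynomial of degree at most \<open>d\<close> is asked for on lines only, since all estimates are
made there.\<close>

definition entire_series :: "(nat \<Rightarrow> 'a::euclidean_space \<Rightarrow> 'a) \<Rightarrow> bool" where
  "entire_series F \<longleftrightarrow>
     (\<forall>d p b e. \<exists>q. degree q \<le> d \<and> (\<forall>t. F d (p + t *\<^sub>R b) \<bullet> e = poly q t)) \<and>
     (\<forall>d s p. F d (s *\<^sub>R p) = s ^ d *\<^sub>R F d p) \<and>
     (\<forall>p. summable (\<lambda>d. norm (F d p)))"

context
  fixes F :: "nat \<Rightarrow> 'a::euclidean_space \<Rightarrow> 'a"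
  assumes F: "entire_series F"
begin

lemma entire_series_line: "\<exists>q. degree q \<le> d \<and> (\<forall>t. F d (p + t *\<^sub>R b) \<bullet> e = poly q t)"
  and entire_series_homogeneous: "F d (s *\<^sub>R p) = s ^ d *\<^sub>R F d p"
  and entire_series_summable: "summable (\<lambda>d. norm (F d p))"
  using F unfolding entire_series_def by blast+

text \<open>Summability at \<open>N p\<close> bounds \<open>F d (N p) = N\<^sup>d F d p\<close>.\<close>

lemma entire_series_pointwise_decay:
  assumes "N \<ge> 1"
  shows "\<exists>C. \<forall>d. \<bar>F d p \<bullet> e\<bar> * N ^ d \<le> C"
proof -
  have "(\<lambda>d. norm (F d (N *\<^sub>R p))) \<longlonglongrightarrow> 0"
    by (rule summable_LIMSEQ_zero[OF entire_series_summable])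
  then have "Bseq (\<lambda>d. norm (F d (N *\<^sub>R p)))" by (rule convergent_imp_Bseq[OF convergentI])
  then obtain C where C: "\<And>d. norm (F d (N *\<^sub>R p)) \<le> C" unfolding Bseq_def by auto
  have "\<bar>F d p \<bullet> e\<bar> * N ^ d \<le> C * norm e" for d
  proof -
    have "\<bar>F d p \<bullet> e\<bar> * N ^ d \<le> (norm (F d p) * norm e) * N ^ d"
      using assms by (intro mult_right_mono Cauchy_Schwarz_ineq2) auto
    also have "\<dots> = norm (F d (N *\<^sub>R p)) * norm e"
      using assms by (simp add: entire_series_homogeneous)
    also have "\<dots> \<le> C * norm e" using C by (intro mult_right_mono) auto
    finally show ?thesis .
  qed
  then show ?thesis by blast
qed

lemma entire_series_uniform_decay:
  assumes N: "N \<ge> 1"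
  shows "\<exists>C. \<forall>d. \<forall>p\<in>cball 0 R. norm (F d p) * N ^ d \<le> C"
proof -
  define R' where "R' = max R 1"
  have R': "R' \<ge> 1" "R \<le> R'" by (simp_all add: R'_def)
  have "\<forall>e. \<exists>C. \<forall>d. \<forall>c. (\<forall>b\<in>Basis. \<bar>c b\<bar> \<le> R') \<longrightarrow>
      \<bar>F d (0 + (\<Sum>b\<in>Basis. c b *\<^sub>R b)) \<bullet> e\<bar> * N ^ d \<le> C"
    by (intro allI superexponential_decay_box[where P = "\<lambda>d x. F d x \<bullet> e" for e]
        finite_Basis entire_series_line entire_series_pointwise_decay R' N)
  then obtain C where C: "\<And>e d c. (\<forall>b\<in>Basis. \<bar>c b\<bar> \<le> R') \<Longrightarrow>
      \<bar>F d (0 + (\<Sum>b\<in>Basis. c b *\<^sub>R b)) \<bullet> e\<bar> * N ^ d \<le> C e" by metis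
  have "norm (F d p) * N ^ d \<le> (\<Sum>e\<in>Basis. C e)" if p: "p \<in> cball 0 R" for d p
  proof -
    have "\<bar>F d p \<bullet> e\<bar> * N ^ d \<le> C e" for e
    proof -
      have "\<bar>p \<bullet> b\<bar> \<le> R'" if "b \<in> Basis" for b
        using Basis_le_norm[OF that, of p] p R' by auto
      then show ?thesis using C[of "\<lambda>b. p \<bullet> b" d e] by (simp add: euclidean_representation)
    qed
    then have "(\<Sum>e\<in>Basis. \<bar>F d p \<bullet> e\<bar> * N ^ d) \<le> (\<Sum>e\<in>Basis. C e)" by (intro sum_mono)
    moreover have "norm (F d p) * N ^ d \<le> (\<Sum>e\<in>Basis. \<bar>F d p \<bullet> e\<bar>) * N ^ d"
      using N by (intro mult_right_mono norm_le_l1) auto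
    ultimately show ?thesis by (simp add: sum_distrib_right)
  qed
  then show ?thesis by blast
qed

lemma entire_series_dominated:
  "\<exists>M. summable M \<and> (\<forall>d. \<forall>p\<in>cball 0 R. norm (F d p) \<le> M d)"
proof -
  obtain C where C: "\<And>d p. p \<in> cball 0 R \<Longrightarrow> norm (F d p) * 2 ^ d \<le> C"
    using entire_series_uniform_decay[of 2 R] by (metis one_le_numeral)
  have "summable (\<lambda>d. C * (1/2) ^ d)" by (intro summable_mult summable_geometric) simp
  moreover have "norm (F d p) \<le> C * (1/2) ^ d" if "p \<in> cball 0 R" for d p
    using C[OF that, of d] by (simp add: power_one_over pos_le_divide_eq)
  ultimately show ?thesis by blast
qed

text \<open>On the line through \<open>x\<close> in the direction of \<open>y - x\<close>, the difference quotient of a component of \<open>F d\<close>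
is a polynomial \<open>g\<close> of degree at most \<open>d\<close> in the parameter.  For parameters in \<open>[1,2]\<close> it is bounded by
values of \<open>F d\<close>, and the Remez inequality carries this bound over to parameters near \<open>0\<close>.  The factor \<open>K\<^sup>d\<close> that
is lost is compensated by decay of \<open>F d\<close> at rate \<open>2 K\<close>.\<close>

lemma entire_series_lipschitz:
  "\<exists>L. summable L \<and> (\<forall>d. 0 \<le> L d) \<and>
     (\<forall>d. \<forall>x\<in>cball 0 R. \<forall>y\<in>cball 0 R. norm (F d y - F d x) \<le> L d * norm (y - x))"
proof -
  define R1 where "R1 = max R 0"
  define S where "S = 2 * R1 + 2"
  define K where "K = 8 * S * exp 2"
  have S: "S \<ge> 2" "R1 \<ge> 0" "R \<le> R1" by (simp_all add: S_def R1_def)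
  have "1 * 1 * 1 \<le> 8 * S * exp 2" using S by (intro mult_mono) auto
  then have K: "K \<ge> 1" by (simp add: K_def)
  then have N: "2 * K \<ge> 1" by simp
  obtain C where C: "\<And>d p. p \<in> cball 0 (R1 + 2) \<Longrightarrow> norm (F d p) * (2 * K) ^ d \<le> C"
    using entire_series_uniform_decay[OF N, of "R1 + 2"] by blast
  have "0 \<le> norm (F 0 0) * (2 * K) ^ 0" by simp
  also have "\<dots> \<le> C" using C[of 0 0] S by auto
  finally have C0: "C \<ge> 0" .
  define c where "c = 2 * C * exp 2 * real DIM('a)"
  have comp: "\<bar>(F d y - F d x) \<bullet> e\<bar> \<le> (2 * C * exp 2 * (1/2) ^ d) * norm (y - x)"
    if x: "x \<in> cball 0 R" and y: "y \<in> cball 0 R" and e: "e \<in> Basis" for d x y e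
  proof (cases "x = y")
    case False
    define r where "r = norm (y - x)"
    have r: "r > 0" using False by (simp add: r_def)
    have rS: "r \<le> S"
      using norm_triangle_ineq4[of y x] x y S by (simp add: r_def S_def)
    define h where "h = (y - x) /\<^sub>R r"
    have h: "norm h = 1" "x + r *\<^sub>R h = y" using r by (simp_all add: h_def r_def)
    obtain q where q: "degree q \<le> d" "\<And>t. F d (x + t *\<^sub>R h) \<bullet> e = poly q t"
      using entire_series_line by blast
    define g where "g = (q - [:poly q 0:]) div [:0, 1:]"
    have "[:0, 1:] dvd (q - [:poly q 0:])" using poly_eq_0_iff_dvd[of "q - [:poly q 0:]" 0] by simp
    then have g: "q - [:poly q 0:] = [:0, 1:] * g" by (simp only: g_def dvd_mult_div_cancel)
    have gt: "poly q t - poly q 0 = t * poly g t" for t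
      using arg_cong[OF g, of "\<lambda>p. poly p t"] by simp
    have "degree g \<le> degree (q - [:poly q 0:])" 
      unfolding g by (subst mult.commute, rule degree_mult_right_le) simp
    also have "\<dots> \<le> d" using q(1) by (intro degree_diff_le) auto
    finally have deg: "degree g \<le> d" .
    have pos: "(2 * K) ^ d > 0" using K by simp
    have Fb: "\<bar>F d p \<bullet> e\<bar> \<le> C / (2 * K) ^ d" if "p \<in> cball 0 (R1 + 2)" for p
    proof -
      have "\<bar>F d p \<bullet> e\<bar> \<le> norm (F d p)" by (rule Basis_le_norm[OF e])
      also have "\<dots> \<le> C / (2 * K) ^ d" using C[OF that, of d] pos by (simp add: pos_le_divide_eq)
      finally show ?thesis .
    qed
    have "\<bar>poly g t\<bar> \<le> 2 * C / (2 * K) ^ d" if t: "t \<in> {1..2}" for t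
    proof -
      have "norm (x + t *\<^sub>R h) \<le> norm x + t" using t h norm_triangle_ineq[of x "t *\<^sub>R h"] by simp
      then have "x + t *\<^sub>R h \<in> cball 0 (R1 + 2)" "x \<in> cball 0 (R1 + 2)" using t x S by auto
      from Fb[OF this(1)] Fb[OF this(2)] have "\<bar>poly q t\<bar> \<le> C / (2 * K) ^ d" "\<bar>poly q 0\<bar> \<le> C / (2 * K) ^ d"
        using q(2)[of t] q(2)[of 0] by simp_all
      then have "t * \<bar>poly g t\<bar> \<le> 2 * C / (2 * K) ^ d" using gt[of t] t by (simp add: abs_mult[symmetric])
      moreover have "1 * \<bar>poly g t\<bar> \<le> t * \<bar>poly g t\<bar>" using t by (intro mult_right_mono) auto
      ultimately show ?thesis by simp
    qed
    then have "\<bar>poly g r\<bar> \<le> (2 * C / (2 * K) ^ d) * (exp 2 * (8 * S * exp 2) ^ d)"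
      using S r rS deg by (intro remez_bound[of "{1..2}"]) auto
    also have "\<dots> = 2 * C * exp 2 * (1/2) ^ d"
      using K by (simp add: K_def[symmetric] power_mult_distrib power_one_over)
    finally have "r * \<bar>poly g r\<bar> \<le> r * (2 * C * exp 2 * (1/2) ^ d)" using r by (intro mult_left_mono) auto
    moreover have "\<bar>(F d y - F d x) \<bullet> e\<bar> = r * \<bar>poly g r\<bar>"
      using q(2)[of r] q(2)[of 0] gt[of r] r h by (simp add: inner_diff_left abs_mult)
    ultimately show ?thesis by (simp add: r_def mult.commute)
  qed (use C0 in simp)
  have "norm (F d y - F d x) \<le> (c * (1/2) ^ d) * norm (y - x)" if "x \<in> cball 0 R" "y \<in> cball 0 R" for d x y
  proof -
    have "norm (F d y - F d x) \<le> (\<Sum>e\<in>Basis. \<bar>(F d y - F d x) \<bullet> e\<bar>)" by (rule norm_le_l1)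
    also have "\<dots> \<le> (\<Sum>e\<in>(Basis::'a set). (2 * C * exp 2 * (1/2) ^ d) * norm (y - x))"
      using that by (intro sum_mono comp)
    finally show ?thesis by (simp add: c_def mult_ac)
  qed
  moreover have "summable (\<lambda>d. c * (1/2) ^ d)" by (intro summable_mult summable_geometric) simp
  moreover have "0 \<le> c * (1/2) ^ d" for d using C0 by (simp add: c_def)
  ultimately show ?thesis by blast
qed

context
  fixes X
  assumes X: "\<And>p. (\<lambda>d. F d p) sums X p"
begin

lemma entire_series_sum_lipschitz: "lipschitz_on_balls X"
  unfolding lipschitz_on_balls_def
proof
  fix R
  obtain L where L: "summable L" "\<And>d. 0 \<le> L d"
    "\<And>d x y. x \<in> cball 0 R \<Longrightarrow> y \<in> cball 0 R \<Longrightarrow> norm (F d y - F d x) \<le> L d * norm (y - x)"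
    using entire_series_lipschitz[of R] by blast
  have "norm (X y - X x) \<le> (\<Sum>d. L d) * norm (y - x)" if "x \<in> cball 0 R" "y \<in> cball 0 R" for x y
  proof -
    have s: "(\<lambda>d. L d * norm (y - x)) sums ((\<Sum>d. L d) * norm (y - x))"
      by (intro sums_mult2 summable_sums L)
    have "norm (\<Sum>d. F d y - F d x) \<le> (\<Sum>d. L d * norm (y - x))"
      by (rule norm_suminf_le[OF L(3)[OF that]]) (rule sums_summable[OF s])
    then show ?thesis using sums_unique[OF sums_diff[OF X X]] sums_unique[OF s] by simp
  qed
  then have "(\<Sum>d. L d)-lipschitz_on (cball 0 R) X"
    by (intro lipschitz_onI suminf_nonneg L) (simp add: dist_norm norm_minus_commute)
  then show "\<exists>L. L-lipschitz_on (cball 0 R) X" by blast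
qed

lemma entire_series_sum_continuous: "continuous_on UNIV X"
proof -
  have "continuous_on (ball 0 R) X" for R
    using entire_series_sum_lipschitz lipschitz_on_continuous_on lipschitz_on_subset[OF _ ball_subset_cball]
    unfolding lipschitz_on_balls_def by blast
  then have "continuous_on (\<Union>R. ball 0 R) X" by (intro continuous_on_open_UN) auto
  moreover have "x \<in> ball 0 (norm x + 1)" for x :: 'a by simp
  then have "(\<Union>R. ball (0::'a) R) = UNIV" by blast
  ultimately show ?thesis by simp
qed

lemma entire_series_uniform_limit:
  assumes "\<epsilon> > 0"
  shows "\<exists>n. \<forall>x\<in>cball 0 R. norm ((\<Sum>d<n. F d x) - X x) \<le> \<epsilon>"
proof -
  obtain M where M: "summable M" "\<And>d x. x \<in> cball 0 R \<Longrightarrow> norm (F d x) \<le> M d"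
    using entire_series_dominated[of R] by blast
  have "uniform_limit (cball 0 R) (\<lambda>n x. \<Sum>d<n. F d x) (\<lambda>x. \<Sum>d. F d x) sequentially"
    by (rule Weierstrass_m_test[OF M(2) M(1)])
  then have "\<forall>\<^sub>F n in sequentially. \<forall>x\<in>cball 0 R. dist (\<Sum>d<n. F d x) (\<Sum>d. F d x) < \<epsilon>"
    using assms by (rule uniform_limitD)
  then obtain n where "\<forall>x\<in>cball 0 R. dist (\<Sum>d<n. F d x) (\<Sum>d. F d x) < \<epsilon>"
    using eventually_happens'[OF sequentially_bot] by blast
  then show ?thesis using sums_unique[OF X] by (intro exI[of _ n]) (auto simp: dist_norm less_imp_le)
qed

text \<open>The summable Lipschitz constants dominate the difference quotients, so Tannery's theorem permits
differentiation term by term.\<close>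

lemma entire_series_directional_derivative:
  assumes D: "\<And>d. (F d has_derivative D d) (at p)"
  shows "summable (\<lambda>d. norm (D d b))"
    and "((\<lambda>t. (1 / t) *\<^sub>R (X (p + t *\<^sub>R b) - X p)) \<longlongrightarrow> (\<Sum>d. D d b)) (at 0)"
proof -
  obtain L where L: "summable L" "\<And>d. 0 \<le> L d"
    "\<And>d x y. x \<in> cball 0 (norm p + norm b) \<Longrightarrow> y \<in> cball 0 (norm p + norm b) \<Longrightarrow>
       norm (F d y - F d x) \<le> L d * norm (y - x)"
    using entire_series_lipschitz[of "norm p + norm b"] by blast
  define a where "a d t = (1 / t) *\<^sub>R (F d (p + t *\<^sub>R b) - F d p)" for d and t :: real
  have lim: "((\<lambda>t. a d t) \<longlongrightarrow> D d b) (at 0)" for d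
  proof -
    have "((\<lambda>t. p + t *\<^sub>R b) has_derivative (\<lambda>t. t *\<^sub>R b)) (at 0)" by (auto intro!: derivative_eq_intros)
    from has_derivative_compose[OF this, where g = "F d"] D[of d]
    have "((\<lambda>t. F d (p + t *\<^sub>R b)) has_derivative (\<lambda>t. D d (t *\<^sub>R b))) (at 0)" by simp
    moreover have "D d (t *\<^sub>R b) = t *\<^sub>R D d b" for t
      using has_derivative_linear[OF D[of d]] by (rule linear_scale)
    ultimately have "((\<lambda>t. norm (F d (p + t *\<^sub>R b) - F d p - t *\<^sub>R D d b) / norm t) \<longlongrightarrow> 0) (at 0)"
      by (simp add: has_derivative_at)
    moreover have "\<forall>\<^sub>F t in at 0. norm (F d (p + t *\<^sub>R b) - F d p - t *\<^sub>R D d b) / norm t = norm (a d t - D d b)"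
    proof (intro eventually_at_filter[THEN iffD2] always_eventually allI impI)
      fix t :: real assume "t \<noteq> 0"
      then have "a d t - D d b = (1 / t) *\<^sub>R (F d (p + t *\<^sub>R b) - F d p - t *\<^sub>R D d b)"
        by (simp add: a_def scaleR_diff_right)
      then show "norm (F d (p + t *\<^sub>R b) - F d p - t *\<^sub>R D d b) / norm t = norm (a d t - D d b)"
        by simp
    qed
    ultimately have "((\<lambda>t. norm (a d t - D d b)) \<longlongrightarrow> 0) (at 0)" by (rule Lim_transform_eventually)
    then show ?thesis by (subst Lim_null) (rule tendsto_norm_zero_cancel)
  qed
  have bound: "norm (a d t) \<le> L d * norm b" if "t \<noteq> 0" "\<bar>t\<bar> < 1" for d t
  proof -
    have "\<bar>t\<bar> * norm b \<le> 1 * norm b" using that by (intro mult_right_mono) auto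
    then have "norm (p + t *\<^sub>R b) \<le> norm p + norm b" using norm_triangle_ineq[of p "t *\<^sub>R b"] by simp
    then have "norm (F d (p + t *\<^sub>R b) - F d p) \<le> L d * norm (t *\<^sub>R b)"
      using L(3)[of p "p + t *\<^sub>R b" d] by simp
    then show ?thesis using that by (simp add: a_def pos_divide_le_eq mult_ac)
  qed
  have ev: "\<forall>\<^sub>F t in at (0::real). t \<noteq> 0 \<and> \<bar>t\<bar> < 1"
    unfolding eventually_at by (intro exI[of _ 1]) auto
  have Dle: "norm (D d b) \<le> L d * norm b" for d
    by (rule tendsto_upperbound[OF tendsto_norm[OF lim]])
      (use ev bound in \<open>auto elim: eventually_mono\<close>)
  show sD: "summable (\<lambda>d. norm (D d b))"
    by (rule summable_comparison_test'[OF summable_mult2[OF L(1), of "norm b"]]) (use Dle in simp)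
  show "((\<lambda>t. (1 / t) *\<^sub>R (X (p + t *\<^sub>R b) - X p)) \<longlongrightarrow> (\<Sum>d. D d b)) (at 0)"
  proof -
    have comp: "((\<lambda>t. (1 / t) *\<^sub>R (X (p + t *\<^sub>R b) - X p) \<bullet> e) \<longlongrightarrow> (\<Sum>d. D d b) \<bullet> e) (at 0)"
      if e: "e \<in> Basis" for e
    proof -
    have "eventually (\<lambda>(d, t). norm (a d t \<bullet> e) \<le> L d * norm b) (at_top \<times>\<^sub>F at 0)"
    proof -
      have "\<forall>\<^sub>F x in at_top \<times>\<^sub>F at (0::real). True \<and> (snd x \<noteq> 0 \<and> \<bar>snd x\<bar> < 1)"
        by (rule eventually_prodI[OF _ ev]) simp
      then show ?thesis
      proof (rule eventually_mono)
        fix x :: "nat \<times> real" assume "True \<and> (snd x \<noteq> 0 \<and> \<bar>snd x\<bar> < 1)"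
        then have "norm (a (fst x) (snd x)) \<le> L (fst x) * norm b" using bound by blast
        moreover have "norm (a (fst x) (snd x) \<bullet> e) \<le> norm (a (fst x) (snd x))"
          using Basis_le_norm[OF e] by simp
        ultimately show "case x of (d, t) \<Rightarrow> norm (a d t \<bullet> e) \<le> L d * norm b" by (simp add: case_prod_unfold)
      qed
    qed
    from tannerys_theorem[OF tendsto_inner[OF lim tendsto_const] this summable_mult2[OF L(1)]]
    have "((\<lambda>t. \<Sum>d. a d t \<bullet> e) \<longlongrightarrow> (\<Sum>d. D d b \<bullet> e)) (at 0)" by simp
    moreover have "(\<Sum>d. a d t \<bullet> e) = (1 / t) *\<^sub>R (X (p + t *\<^sub>R b) - X p) \<bullet> e" for t
    proof -
      have "(\<lambda>d. a d t) sums ((1 / t) *\<^sub>R (X (p + t *\<^sub>R b) - X p))"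
        unfolding a_def by (intro sums_scaleR_right sums_diff X)
      from bounded_linear.sums[OF bounded_linear_inner_left this]
      show ?thesis by (rule sums_unique[symmetric])
    qed
    moreover have "(\<Sum>d. D d b \<bullet> e) = (\<Sum>d. D d b) \<bullet> e"
      by (rule bounded_linear.suminf[OF bounded_linear_inner_left summable_norm_cancel[OF sD], symmetric])
    ultimately show "((\<lambda>t. (1 / t) *\<^sub>R (X (p + t *\<^sub>R b) - X p) \<bullet> e) \<longlongrightarrow> (\<Sum>d. D d b) \<bullet> e) (at 0)"
      by simp
    qed
    have "((\<lambda>t. \<Sum>e\<in>Basis. ((1 / t) *\<^sub>R (X (p + t *\<^sub>R b) - X p) \<bullet> e) *\<^sub>R e)
        \<longlongrightarrow> (\<Sum>e\<in>Basis. ((\<Sum>d. D d b) \<bullet> e) *\<^sub>R e)) (at 0)"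
      by (intro tendsto_sum tendsto_scaleR comp tendsto_const)
    then show ?thesis by (simp only: euclidean_representation)
  qed
qed

end
end

section \<open>Polynomial vector fields of zero divergence\<close>

text \<open>Passing from \<open>Q(s)\<close> to \<open>Q(s/2) - Q(s) / 2\<^sup>m\<close> removes the top coefficient of a polynomial of degree \<open>m\<close> and multiplies
the other ones by nonzero numbers.\<close>

lemma coefficients_in_fun_subspace:
  fixes c :: "nat \<Rightarrow> 'a \<Rightarrow> 'b::real_vector"
  assumes S: "fun_subspace S" and \<delta>: "0 < \<delta>"
    and mem: "\<And>s. \<bar>s\<bar> < \<delta> \<Longrightarrow> (\<lambda>x. \<Sum>k\<le>m. s ^ k *\<^sub>R c k x) \<in> S"
  shows "k \<le> m \<Longrightarrow> c k \<in> S"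
  using mem
proof (induction m arbitrary: c k)
  case 0
  have "(\<lambda>x. \<Sum>k\<le>0. (0::real) ^ k *\<^sub>R c k x) \<in> S" by (rule "0.prems"(2)) (simp add: \<delta>)
  then show ?case using "0.prems"(1) by simp
next
  case (Suc m)
  define c' where "c' k x = ((1/2) ^ k - (1/2) ^ Suc m :: real) *\<^sub>R c k x" for k x
  have c': "(\<lambda>x. \<Sum>k\<le>m. s ^ k *\<^sub>R c' k x) \<in> S" if s: "\<bar>s\<bar> < \<delta>" for s
  proof -
    have 1: "(\<lambda>x. \<Sum>k\<le>Suc m. (s/2) ^ k *\<^sub>R c k x) \<in> S" using s by (intro Suc.prems(2)) auto
    have 2: "(\<lambda>x. (1/2) ^ Suc m *\<^sub>R (\<Sum>k\<le>Suc m. s ^ k *\<^sub>R c k x)) \<in> S"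
      by (intro fun_subspace_scale[OF S] Suc.prems(2) s)
    have "(\<Sum>k\<le>Suc m. (s/2) ^ k *\<^sub>R c k x) - (1/2) ^ Suc m *\<^sub>R (\<Sum>k\<le>Suc m. s ^ k *\<^sub>R c k x)
        = (\<Sum>k\<le>m. s ^ k *\<^sub>R c' k x)" for x
    proof -
      have "(\<Sum>k\<le>Suc m. (s/2) ^ k *\<^sub>R c k x) - (1/2) ^ Suc m *\<^sub>R (\<Sum>k\<le>Suc m. s ^ k *\<^sub>R c k x)
          = (\<Sum>k\<le>Suc m. ((s/2) ^ k - (1/2) ^ Suc m * s ^ k) *\<^sub>R c k x)"
        by (simp only: scaleR_sum_right sum_subtractf scaleR_scaleR scaleR_left_diff_distrib)
      also have "\<dots> = (\<Sum>k\<le>m. ((s/2) ^ k - (1/2) ^ Suc m * s ^ k) *\<^sub>R c k x)"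
        by (simp add: power_divide)
      also have "\<dots> = (\<Sum>k\<le>m. s ^ k *\<^sub>R c' k x)"
        by (intro sum.cong refl) (simp add: c'_def power_divide algebra_simps)
      finally show ?thesis .
    qed
    with fun_subspace_diff[OF S 1 2] show ?thesis by simp
  qed
  have low: "c j \<in> S" if j: "j \<le> m" for j
  proof -
    have "c' j \<in> S" by (rule Suc.IH[OF j c'])
    then have "(\<lambda>x. (1 / ((1/2) ^ j - (1/2) ^ Suc m)) *\<^sub>R c' j x) \<in> S"
      by (rule fun_subspace_scale[OF S])
    moreover have "(1/2::real) ^ Suc m < (1/2) ^ j" using j by (intro power_strict_decreasing) auto
    ultimately show ?thesis by (simp add: c'_def)
  qed
  show ?case
  proof (cases "k = Suc m")
    case True
    have "(\<lambda>x. (\<Sum>k\<le>Suc m. (\<delta>/2) ^ k *\<^sub>R c k x) - (\<Sum>k\<le>m. (\<delta>/2) ^ k *\<^sub>R c k x)) \<in> S"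
      using \<delta> by (intro fun_subspace_diff[OF S] Suc.prems(2) fun_subspace_sum[OF S] fun_subspace_scale[OF S] low) auto
    then have "(\<lambda>x. (\<delta>/2) ^ Suc m *\<^sub>R c (Suc m) x) \<in> S" by simp
    from fun_subspace_scale[OF S this, of "1 / (\<delta>/2) ^ Suc m"] show ?thesis
      using \<delta> True by simp
  next
    case False
    then show ?thesis using low Suc.prems(1) by simp
  qed
qed

inductive_set fun_span :: "('a \<Rightarrow> 'b::real_vector) set \<Rightarrow> ('a \<Rightarrow> 'b) set" for A where
  zero: "(\<lambda>x. 0) \<in> fun_span A"
| step: "g \<in> A \<Longrightarrow> f \<in> fun_span A \<Longrightarrow> (\<lambda>x. c *\<^sub>R g x + f x) \<in> fun_span A"

lemma fun_span_add: "f \<in> fun_span A \<Longrightarrow> g \<in> fun_span A \<Longrightarrow> (\<lambda>x. f x + g x) \<in> fun_span A"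
proof (induction rule: fun_span.induct)
  case (step h f c)
  from fun_span.step[OF step.hyps(1) step.IH[OF step.prems], of c] show ?case by (simp add: add.assoc)
qed simp

lemma fun_span_scale: "f \<in> fun_span A \<Longrightarrow> (\<lambda>x. c *\<^sub>R f x) \<in> fun_span A"
proof (induction rule: fun_span.induct)
  case zero
  show ?case using fun_span.zero by simp
next
  case (step h f b)
  from fun_span.step[OF step.hyps(1) step.IH, of "c * b"] show ?case by (simp add: scaleR_add_right)
qed

lemma fun_subspace_fun_span: "fun_subspace (fun_span A)"
  by (intro fun_subspaceI fun_span.zero fun_span_add fun_span_scale)

lemma fun_span_base: "g \<in> A \<Longrightarrow> g \<in> fun_span A"
  using fun_span.step[OF _ fun_span.zero, of g A 1] by simp

lemma fun_span_subset:
  assumes "fun_subspace S" "A \<subseteq> S"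
  shows "fun_span A \<subseteq> S"
proof
  fix f assume "f \<in> fun_span A"
  then show "f \<in> S"
  proof induction
    case zero
    show ?case by (rule fun_subspace_0[OF assms(1)])
  next
    case (step g f c)
    have "g \<in> S" using step.hyps(1) assms(2) by blast
    then show ?case by (intro fun_subspace_add[OF assms(1)] fun_subspace_scale[OF assms(1)] step.IH)
  qed
qed

text \<open>The condition \<open>l \<bullet> e \<noteq> 0\<close> makes it possible to correct any vector by a multiple of \<open>e\<close> so as to become
orthogonal to \<open>l\<close>.\<close>

definition linear_powers :: "'a::euclidean_space \<Rightarrow> ('a \<Rightarrow> real) set" where
  "linear_powers e = {(\<lambda>x. (l \<bullet> x) ^ n) | l n. l \<bullet> e \<noteq> 0}"

lemma linear_powersI: "l \<bullet> e \<noteq> 0 \<Longrightarrow> (\<lambda>x. (l \<bullet> x) ^ n) \<in> linear_powers e"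
  unfolding linear_powers_def by blast

text \<open>Polarisation: up to the factor \<open>n + 1\<close>, the product of \<open>m\<close> and \<open>l\<^sup>n\<close> is the coefficient of \<open>s\<close> in \<open>(l + s m)\<^sup>n\<^sup>+\<^sup>1\<close>.  For small
\<open>s\<close> the form \<open>l + s m\<close> still does not vanish at \<open>e\<close>.\<close>

lemma linear_powers_times_linear:
  assumes "f \<in> fun_span (linear_powers e)"
  shows "(\<lambda>x. (m \<bullet> x) * f x) \<in> fun_span (linear_powers e)"
  using assms
proof (induction rule: fun_span.induct)
  case zero
  show ?case using fun_span.zero by simp
next
  case (step g f c)
  obtain l n where g: "g = (\<lambda>x. (l \<bullet> x) ^ n)" and l: "l \<bullet> e \<noteq> 0"
    using step.hyps(1) by (auto simp: linear_powers_def)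
  \<comment> \<open>For \<open>\<bar>s\<bar> < \<delta>\<close> the number \<open>(l + s m) \<bullet> e\<close> is nonzero.\<close>
  define \<delta> where "\<delta> = \<bar>l \<bullet> e\<bar> / (\<bar>m \<bullet> e\<bar> + 1)"
  have \<delta>: "\<delta> > 0" using l by (simp add: \<delta>_def)
  define cf where "cf k x = (of_nat (Suc n choose k) * (m \<bullet> x) ^ k * (l \<bullet> x) ^ (Suc n - k) :: real)" for k x
  have mem: "(\<lambda>x. \<Sum>k\<le>Suc n. s ^ k *\<^sub>R cf k x) \<in> fun_span (linear_powers e)" if s: "\<bar>s\<bar> < \<delta>" for s
  proof -
    have "\<bar>s\<bar> * (\<bar>m \<bullet> e\<bar> + 1) < \<bar>l \<bullet> e\<bar>"
      using s by (simp add: \<delta>_def pos_less_divide_eq)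
    then have "\<bar>s * (m \<bullet> e)\<bar> < \<bar>l \<bullet> e\<bar>"
      by (simp add: abs_mult distrib_left)
    then have "(l + s *\<^sub>R m) \<bullet> e \<noteq> 0" by (auto simp: inner_add_left)
    then have "(\<lambda>x. ((l + s *\<^sub>R m) \<bullet> x) ^ Suc n) \<in> fun_span (linear_powers e)"
      by (intro fun_span_base linear_powersI)
    also have "(\<lambda>x. ((l + s *\<^sub>R m) \<bullet> x) ^ Suc n) = (\<lambda>x. \<Sum>k\<le>Suc n. s ^ k *\<^sub>R cf k x)"
    proof
      fix x
      have "((l + s *\<^sub>R m) \<bullet> x) ^ Suc n = (s * (m \<bullet> x) + l \<bullet> x) ^ Suc n"
        by (simp add: inner_add_left add.commute)
      also have "\<dots> = (\<Sum>k\<le>Suc n. s ^ k *\<^sub>R cf k x)"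
        unfolding binomial_ring cf_def by (intro sum.cong refl) (simp add: power_mult_distrib mult_ac)
      finally show "((l + s *\<^sub>R m) \<bullet> x) ^ Suc n = (\<Sum>k\<le>Suc n. s ^ k *\<^sub>R cf k x)" .
    qed
    finally show ?thesis .
  qed
  have "cf 1 \<in> fun_span (linear_powers e)"
    by (rule coefficients_in_fun_subspace[OF fun_subspace_fun_span \<delta> mem]) auto
  then have "(\<lambda>x. (c / real (Suc n)) *\<^sub>R cf 1 x) \<in> fun_span (linear_powers e)"
    by (rule fun_span_scale)
  also have "(\<lambda>x. (c / real (Suc n)) *\<^sub>R cf 1 x) = (\<lambda>x. (m \<bullet> x) * (c *\<^sub>R g x))"
    by (simp add: cf_def g fun_eq_iff del: of_nat_Suc)
  finally show ?case using fun_span_add[OF _ step.IH] by (simp add: distrib_left)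
qed

lemma real_polynomial_function_times_linear_powers:
  assumes "real_polynomial_function p" "e \<noteq> 0"
  shows "f \<in> fun_span (linear_powers e) \<Longrightarrow> (\<lambda>x. p x * f x) \<in> fun_span (linear_powers e)"
  using assms(1)
proof (induction p arbitrary: f rule: real_polynomial_function.induct)
  case (linear h)
  have "h x = (\<Sum>b\<in>Basis. h b *\<^sub>R b) \<bullet> x" for x
  proof -
    have "h x = h (\<Sum>b\<in>Basis. (x \<bullet> b) *\<^sub>R b)" by (simp add: euclidean_representation)
    also have "\<dots> = (\<Sum>b\<in>Basis. (x \<bullet> b) *\<^sub>R h b)"
      using linear.hyps by (simp add: linear_sum linear_scale bounded_linear.linear)
    also have "\<dots> = (\<Sum>b\<in>Basis. h b *\<^sub>R b) \<bullet> x"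
      unfolding inner_sum_left by (intro sum.cong refl) (simp add: inner_commute)
    finally show ?thesis .
  qed
  then obtain m where "\<And>x. h x = m \<bullet> x" by blast
  then show ?case using linear_powers_times_linear[OF linear.prems, of m] by simp
next
  case (const c)
  show ?case using fun_span_scale[OF const.prems, of c] by simp
next
  case (add p q)
  show ?case using fun_span_add[OF add.IH(1)[OF add.prems] add.IH(2)[OF add.prems]] by (simp add: distrib_right)
next
  case (mult p q)
  show ?case using mult.IH(1)[OF mult.IH(2)[OF mult.prems]] by (simp add: mult.assoc)
qed

lemma real_polynomial_function_in_span_linear_powers:
  assumes "real_polynomial_function p" "e \<noteq> 0"
  shows "p \<in> fun_span (linear_powers e)"
proof -
  have "(\<lambda>x. (e \<bullet> x) ^ 0) \<in> fun_span (linear_powers e)"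
    using assms(2) by (intro fun_span_base linear_powersI) simp
  from real_polynomial_function_times_linear_powers[OF assms this] show ?thesis by simp
qed

definition shear_fields :: "('a::euclidean_space \<Rightarrow> 'a) set" where
  "shear_fields = {(\<lambda>x. (l \<bullet> x) ^ n *\<^sub>R b) | l n b. l \<bullet> b = 0}"

lemma shear_fieldsI: "l \<bullet> b = 0 \<Longrightarrow> (\<lambda>x. (l \<bullet> x) ^ n *\<^sub>R b) \<in> shear_fields"
  unfolding shear_fields_def by blast

text \<open>For \<open>l \<bullet> e \<noteq> 0\<close> write \<open>b = b' + \<lambda> e\<close> with \<open>l \<bullet> b' = 0\<close>; then \<open>(l \<bullet> x)\<^sup>n b'\<close> is a shear field.  Thus, modulo shear fields,
only one component of a polynomial field is left.\<close>

lemma polynomial_field_reduction: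
  assumes p: "polynomial_function X" and e: "(e :: 'a::euclidean_space) \<noteq> 0"
  shows "\<exists>Y q. Y \<in> fun_span shear_fields \<and> q \<in> fun_span (linear_powers e) \<and>
     X = (\<lambda>x. Y x + q x *\<^sub>R e)"
proof -
  let ?P = "\<lambda>X. \<exists>Y q. Y \<in> fun_span shear_fields \<and> q \<in> fun_span (linear_powers e) \<and>
     X = (\<lambda>x. Y x + q x *\<^sub>R e)"
  have add: "?P (\<lambda>x. X x + Z x)" if X: "?P X" and Z: "?P Z" for X Z
  proof -
    from X obtain Y q where 1: "Y \<in> fun_span shear_fields" "q \<in> fun_span (linear_powers e)"
      "X = (\<lambda>x. Y x + q x *\<^sub>R e)" by blast
    from Z obtain Y' q' where 2: "Y' \<in> fun_span shear_fields" "q' \<in> fun_span (linear_powers e)"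
      "Z = (\<lambda>x. Y' x + q' x *\<^sub>R e)" by blast
    have "(\<lambda>x. X x + Z x) = (\<lambda>x. (Y x + Y' x) + (q x + q' x) *\<^sub>R e)"
      by (simp add: 1 2 algebra_simps)
    then show ?thesis using fun_span_add[OF 1(1) 2(1)] fun_span_add[OF 1(2) 2(2)] by blast
  qed
  have zero: "?P (\<lambda>x. 0)"
    by (intro exI[of _ "\<lambda>x. 0"] conjI fun_span.zero) simp
  have b: "?P (\<lambda>x. f x *\<^sub>R b)" if "f \<in> fun_span (linear_powers e)" for f b
    using that
  proof (induction rule: fun_span.induct)
    case zero
    show ?case using \<open>?P (\<lambda>x. 0)\<close> by simp
  next
    case (step g f c)
    obtain l n where g: "g = (\<lambda>x. (l \<bullet> x) ^ n)" and l: "l \<bullet> e \<noteq> 0"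
      using step.hyps(1) by (auto simp: linear_powers_def)
    define b' where "b' = b - ((l \<bullet> b) / (l \<bullet> e)) *\<^sub>R e"
    have "l \<bullet> b' = 0" using l by (simp add: b'_def inner_diff_right)
    then have "(\<lambda>x. (l \<bullet> x) ^ n *\<^sub>R b') \<in> fun_span shear_fields"
      by (intro fun_span_base shear_fieldsI)
    then have 1: "(\<lambda>x. c *\<^sub>R g x *\<^sub>R b') \<in> fun_span shear_fields"
      unfolding g by (rule fun_span_scale)
    have 2: "(\<lambda>x. (c * ((l \<bullet> b) / (l \<bullet> e))) *\<^sub>R g x) \<in> fun_span (linear_powers e)"
      by (intro fun_span_scale fun_span_base step.hyps)
    have "(\<lambda>x. (c *\<^sub>R g x) *\<^sub>R b) =
        (\<lambda>x. c *\<^sub>R g x *\<^sub>R b' + ((c * ((l \<bullet> b) / (l \<bullet> e))) *\<^sub>R g x) *\<^sub>R e)"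
      by (simp add: b'_def fun_eq_iff algebra_simps)
    then have "?P (\<lambda>x. (c *\<^sub>R g x) *\<^sub>R b)" using 1 2 by blast
    from add[OF this step.IH] show ?case by (simp add: scaleR_add_left)
  qed
  have "?P (\<lambda>x. (X x \<bullet> b) *\<^sub>R b)" for b
  proof (rule b, rule real_polynomial_function_in_span_linear_powers[OF _ e])
    show "real_polynomial_function (\<lambda>x. X x \<bullet> b)"
      using p bounded_linear_inner_left[of b] unfolding polynomial_function_def o_def by blast
  qed
  note comp = this
  have "?P (\<lambda>x. \<Sum>b\<in>B. (X x \<bullet> b) *\<^sub>R b)" if "finite B" for B
    using that
  proof (induction B rule: finite_induct)
    case empty
    then show ?case using zero by simp
  next
    case (insert b B)
    from add[OF comp insert.IH] insert.hyps show ?case by simp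
  qed
  from this[OF finite_Basis] show ?thesis by (simp add: euclidean_representation)
qed

definition has_real_divergence ::
  "('a::euclidean_space \<Rightarrow> 'a) \<Rightarrow> ('a \<Rightarrow> real) \<Rightarrow> bool" where
  "has_real_divergence X D \<longleftrightarrow>
     (\<forall>x. \<exists>A. (X has_derivative A) (at x) \<and> (\<Sum>b\<in>Basis. A b \<bullet> b) = D x)"

lemma has_real_divergenceE:
  assumes "has_real_divergence X D"
  obtains A where "(X has_derivative A) (at x)" "(\<Sum>b\<in>Basis. A b \<bullet> b) = D x"
  using assms unfolding has_real_divergence_def by blast

lemma has_real_divergence_unique:
  assumes "has_real_divergence X D" "has_real_divergence X D'"
  shows "D = D'"
proof
  fix x
  obtain A where A: "(X has_derivative A) (at x)" "(\<Sum>b\<in>Basis. A b \<bullet> b) = D x"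
    by (rule has_real_divergenceE[OF assms(1)])
  obtain A' where A': "(X has_derivative A') (at x)" "(\<Sum>b\<in>Basis. A' b \<bullet> b) = D' x"
    by (rule has_real_divergenceE[OF assms(2)])
  have "A = A'" by (rule has_derivative_unique[OF A(1) A'(1)])
  with A(2) A'(2) show "D x = D' x" by simp
qed

lemma has_real_divergence_add:
  assumes "has_real_divergence X D" "has_real_divergence Y E"
  shows "has_real_divergence (\<lambda>x. X x + Y x) (\<lambda>x. D x + E x)"
  unfolding has_real_divergence_def
proof
  fix x
  obtain A where A: "(X has_derivative A) (at x)" "(\<Sum>b\<in>Basis. A b \<bullet> b) = D x"
    by (rule has_real_divergenceE[OF assms(1)])
  obtain B where B: "(Y has_derivative B) (at x)" "(\<Sum>b\<in>Basis. B b \<bullet> b) = E x"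
    by (rule has_real_divergenceE[OF assms(2)])
  have "(\<Sum>b\<in>Basis. (A b + B b) \<bullet> b) = D x + E x"
    unfolding inner_add_left sum.distrib A(2) B(2) ..
  with has_derivative_add[OF A(1) B(1)]
  show "\<exists>A. ((\<lambda>x. X x + Y x) has_derivative A) (at x) \<and> (\<Sum>b\<in>Basis. A b \<bullet> b) = D x + E x" by blast
qed

lemma has_real_divergence_scale:
  assumes "has_real_divergence X D"
  shows "has_real_divergence (\<lambda>x. c *\<^sub>R X x) (\<lambda>x. c * D x)"
  unfolding has_real_divergence_def
proof
  fix x
  obtain A where 1: "(X has_derivative A) (at x)" "(\<Sum>b\<in>Basis. A b \<bullet> b) = D x"
    by (rule has_real_divergenceE[OF assms])
  have "(\<Sum>b\<in>Basis. (c *\<^sub>R A b) \<bullet> b) = c * D x"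
    unfolding inner_scaleR_left sum_distrib_left[symmetric] 1(2) ..
  with has_derivative_scaleR_right[OF 1(1)]
  show "\<exists>A. ((\<lambda>x. c *\<^sub>R X x) has_derivative A) (at x) \<and> (\<Sum>b\<in>Basis. A b \<bullet> b) = c * D x" by blast
qed

text \<open>The trace of the rank-one map \<open>h \<mapsto> f'(h) b\<close> is \<open>f'(b)\<close>.\<close>

lemma has_real_divergence_scalar_times_vector:
  assumes "\<And>x. (f has_derivative f' x) (at x)"
  shows "has_real_divergence (\<lambda>x. f x *\<^sub>R b) (\<lambda>x. f' x b)"
  unfolding has_real_divergence_def
proof
  fix x
  have lin: "linear (f' x)" using assms has_derivative_linear by blast
  have "(\<Sum>i\<in>Basis. (f' x i *\<^sub>R b) \<bullet> i) = (\<Sum>i\<in>Basis. f' x ((b \<bullet> i) *\<^sub>R i))"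
    by (simp add: linear_scale[OF lin] mult.commute)
  also have "\<dots> = f' x b" by (simp add: linear_sum[OF lin, symmetric] euclidean_representation)
  finally have "(\<Sum>i\<in>Basis. (f' x i *\<^sub>R b) \<bullet> i) = f' x b" .
  moreover have "((\<lambda>x. f x *\<^sub>R b) has_derivative (\<lambda>h. f' x h *\<^sub>R b)) (at x)"
    by (rule has_derivative_scaleR_left[OF assms])
  ultimately show "\<exists>A. ((\<lambda>x. f x *\<^sub>R b) has_derivative A) (at x) \<and> (\<Sum>i\<in>Basis. A i \<bullet> i) = f' x b"
    by blast
qed

lemma linear_power_has_derivative:
  "((\<lambda>x. (l \<bullet> x) ^ n) has_derivative (\<lambda>h. real n * (l \<bullet> x) ^ (n - 1) * (l \<bullet> h))) (at x)"
  by (auto intro!: derivative_eq_intros simp: mult_ac)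

lemma fun_span_shear_fields_divergence_free:
  "Y \<in> fun_span shear_fields \<Longrightarrow> has_real_divergence Y (\<lambda>x. 0)"
proof (induction rule: fun_span.induct)
  case zero
  show ?case by (auto simp: has_real_divergence_def intro!: exI[of _ "\<lambda>h. 0"])
next
  case (step g f c)
  obtain l n b where g: "g = (\<lambda>x. (l \<bullet> x) ^ n *\<^sub>R b)" "l \<bullet> b = 0"
    using step.hyps(1) by (auto simp: shear_fields_def)
  have "has_real_divergence g (\<lambda>x. real n * (l \<bullet> x) ^ (n - 1) * (l \<bullet> b))"
    unfolding g(1) by (rule has_real_divergence_scalar_times_vector[OF linear_power_has_derivative])
  then have "has_real_divergence g (\<lambda>x. 0)" by (simp add: g(2))
  from has_real_divergence_add[OF has_real_divergence_scale[OF this, of c] step.IH] show ?case by simp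
qed

text \<open>After subtraction of shear fields the remaining field \<open>q e\<close> is divergence free, that is, \<open>q\<close> does not depend on
the coordinate along \<open>e\<close>.  Then each \<open>l\<close> occurring in \<open>q\<close> may be replaced by its projection
orthogonal to \<open>e\<close>, which turns \<open>q e\<close> itself into a combination of shear fields.\<close>

theorem divergence_free_polynomial_field:
  fixes X :: "'a::euclidean_space \<Rightarrow> 'a"
  assumes p: "polynomial_function X" and div: "has_real_divergence X (\<lambda>x. 0)"
  shows "X \<in> fun_span shear_fields"
proof -
  obtain e :: 'a where e: "e \<in> Basis" using nonempty_Basis by blast
  then have e0: "e \<noteq> 0" and ee: "e \<bullet> e = 1" by auto
  obtain Y q where Y: "Y \<in> fun_span shear_fields" and q: "q \<in> fun_span (linear_powers e)"
    and X: "X = (\<lambda>x. Y x + q x *\<^sub>R e)"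
    using polynomial_field_reduction[OF p e0] by blast
  have diff: "\<exists>q'. (q has_derivative q') (at x)" for x
    using q
  proof (induction rule: fun_span.induct)
    case zero
    show ?case using has_derivative_const by blast
  next
    case (step g f c)
    obtain l n where g: "g = (\<lambda>x. (l \<bullet> x) ^ n)" using step.hyps(1) by (auto simp: linear_powers_def)
    obtain f' where "(f has_derivative f') (at x)" using step.IH by blast
    from has_derivative_add[OF has_derivative_scaleR_right[OF linear_power_has_derivative[of l n x], of c] this]
    show ?case unfolding g by blast
  qed
  then obtain q' where q': "\<And>x. (q has_derivative q' x) (at x)" by metis
  have "has_real_divergence (\<lambda>x. X x + (-1) *\<^sub>R Y x) (\<lambda>x. 0 + (-1) * 0)"
    by (intro has_real_divergence_add div has_real_divergence_scale fun_span_shear_fields_divergence_free Y)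
  then have "has_real_divergence (\<lambda>x. q x *\<^sub>R e) (\<lambda>x. 0)" by (simp add: X)
  from has_real_divergence_unique[OF this has_real_divergence_scalar_times_vector[OF q']]
  have q'0: "q' x e = 0" for x by (metis (mono_tags))
  have const: "q (x + t *\<^sub>R e) = q x" for x t
  proof -
    have "((\<lambda>t. q (x + t *\<^sub>R e)) has_derivative (\<lambda>h. 0)) (at t within UNIV)" for t
    proof -
      have "((\<lambda>t. x + t *\<^sub>R e) has_derivative (\<lambda>h. h *\<^sub>R e)) (at t)"
        by (auto intro!: derivative_eq_intros)
      from has_derivative_compose[OF this q']
      have "((\<lambda>t. q (x + t *\<^sub>R e)) has_derivative (\<lambda>h. q' (x + t *\<^sub>R e) (h *\<^sub>R e))) (at t)" .
      moreover have "linear (q' (x + t *\<^sub>R e))" using q' has_derivative_linear by blast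
      ultimately show ?thesis by (simp add: linear_scale q'0)
    qed
    then have "\<exists>c. \<forall>t\<in>UNIV. q (x + t *\<^sub>R e) = c"
      by (intro has_derivative_zero_constant) auto
    then show ?thesis by (metis UNIV_I add.right_neutral scaleR_zero_left)
  qed
  have "(\<lambda>x. f (x - (x \<bullet> e) *\<^sub>R e) *\<^sub>R e) \<in> fun_span shear_fields"
    if "f \<in> fun_span (linear_powers e)" for f
    using that
  proof (induction rule: fun_span.induct)
    case zero
    show ?case using fun_span.zero by simp
  next
    case (step g f c)
    obtain l n where g: "g = (\<lambda>x. (l \<bullet> x) ^ n)" using step.hyps(1) by (auto simp: linear_powers_def)
    define l' where "l' = l - (l \<bullet> e) *\<^sub>R e"
    have "l' \<bullet> e = 0" by (simp add: l'_def inner_diff_left ee)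
    then have "(\<lambda>x. (l' \<bullet> x) ^ n *\<^sub>R e) \<in> shear_fields" by (rule shear_fieldsI)
    from fun_span.step[OF this step.IH, of c] show ?case
      by (simp add: g l'_def inner_diff_left inner_diff_right algebra_simps inner_commute)
  qed
  from this[OF q] have "(\<lambda>x. q x *\<^sub>R e) \<in> fun_span shear_fields"
    using const[of x "- (x \<bullet> e)" for x] by simp
  from fun_span_add[OF Y this] show ?thesis by (simp add: X)
qed

section \<open>Transvections\<close>

abbreviation transvection_field :: "'a::real_inner \<Rightarrow> 'a \<Rightarrow> 'a \<Rightarrow> 'a" where
  "transvection_field c k \<equiv> (\<lambda>x. (k \<bullet> x) *\<^sub>R c)"

context map_monoid begin

text \<open>Push-forward by the transvection \<open>x + (k \<bullet> x) c\<close>, whose inverse is \<open>x - (k \<bullet> x) c\<close> because \<open>k \<bullet> c = 0\<close>.\<close>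

lemma push_transvection:
  assumes tv: "transvection_field c k \<in> tangent_fields G" and ck: "k \<bullet> c = 0"
    and Y: "Y \<in> tangent_fields G"
  shows "(\<lambda>x. Y (x - (k \<bullet> x) *\<^sub>R c) + (k \<bullet> Y (x - (k \<bullet> x) *\<^sub>R c)) *\<^sub>R c) \<in> tangent_fields G"
proof -
  have lin: "linear (transvection_field c k)"
    by (rule linearI) (simp_all add: inner_add_right scaleR_add_left)
  have nil: "transvection_field c k (transvection_field c k x) = 0" for x
    by (simp add: ck)
  note mem = linear_field_flow_mem[OF tv lin nil]
  have A: "linear (\<lambda>x. x + (k \<bullet> x) *\<^sub>R c)"
    by (rule linearI) (simp_all add: inner_add_right scaleR_add_left scaleR_add_right)
  have tau: "(\<lambda>x. 0 + (x + (k \<bullet> x) *\<^sub>R c)) \<in> continuous_closure G" using mem[of 1] by simp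
  have sig: "(\<lambda>x. x - (k \<bullet> x) *\<^sub>R c) \<in> continuous_closure G" using mem[of "-1"] by simp
  have "0 + ((x - (k \<bullet> x) *\<^sub>R c) + (k \<bullet> (x - (k \<bullet> x) *\<^sub>R c)) *\<^sub>R c) = x" for x
    by (simp add: inner_diff_right ck)
  from tangent_fields_affine_push[OF Y A tau sig this] show ?thesis .
qed

end

lemma unit_antipodal:
  fixes m l :: "'a::real_inner"
  assumes "norm m = 1" "norm l = 1" "1 + m \<bullet> l = 0"
  shows "l = - m"
proof -
  have "(norm (m + l))\<^sup>2 = 2 * (1 + m \<bullet> l)"
    using assms(1,2)
    by (simp add: power2_norm_eq_inner inner_add_left inner_add_right inner_commute norm_eq_1)
  then have "m + l = 0" using assms(3) by simp
  then show ?thesis by (simp add: eq_neg_iff_add_eq_0 add.commute)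
qed

text \<open>With such a \<open>c\<close> and \<open>k = m - l\<close> one has \<open>k \<bullet> c = 0\<close>, and the transvection along \<open>c\<close> and \<open>k\<close> carries the linear form
\<open>m\<close> to \<open>l\<close>.  The multiple of \<open>m + l\<close> with these products exists unless \<open>m + l = 0\<close>.\<close>

lemma rotating_transvection:
  fixes m l :: "'a::real_inner"
  assumes "norm m = 1" "norm l = 1" "l \<noteq> - m"
  obtains c where "m \<bullet> c = 1" "l \<bullet> c = 1"
proof -
  have nz: "1 + m \<bullet> l \<noteq> 0" using unit_antipodal assms by blast
  have mm: "m \<bullet> m = 1" "l \<bullet> l = 1" using assms by (simp_all add: dot_square_norm)
  show ?thesis
  proof (rule that[of "(1 / (1 + m \<bullet> l)) *\<^sub>R (m + l)"])
    show "m \<bullet> ((1 / (1 + m \<bullet> l)) *\<^sub>R (m + l)) = 1"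
      using nz by (simp add: inner_add_right mm)
    show "l \<bullet> ((1 / (1 + m \<bullet> l)) *\<^sub>R (m + l)) = 1"
      using nz by (simp add: inner_add_right mm inner_commute add.commute)
  qed
qed

locale transvective_monoid = map_monoid G for G :: "('a::euclidean_space \<Rightarrow> 'a) set" +
  assumes transvection_tangent: "k \<bullet> c = 0 \<Longrightarrow> transvection_field c k \<in> tangent_fields G"
begin

lemma move_covector:
  assumes "(\<lambda>x. (m \<bullet> x) ^ n *\<^sub>R b) \<in> tangent_fields G" "norm m = 1" "norm l = 1"
    "m \<bullet> b = 0" "l \<bullet> b = 0"
  shows "(\<lambda>x. (l \<bullet> x) ^ n *\<^sub>R b) \<in> tangent_fields G"
proof (cases "l = - m")
  case True
  then have "(\<lambda>x. (l \<bullet> x) ^ n *\<^sub>R b) = (\<lambda>x. (-1) ^ n *\<^sub>R (m \<bullet> x) ^ n *\<^sub>R b)"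
    by (simp add: fun_eq_iff flip: power_mult_distrib)
  then show ?thesis using tangent_fields_scale[OF assms(1), of "(-1) ^ n"] by metis
next
  case False
  then obtain c where c: "m \<bullet> c = 1" "l \<bullet> c = 1" using rotating_transvection assms by blast
  then have kc: "(m - l) \<bullet> c = 0" by (simp add: inner_diff_left)
  have "m \<bullet> (x - ((m - l) \<bullet> x) *\<^sub>R c) = l \<bullet> x" for x
    by (simp add: inner_diff_left inner_diff_right c)
  moreover have "(m - l) \<bullet> b = 0" by (simp add: inner_diff_left assms)
  ultimately show ?thesis
    using push_transvection[OF transvection_tangent[OF kc] kc assms(1)] by simp
qed

lemma move_vector:
  assumes "(\<lambda>x. (l \<bullet> x) ^ n *\<^sub>R b) \<in> tangent_fields G" "norm b = 1" "norm b' = 1"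
    "l \<bullet> b = 0" "l \<bullet> b' = 0"
  shows "(\<lambda>x. (l \<bullet> x) ^ n *\<^sub>R b') \<in> tangent_fields G"
proof (cases "b' = - b")
  case True
  then show ?thesis using tangent_fields_scale[OF assms(1), of "-1"] by simp
next
  case False
  then obtain k where k: "b \<bullet> k = 1" "b' \<bullet> k = 1" using rotating_transvection assms by blast
  then have kc: "k \<bullet> (b' - b) = 0" by (simp add: inner_diff_right inner_commute)
  have "l \<bullet> (x - (k \<bullet> x) *\<^sub>R (b' - b)) = l \<bullet> x" for x
    by (simp add: inner_diff_right assms)
  moreover have "k \<bullet> b = 1" using k by (simp add: inner_commute)
  ultimately show ?thesis
    using push_transvection[OF transvection_tangent[OF kc] kc assms(1)]
    by (simp add: scaleR_diff_right)
qed

text \<open>To carry the pair \<open>(m, a)\<close> to \<open>(l, b)\<close> one needs a form \<open>h\<close> that annihilates both \<open>a\<close> and \<open>b\<close>, which exists in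
dimension at least \<open>3\<close>: move \<open>m\<close> to \<open>h\<close>, then \<open>a\<close> to \<open>b\<close>, then \<open>h\<close> to \<open>l\<close>.\<close>

lemma shear_field_orbit:
  assumes start: "(\<lambda>x. (m \<bullet> x) ^ n *\<^sub>R a) \<in> tangent_fields G" "norm m = 1" "norm a = 1" "m \<bullet> a = 0"
    and lb: "l \<bullet> b = 0" "l \<noteq> 0" "b \<noteq> 0" and dim: "2 < DIM('a)"
  shows "(\<lambda>x. (l \<bullet> x) ^ n *\<^sub>R b) \<in> tangent_fields G"
proof -
  define l1 where "l1 = l /\<^sub>R norm l"
  define b1 where "b1 = b /\<^sub>R norm b"
  have n1: "norm l1 = 1" "norm b1 = 1" "l1 \<bullet> b1 = 0"
    using lb by (simp_all add: l1_def b1_def)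
  have "dim {a, b1} \<le> card {a, b1}" by (rule dim_le_card') simp
  also have "\<dots> \<le> 2" by (simp add: card_insert_if)
  finally have "dim {a, b1} < DIM('a)" using dim by simp
  then obtain h where h: "h \<noteq> 0" "\<And>y. y \<in> span {a, b1} \<Longrightarrow> orthogonal h y"
    using orthogonal_to_subspace_exists by blast
  define h1 where "h1 = h /\<^sub>R norm h"
  have "h \<bullet> a = 0" "h \<bullet> b1 = 0" using h(2) by (auto simp: orthogonal_def span_base)
  then have h1: "norm h1 = 1" "h1 \<bullet> a = 0" "h1 \<bullet> b1 = 0" using h(1) by (simp_all add: h1_def)
  have "(\<lambda>x. (h1 \<bullet> x) ^ n *\<^sub>R a) \<in> tangent_fields G"
    by (rule move_covector[OF start(1,2) h1(1) start(4) h1(2)])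
  then have "(\<lambda>x. (h1 \<bullet> x) ^ n *\<^sub>R b1) \<in> tangent_fields G"
    by (rule move_vector[OF _ start(3) n1(2) h1(2,3)])
  then have "(\<lambda>x. (l1 \<bullet> x) ^ n *\<^sub>R b1) \<in> tangent_fields G"
    by (rule move_covector[OF _ h1(1) n1(1) h1(3) n1(3)])
  from tangent_fields_scale[OF this, of "norm l ^ n * norm b"]
  have "(\<lambda>x. (norm l ^ n * norm b) *\<^sub>R (l1 \<bullet> x) ^ n *\<^sub>R b1) \<in> tangent_fields G" .
  also have "(\<lambda>x. (norm l ^ n * norm b) *\<^sub>R (l1 \<bullet> x) ^ n *\<^sub>R b1) = (\<lambda>x. (l \<bullet> x) ^ n *\<^sub>R b)"
    using lb by (simp add: l1_def b1_def fun_eq_iff power_mult_distrib power_inverse field_simps)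
  finally show ?thesis .
qed

text \<open>The field has divergence \<open>(r \<bullet> b) (m \<bullet> x)\<^sup>n = (m \<bullet> x)\<^sup>n\<close>; the two relations \<open>m \<bullet> b = 0\<close> and \<open>r \<bullet> b = 1\<close> that
give this value are preserved by transvections.\<close>

lemma move_weighted_covector:
  assumes "(\<lambda>x. ((r \<bullet> x) * (m \<bullet> x) ^ n) *\<^sub>R b) \<in> tangent_fields G" "norm m = 1" "norm l = 1"
    "m \<bullet> b = 0" "r \<bullet> b = 1"
  shows "\<exists>r b. (\<lambda>x. ((r \<bullet> x) * (l \<bullet> x) ^ n) *\<^sub>R b) \<in> tangent_fields G \<and> l \<bullet> b = 0 \<and> r \<bullet> b = 1"
proof (cases "l = - m")
  case True
  then have "(\<lambda>x. ((r \<bullet> x) * (l \<bullet> x) ^ n) *\<^sub>R b) = (\<lambda>x. (-1) ^ n *\<^sub>R ((r \<bullet> x) * (m \<bullet> x) ^ n) *\<^sub>R b)"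
    by (simp add: fun_eq_iff mult.left_commute flip: power_mult_distrib)
  then have "(\<lambda>x. ((r \<bullet> x) * (l \<bullet> x) ^ n) *\<^sub>R b) \<in> tangent_fields G"
    using tangent_fields_scale[OF assms(1), of "(-1) ^ n"] by metis
  then show ?thesis using assms True by (intro exI[of _ r] exI[of _ b]) simp
next
  case False
  then obtain c where c: "m \<bullet> c = 1" "l \<bullet> c = 1" using rotating_transvection assms by blast
  define k where "k = m - l"
  have kc: "k \<bullet> c = 0" using c by (simp add: k_def inner_diff_left)
  define r' where "r' = r - (r \<bullet> c) *\<^sub>R k"
  define b' where "b' = b + (k \<bullet> b) *\<^sub>R c"
  have "m \<bullet> (x - (k \<bullet> x) *\<^sub>R c) = l \<bullet> x" "r \<bullet> (x - (k \<bullet> x) *\<^sub>R c) = r' \<bullet> x" for x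
    by (simp_all add: k_def r'_def inner_diff_left inner_diff_right c)
  then have "(\<lambda>x. ((r' \<bullet> x) * (l \<bullet> x) ^ n) *\<^sub>R b') \<in> tangent_fields G"
    using push_transvection[OF transvection_tangent[OF kc] kc assms(1)]
    by (simp add: b'_def scaleR_add_right mult.assoc)
  moreover have "l \<bullet> b' = 0"
    using assms(4) c by (simp add: b'_def k_def inner_add_right inner_diff_left inner_diff_right)
  moreover have "r' \<bullet> b' = 1"
    using assms(5) kc by (simp add: r'_def b'_def inner_add_right inner_diff_left)
  ultimately show ?thesis by blast
qed

end

lemma shear_scalar_polynomial: "real_polynomial_function (\<lambda>x. (l \<bullet> x) ^ n)"
  by (intro real_polynomial_function_power real_polynomial_function.intros(1) bounded_linear_inner_right)

lemma shear_polynomial: "polynomial_function (\<lambda>x. (l \<bullet> x) ^ n *\<^sub>R b)"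
  using shear_scalar_polynomial[of l n] by (auto simp: real_polynomial_function_eq)

lemma weighted_shear_polynomial: "polynomial_function (\<lambda>x. ((r \<bullet> x) * (l \<bullet> x) ^ n) *\<^sub>R b)"
proof -
  have "real_polynomial_function (\<lambda>x. (r \<bullet> x) * (l \<bullet> x) ^ n)"
    using real_polynomial_function.intros(4)[OF shear_scalar_polynomial[of r 1] shear_scalar_polynomial[of l n]]
    by simp
  then show ?thesis by (auto simp: real_polynomial_function_eq)
qed

lemma weighted_power_has_derivative:
  "((\<lambda>x. (r \<bullet> x) * (l \<bullet> x) ^ n) has_derivative
     (\<lambda>h. (r \<bullet> x) * (real n * (l \<bullet> x) ^ (n - 1) * (l \<bullet> h)) + (r \<bullet> h) * (l \<bullet> x) ^ n)) (at x)"
  by (intro has_derivative_mult linear_power_has_derivative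
      bounded_linear_imp_has_derivative bounded_linear_inner_right)

text \<open>By the reduction to a single component it suffices to treat \<open>(l \<bullet> x)\<^sup>N m\<close>.  Its divergence is a multiple of \<open>(l \<bullet> x)\<^sup>N\<^sup>-\<^sup>1\<close>, which up to a
factor is also the divergence of a weighted field obtained from the given one; a combination of the two is
divergence free.\<close>

lemma (in transvective_monoid) polynomial_fields_in_tangent_fields:
  assumes free: "\<And>X. polynomial_function X \<Longrightarrow> has_real_divergence X (\<lambda>x. 0) \<Longrightarrow> X \<in> tangent_fields G"
    and start: "\<And>n. (\<lambda>x. ((r \<bullet> x) * (m \<bullet> x) ^ n) *\<^sub>R b) \<in> tangent_fields G"
    and norm: "norm m = 1" "m \<bullet> b = 0" "r \<bullet> b = 1"
    and X: "polynomial_function X"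
  shows "X \<in> tangent_fields G"
proof -
  have e: "m \<noteq> 0" using norm(1) by auto
  have pw: "(\<lambda>x. (l \<bullet> x) ^ N *\<^sub>R m) \<in> tangent_fields G" if l: "l \<bullet> m \<noteq> 0" for l N
  proof (cases N)
    case 0
    have "has_real_divergence (\<lambda>x. 1 *\<^sub>R m) (\<lambda>x. 0)"
      by (rule has_real_divergence_scalar_times_vector[where f' = "\<lambda>x h. 0"]) simp
    then show ?thesis using 0 by (intro free) auto
  next
    case (Suc n)
    define l1 where "l1 = l /\<^sub>R norm l"
    have l0: "l \<noteq> 0" using l by auto
    then have l1: "norm l1 = 1" by (simp add: l1_def)
    obtain r' b' where rb: "(\<lambda>x. ((r' \<bullet> x) * (l1 \<bullet> x) ^ n) *\<^sub>R b') \<in> tangent_fields G"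
      "l1 \<bullet> b' = 0" "r' \<bullet> b' = 1"
      using move_weighted_covector[OF start norm(1) l1 norm(2,3)] by blast
    let ?Z = "\<lambda>x. ((r' \<bullet> x) * (l1 \<bullet> x) ^ n) *\<^sub>R b'"
    let ?W = "\<lambda>x. (l1 \<bullet> x) ^ Suc n *\<^sub>R m"
    let ?\<kappa> = "- (real (Suc n) * (l1 \<bullet> m))"
    have "has_real_divergence ?Z (\<lambda>x. (l1 \<bullet> x) ^ n)"
      using has_real_divergence_scalar_times_vector[OF weighted_power_has_derivative, of r' l1 n b']
      by (simp add: rb)
    moreover have "has_real_divergence ?W (\<lambda>x. real (Suc n) * (l1 \<bullet> x) ^ n * (l1 \<bullet> m))"
      using has_real_divergence_scalar_times_vector[OF linear_power_has_derivative, of l1 "Suc n" m]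
      by (simp del: of_nat_Suc)
    ultimately have "has_real_divergence (\<lambda>x. ?W x + ?\<kappa> *\<^sub>R ?Z x)
        (\<lambda>x. real (Suc n) * (l1 \<bullet> x) ^ n * (l1 \<bullet> m) + ?\<kappa> * (l1 \<bullet> x) ^ n)"
      by (intro has_real_divergence_add has_real_divergence_scale)
    then have "has_real_divergence (\<lambda>x. ?W x + ?\<kappa> *\<^sub>R ?Z x) (\<lambda>x. 0)"
      by (simp add: mult_ac del: of_nat_Suc)
    moreover have "polynomial_function ?W" "polynomial_function ?Z"
      by (rule shear_polynomial weighted_shear_polynomial)+
    ultimately have "(\<lambda>x. ?W x + ?\<kappa> *\<^sub>R ?Z x) \<in> tangent_fields G"
      by (intro free polynomial_function_add polynomial_function_cmul)
    from tangent_fields_add[OF this tangent_fields_scale[OF rb(1), of "- ?\<kappa>"]]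
    have "?W \<in> tangent_fields G" by simp
    from tangent_fields_scale[OF this, of "norm l ^ Suc n"]
    have "(\<lambda>x. norm l ^ Suc n *\<^sub>R ?W x) \<in> tangent_fields G" .
    also have "(\<lambda>x. norm l ^ Suc n *\<^sub>R ?W x) = (\<lambda>x. (l \<bullet> x) ^ N *\<^sub>R m)"
    proof
      fix x
      have "norm l * (l1 \<bullet> x) = l \<bullet> x" using l0 by (simp add: l1_def)
      then have "norm l ^ Suc n * (l1 \<bullet> x) ^ Suc n = (l \<bullet> x) ^ Suc n"
        by (simp only: power_mult_distrib[symmetric])
      then show "norm l ^ Suc n *\<^sub>R ?W x = (l \<bullet> x) ^ N *\<^sub>R m" by (simp only: scaleR_scaleR Suc)
    qed
    finally show ?thesis .
  qed
  obtain Y q where Y: "Y \<in> fun_span shear_fields" and q: "q \<in> fun_span (linear_powers m)"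
    and Xeq: "X = (\<lambda>x. Y x + q x *\<^sub>R m)"
    using polynomial_field_reduction[OF X e] by blast
  have "Y \<in> tangent_fields G"
  proof -
    have "(\<lambda>x. (l \<bullet> x) ^ n *\<^sub>R b) \<in> tangent_fields G" if "l \<bullet> b = 0" for l n b
    proof (rule free)
      show "polynomial_function (\<lambda>x. (l \<bullet> x) ^ n *\<^sub>R b)"
        by (rule shear_polynomial)
      show "has_real_divergence (\<lambda>x. (l \<bullet> x) ^ n *\<^sub>R b) (\<lambda>x. 0)"
        by (intro fun_span_shear_fields_divergence_free fun_span_base shear_fieldsI that)
    qed
    then have "shear_fields \<subseteq> tangent_fields G" unfolding shear_fields_def by blast
    with Y show ?thesis using fun_span_subset[OF fun_subspace_tangent_fields] by blast
  qed
  moreover have "(\<lambda>x. q x *\<^sub>R m) \<in> tangent_fields G"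
    using q
  proof (induction rule: fun_span.induct)
    case zero
    show ?case using tangent_fields_0 by simp
  next
    case (step g f c)
    obtain l n where g: "g = (\<lambda>x. (l \<bullet> x) ^ n)" and l: "l \<bullet> m \<noteq> 0"
      using step.hyps(1) by (auto simp: linear_powers_def)
    from tangent_fields_add[OF tangent_fields_scale[OF pw[OF l, of n], of c] step.IH]
    show ?case by (simp add: g scaleR_add_left)
  qed
  ultimately show ?thesis unfolding Xeq by (rule tangent_fields_add)
qed

section \<open>Fields tangent to shears and overshears\<close>

lemma slice_regular_monomial: "slice_regular (\<lambda>u. u ^ n * a)"
  unfolding slice_regular_def
proof (intro exI allI)
  fix u :: quat
  have "(\<lambda>k. if k = n then u ^ k * a else 0) sums (u ^ n * a)" by (rule sums_single)
  also have "(\<lambda>k. if k = n then u ^ k * a else 0) = (\<lambda>k. u ^ k * (if k = n then a else 0))"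
    by auto
  finally show "(\<lambda>k. u ^ k * (if k = n then a else 0)) sums (u ^ n * a)" .
qed

lemma real_functional_fst: "real_functional fst"
  unfolding real_functional_def right_linear_def
  by (intro conjI exI[of _ "1::real"] exI[of _ "0::real"]) simp_all

lemma real_functional_snd: "real_functional snd"
  unfolding real_functional_def right_linear_def
  by (intro conjI exI[of _ "0::real"] exI[of _ "1::real"]) simp_all

lemma shear_first: "slice_regular f \<Longrightarrow> (\<lambda>p. p + (f (snd p), 0)) \<in> shears"
  unfolding shears_def
  by (rule CollectI, rule exI[of _ snd], rule exI[of _ 1], rule exI[of _ 0], rule exI[of _ f])
    (auto simp: real_functional_snd norm_Pair)

lemma shear_second: "slice_regular f \<Longrightarrow> (\<lambda>p. p + (0, f (fst p))) \<in> shears"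
  unfolding shears_def
  by (rule CollectI, rule exI[of _ fst], rule exI[of _ 0], rule exI[of _ 1], rule exI[of _ f])
    (auto simp: real_functional_fst norm_Pair)

lemma overshear_first:
  "slice_regular f \<Longrightarrow> (\<lambda>p. p + (fst p * (exp (f (snd p)) - 1), 0)) \<in> overshears"
  unfolding overshears_def
  by (rule CollectI, rule exI[of _ snd], rule exI[of _ 1], rule exI[of _ 0], rule exI[of _ f])
    (auto simp: real_functional_snd norm_Pair)

text \<open>The real part of \<open>x\<close> is \<open>(x - i x i - j x j - k x k) / 4\<close>, applied to the product of \<open>w\<close> and the conjugate of \<open>k\<close>, whose
real part is \<open>k \<bullet> w\<close>.\<close>

lemma quat_inner_scaleR:
  "(k \<bullet> w) *\<^sub>R c = (1/4) *\<^sub>R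
    (1 * w * (Quat (qRe k) (- qI k) (- qJ k) (- qK k) * c)
     - Quat 0 1 0 0 * w * (Quat (qRe k) (- qI k) (- qJ k) (- qK k) * Quat 0 1 0 0 * c)
     - Quat 0 0 1 0 * w * (Quat (qRe k) (- qI k) (- qJ k) (- qK k) * Quat 0 0 1 0 * c)
     - Quat 0 0 0 1 * w * (Quat (qRe k) (- qI k) (- qJ k) (- qK k) * Quat 0 0 0 1 * c))"
  by (rule quat_eqI) (simp_all add: inner_quat_def algebra_simps)

text \<open>The intermediate coefficients are sums over noncommutative words in \<open>a\<close> and \<open>b\<close>; the top coefficient is the one that
is extracted later.\<close>

lemma power_of_affine_expansion:
  fixes a b :: "'a \<Rightarrow> 'b::real_algebra_1"
  shows "\<exists>c. (\<forall>s x. (a x + s *\<^sub>R b x) ^ n = (\<Sum>k\<le>n. s ^ k *\<^sub>R c k x)) \<and> (\<forall>x. c n x = b x ^ n)"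
proof (induction n)
  case 0
  show ?case by (intro exI[of _ "\<lambda>_ _. 1"]) simp
next
  case (Suc n)
  then obtain c where c: "\<And>s x. (a x + s *\<^sub>R b x) ^ n = (\<Sum>k\<le>n. s ^ k *\<^sub>R c k x)" "\<And>x. c n x = b x ^ n"
    by blast
  define c' where "c' k x = (if k \<le> n then c k x * a x else 0) + (case k of 0 \<Rightarrow> 0 | Suc j \<Rightarrow> c j x * b x)" for k x
  have "(a x + s *\<^sub>R b x) ^ Suc n = (\<Sum>k\<le>Suc n. s ^ k *\<^sub>R c' k x)" for s x
  proof -
    have "(a x + s *\<^sub>R b x) ^ Suc n = (\<Sum>k\<le>n. s ^ k *\<^sub>R c k x) * (a x + s *\<^sub>R b x)"
      by (simp only: power_Suc2 c(1))
    also have "\<dots> = (\<Sum>k\<le>n. s ^ k *\<^sub>R (c k x * a x)) + (\<Sum>k\<le>n. s ^ Suc k *\<^sub>R (c k x * b x))"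
      by (simp add: distrib_left sum_distrib_right scaleR_sum_right mult.commute)
    also have "(\<Sum>k\<le>n. s ^ k *\<^sub>R (c k x * a x)) = (\<Sum>k\<le>Suc n. s ^ k *\<^sub>R (if k \<le> n then c k x * a x else 0))"
      by simp
    also have "(\<Sum>k\<le>n. s ^ Suc k *\<^sub>R (c k x * b x)) =
        (\<Sum>k\<le>Suc n. s ^ k *\<^sub>R (case k of 0 \<Rightarrow> 0 | Suc j \<Rightarrow> c j x * b x))"
      by (subst sum.atMost_Suc_shift) simp
    finally show ?thesis by (simp only: c'_def scaleR_add_right sum.distrib)
  qed
  moreover have "c' (Suc n) x = b x ^ Suc n" for x by (simp add: c'_def c(2) power_Suc2 del: power_Suc)
  ultimately show ?case by blast
qed

lemma quat_exp_remainder: "norm (exp q - 1 - q) \<le> (norm q)\<^sup>2 * exp (norm (q::quat))"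
proof -
  let ?f = "\<lambda>n. q ^ (n + 2) /\<^sub>R fact (n + 2)"
  have "(\<lambda>n. q ^ n /\<^sub>R fact n) sums exp q" by (rule exp_converges)
  from sums_split_initial_segment[OF this, of 2]
  have s: "?f sums (exp q - 1 - q)" by (simp add: numeral_2_eq_2 algebra_simps)
  have "(\<lambda>n. norm q ^ n /\<^sub>R fact n) sums exp (norm q)"
    by (rule exp_converges)
  from sums_mult[OF this, of "(norm q)\<^sup>2"]
  have t: "(\<lambda>n. (norm q)\<^sup>2 * (norm q ^ n /\<^sub>R fact n)) sums ((norm q)\<^sup>2 * exp (norm q))" .
  have le: "norm (?f n) \<le> (norm q)\<^sup>2 * (norm q ^ n /\<^sub>R fact n)" for n
  proof -
    have "norm (?f n) = norm q ^ (n + 2) / fact (n + 2)" by (simp add: norm_power norm_mult divide_simps)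
    also have "\<dots> \<le> norm q ^ (n + 2) / fact n"
      by (intro divide_left_mono fact_mono) auto
    also have "\<dots> = (norm q)\<^sup>2 * (norm q ^ n /\<^sub>R fact n)"
      by (simp add: power_add power2_eq_square divide_inverse mult_ac)
    finally show ?thesis .
  qed
  have "norm (suminf ?f) \<le> (\<Sum>n. (norm q)\<^sup>2 * (norm q ^ n /\<^sub>R fact n))"
    by (rule norm_suminf_le[OF le]) (rule sums_summable[OF t])
  then show ?thesis using sums_unique[OF s] sums_unique[OF t] by simp
qed

locale shear_monoid = map_monoid G for G :: "(quat \<times> quat \<Rightarrow> quat \<times> quat) set" +
  assumes shears_subset: "shears \<subseteq> G"
begin

lemma monomial_first: "(\<lambda>p. (snd p ^ n * a, 0)) \<in> tangent_fields G"
proof (rule tangent_field_of_exact_flow)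
  show "continuous_on UNIV (\<lambda>p :: quat \<times> quat. (snd p ^ n * a, 0 :: quat))" by (intro continuous_intros)
  fix t
  have "(\<lambda>p. p + (snd p ^ n * (t *\<^sub>R a), 0)) \<in> G"
    using shear_first[OF slice_regular_monomial] shears_subset by blast
  then show "(\<lambda>p. p + t *\<^sub>R (snd p ^ n * a, 0)) \<in> G" by simp
qed

lemma monomial_second: "(\<lambda>p. (0, fst p ^ n * a)) \<in> tangent_fields G"
proof (rule tangent_field_of_exact_flow)
  show "continuous_on UNIV (\<lambda>p :: quat \<times> quat. (0 :: quat, fst p ^ n * a))" by (intro continuous_intros)
  fix t
  have "(\<lambda>p. p + (0, fst p ^ n * (t *\<^sub>R a))) \<in> G"
    using shear_second[OF slice_regular_monomial] shears_subset by blast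
  then show "(\<lambda>p. p + t *\<^sub>R (0, fst p ^ n * a)) \<in> G" by simp
qed

lemma translation_mem: "(\<lambda>p. c + p) \<in> continuous_closure G"
proof (rule subset_continuous_closure)
  show "continuous_on UNIV (\<lambda>p. c + p)" by (intro continuous_intros)
  have "(\<lambda>p. p + (snd p ^ 0 * fst c, 0)) \<in> G" "(\<lambda>p. p + (0, fst p ^ 0 * snd c)) \<in> G"
    using shear_first[OF slice_regular_monomial] shear_second[OF slice_regular_monomial] shears_subset by blast+
  from comp_mem[OF this] show "(\<lambda>p. c + p) \<in> G"
    by (simp add: o_def prod_eq_iff add_ac plus_prod_def case_prod_unfold)
qed

lemma translate_tangent_field:
  assumes "Y \<in> tangent_fields G"
  shows "(\<lambda>p. Y (c + p)) \<in> tangent_fields G"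
  using tangent_fields_affine_push[OF assms linear_id[unfolded id_def] translation_mem translation_mem, of "-c" c]
  by simp

text \<open>\<open>(w + q)\<^sup>2 a - w\<^sup>2 a - q\<^sup>2 a - w q a = q w a\<close>.  The shear \<open>z + w a\<close> commutes with left multiplication by
quaternions; the new field does not.\<close>

lemma left_linear_first: "(\<lambda>p. (q * snd p * a, 0)) \<in> tangent_fields G"
proof -
  note S = fun_subspace_tangent_fields
  have "(\<lambda>p. (((snd p + q) ^ 2 * a, 0) - (snd p ^ 2 * a, 0) - (snd p ^ 0 * (q ^ 2 * a), 0))
      - (snd p ^ 1 * (q * a), 0)) \<in> tangent_fields G"
    using translate_tangent_field[OF monomial_first[of 2 a], of "(0, q)"]
    by (intro fun_subspace_diff[OF S] monomial_first) (simp add: add.commute)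
  then show ?thesis by (simp add: power2_eq_square algebra_simps)
qed

lemma left_linear_second: "(\<lambda>p. (0, q * fst p * a)) \<in> tangent_fields G"
proof -
  note S = fun_subspace_tangent_fields
  have "(\<lambda>p. ((0, (fst p + q) ^ 2 * a) - (0, fst p ^ 2 * a) - (0, fst p ^ 0 * (q ^ 2 * a)))
      - (0, fst p ^ 1 * (q * a))) \<in> tangent_fields G"
    using translate_tangent_field[OF monomial_second[of 2 a], of "(q, 0)"]
    by (intro fun_subspace_diff[OF S] monomial_second) (simp add: add.commute)
  then show ?thesis by (simp add: power2_eq_square algebra_simps)
qed

lemma block_transvection_first: "(\<lambda>p. ((k \<bullet> snd p) *\<^sub>R c, 0)) \<in> tangent_fields G"
proof -
  note S = fun_subspace_tangent_fields
  let ?k = "Quat (qRe k) (- qI k) (- qJ k) (- qK k)"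
  have "(\<lambda>p. (1/4) *\<^sub>R ((1 * snd p * (?k * c), 0)
     - (Quat 0 1 0 0 * snd p * (?k * Quat 0 1 0 0 * c), 0)
     - (Quat 0 0 1 0 * snd p * (?k * Quat 0 0 1 0 * c), 0)
     - (Quat 0 0 0 1 * snd p * (?k * Quat 0 0 0 1 * c), 0))) \<in> tangent_fields G"
    by (intro fun_subspace_scale[OF S] fun_subspace_diff[OF S] left_linear_first)
  also have "(\<lambda>p. (1/4) *\<^sub>R ((1 * snd p * (?k * c), 0)
     - (Quat 0 1 0 0 * snd p * (?k * Quat 0 1 0 0 * c), 0)
     - (Quat 0 0 1 0 * snd p * (?k * Quat 0 0 1 0 * c), 0)
     - (Quat 0 0 0 1 * snd p * (?k * Quat 0 0 0 1 * c), 0))) = (\<lambda>p. ((k \<bullet> snd p) *\<^sub>R c, 0 :: quat))"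
    unfolding quat_inner_scaleR by (simp only: scaleR_Pair diff_Pair diff_0_right scaleR_zero_right)
  finally show ?thesis .
qed

lemma block_transvection_second: "(\<lambda>p. (0, (k \<bullet> fst p) *\<^sub>R c)) \<in> tangent_fields G"
proof -
  note S = fun_subspace_tangent_fields
  let ?k = "Quat (qRe k) (- qI k) (- qJ k) (- qK k)"
  have "(\<lambda>p. (1/4) *\<^sub>R ((0, 1 * fst p * (?k * c))
     - (0, Quat 0 1 0 0 * fst p * (?k * Quat 0 1 0 0 * c))
     - (0, Quat 0 0 1 0 * fst p * (?k * Quat 0 0 1 0 * c))
     - (0, Quat 0 0 0 1 * fst p * (?k * Quat 0 0 0 1 * c)))) \<in> tangent_fields G"
    by (intro fun_subspace_scale[OF S] fun_subspace_diff[OF S] left_linear_second)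
  also have "(\<lambda>p. (1/4) *\<^sub>R ((0, 1 * fst p * (?k * c))
     - (0, Quat 0 1 0 0 * fst p * (?k * Quat 0 1 0 0 * c))
     - (0, Quat 0 0 1 0 * fst p * (?k * Quat 0 0 1 0 * c))
     - (0, Quat 0 0 0 1 * fst p * (?k * Quat 0 0 0 1 * c)))) = (\<lambda>p. (0 :: quat, (k \<bullet> fst p) *\<^sub>R c))"
    unfolding quat_inner_scaleR by (simp only: scaleR_Pair diff_Pair diff_0_right scaleR_zero_right)
  finally show ?thesis .
qed

text \<open>Push the field \<open>(0, (k \<bullet> z) d)\<close> along the transvection \<open>z + (l \<bullet> w) c\<close>.  Besides off-diagonal terms, which are known to
be tangent, this produces diagonal blocks with opposite traces.\<close>

lemma diagonal_block_field:
  "(\<lambda>p. (((l \<bullet> d) * (k \<bullet> fst p)) *\<^sub>R c, - (((k \<bullet> c) * (l \<bullet> snd p)) *\<^sub>R d))) \<in> tangent_fields G"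
proof -
  note S = fun_subspace_tangent_fields
  have tv: "transvection_field (c, 0) (0, l) \<in> tangent_fields G"
    using block_transvection_first[of l c] by (simp add: inner_prod_def)
  have Y: "(\<lambda>p. (0, (k \<bullet> fst p) *\<^sub>R d)) \<in> tangent_fields G" by (rule block_transvection_second)
  from push_transvection[OF tv _ Y]
  have "(\<lambda>p. (0, (k \<bullet> (fst p - (l \<bullet> snd p) *\<^sub>R c)) *\<^sub>R d)
      + (l \<bullet> ((k \<bullet> (fst p - (l \<bullet> snd p) *\<^sub>R c)) *\<^sub>R d)) *\<^sub>R (c, 0)) \<in> tangent_fields G"
    by (simp add: inner_prod_def)
  from fun_subspace_add[OF S fun_subspace_diff[OF S this Y]
      fun_subspace_scale[OF S tv, of "(l \<bullet> d) * (k \<bullet> c)"]]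
  show ?thesis
    by (simp add: inner_prod_def inner_diff_right algebra_simps)
qed

text \<open>The diagonal blocks of \<open>(k \<bullet> x) c\<close> have traces \<open>k1 \<bullet> c1\<close> and \<open>k2 \<bullet> c2\<close> with sum zero.  The fields \<open>P\<close> and \<open>Q\<close> below split off
each block with a rank-one correction in the other one; \<open>D\<close> cancels the two corrections.\<close>

sublocale transvective_monoid G
proof
  fix k c :: "quat \<times> quat" assume kc: "k \<bullet> c = 0"
  note S = fun_subspace_tangent_fields
  obtain k1 k2 c1 c2 where [simp]: "k = (k1, k2)" "c = (c1, c2)" by (cases k; cases c)
  have kc': "k2 \<bullet> c2 = - (k1 \<bullet> c1)" using kc by (simp add: inner_prod_def)
  have one: "(1 :: quat) \<bullet> 1 = 1" by (simp add: inner_quat_def)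
  let ?P = "\<lambda>p. ((((1::quat) \<bullet> 1) * (k1 \<bullet> fst p)) *\<^sub>R c1, - (((k1 \<bullet> c1) * (1 \<bullet> snd p)) *\<^sub>R (1::quat)))"
  let ?Q = "\<lambda>p. (((k2 \<bullet> c2) * (1 \<bullet> fst p)) *\<^sub>R (1::quat), - ((((1::quat) \<bullet> 1) * (k2 \<bullet> snd p)) *\<^sub>R c2))"
  let ?D = "\<lambda>p. ((((1::quat) \<bullet> 1) * (1 \<bullet> fst p)) *\<^sub>R (1::quat), - ((((1::quat) \<bullet> 1) * (1 \<bullet> snd p)) *\<^sub>R (1::quat)))"
  have "(\<lambda>p. (((?P p - ?Q p) - (k1 \<bullet> c1) *\<^sub>R ?D p) + ((k2 \<bullet> snd p) *\<^sub>R c1, 0))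
      + (0, (k1 \<bullet> fst p) *\<^sub>R c2)) \<in> tangent_fields G"
    by (intro fun_subspace_add[OF S] fun_subspace_diff[OF S] fun_subspace_scale[OF S] diagonal_block_field
        block_transvection_first block_transvection_second)
  then show "transvection_field c k \<in> tangent_fields G"
    by (simp add: one kc' inner_prod_def algebra_simps)
qed


text \<open>The transvection replaces \<open>w\<close> by \<open>w + s r\<close>, where \<open>r\<close> is the coordinate of \<open>w\<close> along the quaternion unit \<open>i\<close>.  Since \<open>r\<close> is real,
the coefficient of \<open>s\<^sup>n\<close> in \<open>(w + s r)\<^sup>n\<close> is \<open>r\<^sup>n\<close>.\<close>

lemma real_power_first: "(\<lambda>p. ((0, Quat 0 1 0 0) \<bullet> p) ^ n *\<^sub>R (1, 0)) \<in> tangent_fields G"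
proof -
  let ?i = "Quat 0 1 0 0"
  obtain c where c: "\<And>s w. (w + s *\<^sub>R (?i \<bullet> w) *\<^sub>R 1) ^ n = (\<Sum>k\<le>n. s ^ k *\<^sub>R c k w)"
    "\<And>w. c n w = ((?i \<bullet> w) *\<^sub>R 1) ^ n"
    using power_of_affine_expansion[of "\<lambda>w. w" "\<lambda>w. (?i \<bullet> w) *\<^sub>R 1" n] by blast
  have "(\<lambda>p. \<Sum>k\<le>n. s ^ k *\<^sub>R (c k (snd p), 0)) \<in> tangent_fields G" for s
  proof -
    have orth: "(0, ?i) \<bullet> (0 :: quat, (- s) *\<^sub>R 1 :: quat) = 0" by (simp add: inner_prod_def inner_quat_def)
    from push_transvection[OF transvection_tangent[OF orth] orth monomial_first[of n 1]]
    have "(\<lambda>p. ((snd p + s *\<^sub>R (?i \<bullet> snd p) *\<^sub>R 1) ^ n, 0)) \<in> tangent_fields G"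
      by (simp add: inner_prod_def mult.commute)
    then show ?thesis by (simp add: c(1)[unfolded scaleR_scaleR] scaleR_Pair sum_prod)
  qed
  from coefficients_in_fun_subspace[OF fun_subspace_tangent_fields zero_less_one this, where k = n]
  show ?thesis by (simp add: c(2) inner_prod_def scaleR_power)
qed

lemma shear_fields_tangent: "l \<bullet> b = 0 \<Longrightarrow> (\<lambda>p. (l \<bullet> p) ^ n *\<^sub>R b) \<in> tangent_fields G"
proof (cases "l = 0 \<or> b = 0")
  case True
  have "(\<lambda>p. (snd p ^ 0 * fst b, 0) + (0, fst p ^ 0 * snd b)) \<in> tangent_fields G"
    by (intro tangent_fields_add monomial_first monomial_second)
  then have const: "(\<lambda>p. b) \<in> tangent_fields G" by simp
  show ?thesis
  proof (cases n)
    case 0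
    then show ?thesis using const by simp
  next
    case (Suc m)
    then have "(\<lambda>p. (l \<bullet> p) ^ n *\<^sub>R b) = (\<lambda>p. 0)" using True by auto
    then show ?thesis using tangent_fields_0 by simp
  qed
next
  case False
  assume lb: "l \<bullet> b = 0"
  have "card (Basis :: quat set) = 4" by (simp add: Basis_quat_def)
  then have dim: "2 < DIM(quat \<times> quat)" by simp
  show ?thesis
    by (rule shear_field_orbit[OF real_power_first _ _ _ lb _ _ dim])
      (use False in \<open>simp_all add: norm_Pair norm_quat_def inner_prod_def\<close>)
qed

lemma divergence_free_polynomial_tangent:
  assumes "polynomial_function X" "has_real_divergence X (\<lambda>x. 0)"
  shows "X \<in> tangent_fields G"
proof -
  have "shear_fields \<subseteq> tangent_fields G"
    unfolding shear_fields_def using shear_fields_tangent by blast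
  with divergence_free_polynomial_field[OF assms] show ?thesis
    using fun_span_subset[OF fun_subspace_tangent_fields] by blast
qed

text \<open>The overshear with \<open>f(u) = t u\<^sup>n\<close> agrees with \<open>(z + t z w\<^sup>n, w)\<close> to first order in \<open>t\<close>.\<close>

lemma overshear_monomial:
  assumes "overshears \<subseteq> G"
  shows "(\<lambda>p. (fst p * snd p ^ n, 0)) \<in> tangent_fields G"
  unfolding tangent_fields_def
proof (intro CollectI conjI allI impI)
  show "continuous_on UNIV (\<lambda>p :: quat \<times> quat. (fst p * snd p ^ n, 0 :: quat))" by (intro continuous_intros)
  fix R \<epsilon> :: real assume e: "0 < \<epsilon>"
  define S where "S = max R 1"
  define C where "C = S * ((S ^ n)\<^sup>2 * exp (S ^ n))"
  have S: "S \<ge> 1" "S \<ge> R" by (simp_all add: S_def)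
  have C: "C \<ge> 0" using S by (simp add: C_def)
  have "\<exists>g\<in>G. \<forall>p\<in>cball 0 R. norm (g p - p - t *\<^sub>R (fst p * snd p ^ n, 0)) \<le> \<epsilon> * \<bar>t\<bar>"
    if t: "\<bar>t\<bar> < min 1 (\<epsilon> / (C + 1))" for t
  proof -
    define f where "f u = u ^ n * (t *\<^sub>R 1)" for u :: quat
    let ?g = "\<lambda>p. p + (fst p * (exp (f (snd p)) - 1), 0)"
    have g: "?g \<in> G" using overshear_first[of f] slice_regular_monomial assms unfolding f_def by blast
    have "norm (?g p - p - t *\<^sub>R (fst p * snd p ^ n, 0)) \<le> \<epsilon> * \<bar>t\<bar>" if p: "p \<in> cball 0 R" for p
    proof -
      have n: "norm (fst p) \<le> S" "norm (snd p) \<le> S"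
        using p S norm_fst_le[of "fst p" "snd p"] norm_snd_le[of "snd p" "fst p"] by auto
      have fq: "f (snd p) = t *\<^sub>R snd p ^ n" by (simp add: f_def)
      have nf: "norm (f (snd p)) \<le> \<bar>t\<bar> * S ^ n"
        using n by (simp add: f_def norm_mult norm_power mult.commute mult_left_mono power_mono)
      have "\<bar>t\<bar> * S ^ n \<le> 1 * S ^ n" using t S by (intro mult_right_mono) auto
      with nf have nf': "norm (f (snd p)) \<le> S ^ n" by simp
      have "?g p - p - t *\<^sub>R (fst p * snd p ^ n, 0) = (fst p * (exp (f (snd p)) - 1 - f (snd p)), 0)"
        by (simp add: fq prod_eq_iff algebra_simps)
      then have "norm (?g p - p - t *\<^sub>R (fst p * snd p ^ n, 0)) =
          norm (fst p) * norm (exp (f (snd p)) - 1 - f (snd p))"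
        by (simp add: norm_Pair norm_mult)
      also have "\<dots> \<le> S * ((\<bar>t\<bar> * S ^ n)\<^sup>2 * exp (S ^ n))"
        using n S nf nf' by (intro mult_mono order_trans[OF quat_exp_remainder] power_mono) auto
      also have "\<dots> = \<bar>t\<bar> * C * \<bar>t\<bar>" by (simp add: C_def power2_eq_square mult_ac)
      also have "\<dots> \<le> \<epsilon> * \<bar>t\<bar>"
      proof (rule mult_right_mono)
        have "\<bar>t\<bar> * C \<le> \<bar>t\<bar> * (C + 1)" by (simp add: mult_left_mono)
        also have "\<dots> \<le> \<epsilon>" using t C by (simp add: pos_less_divide_eq)
        finally show "\<bar>t\<bar> * C \<le> \<epsilon>" .
      qed simp
      finally show ?thesis .
    qed
    then show ?thesis by (intro bexI[OF _ g] ballI)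
  qed
  then show "\<exists>\<delta>>0. \<forall>t. 0 < \<bar>t\<bar> \<and> \<bar>t\<bar> < \<delta> \<longrightarrow>
      (\<exists>g\<in>G. \<forall>p\<in>cball 0 R. norm (g p - p - t *\<^sub>R (fst p * snd p ^ n, 0)) \<le> \<epsilon> * \<bar>t\<bar>)"
  proof (intro exI[of _ "min 1 (\<epsilon> / (C + 1))"] conjI)
    show "0 < min 1 (\<epsilon> / (C + 1))" using e C by simp
  qed blast
qed

lemma overshear_real_power:
  assumes "overshears \<subseteq> G"
  shows "(\<lambda>p. ((0, Quat 0 1 0 0) \<bullet> p) ^ n *\<^sub>R (fst p, 0)) \<in> tangent_fields G"
proof -
  let ?i = "Quat 0 1 0 0"
  obtain c where c: "\<And>s w. (w + s *\<^sub>R (?i \<bullet> w) *\<^sub>R 1) ^ n = (\<Sum>k\<le>n. s ^ k *\<^sub>R c k w)"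
    "\<And>w. c n w = ((?i \<bullet> w) *\<^sub>R 1) ^ n"
    using power_of_affine_expansion[of "\<lambda>w. w" "\<lambda>w. (?i \<bullet> w) *\<^sub>R 1" n] by blast
  have "(\<lambda>p. \<Sum>k\<le>n. s ^ k *\<^sub>R (fst p * c k (snd p), 0)) \<in> tangent_fields G" for s
  proof -
    have orth: "(0, ?i) \<bullet> (0 :: quat, (- s) *\<^sub>R 1 :: quat) = 0" by (simp add: inner_prod_def inner_quat_def)
    from push_transvection[OF transvection_tangent[OF orth] orth overshear_monomial[OF assms, of n]]
    have "(\<lambda>p. (fst p * (snd p + s *\<^sub>R (?i \<bullet> snd p) *\<^sub>R 1) ^ n, 0)) \<in> tangent_fields G"
      by (simp add: inner_prod_def mult.commute)
    then show ?thesis by (simp add: c(1)[unfolded scaleR_scaleR] scaleR_Pair sum_prod sum_distrib_left)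
  qed
  from coefficients_in_fun_subspace[OF fun_subspace_tangent_fields zero_less_one this, where k = n]
  show ?thesis by (simp add: c(2) inner_prod_def scaleR_power)
qed

text \<open>Decompose \<open>z\<close> along the four basis elements \<open>e\<close>.  The summands \<open>(e \<bullet> z) r\<^sup>n e\<close>, with \<open>r\<close> the coordinate of \<open>w\<close> as before, all have the divergence \<open>r\<^sup>n\<close>, so
they differ by divergence-free fields, and their sum is four times any one of them modulo such fields.\<close>

lemma overshear_weighted_power:
  assumes "overshears \<subseteq> G"
  shows "(\<lambda>p. (((1, 0) \<bullet> p) * ((0, Quat 0 1 0 0) \<bullet> p) ^ n) *\<^sub>R (1, 0)) \<in> tangent_fields G"
proof -
  let ?m = "(0, Quat 0 1 0 0) :: quat \<times> quat"
  let ?Z = "\<lambda>e p. (((e, 0) \<bullet> p) * (?m \<bullet> p) ^ n) *\<^sub>R (e, 0) :: quat \<times> quat"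
  have sum: "(?m \<bullet> p) ^ n *\<^sub>R (fst p, 0) = (\<Sum>e\<in>Basis. ?Z e p)" for p
  proof -
    have "(\<Sum>e\<in>Basis. ?Z e p) = (?m \<bullet> p) ^ n *\<^sub>R (\<Sum>e\<in>Basis. (fst p \<bullet> e) *\<^sub>R e, 0)"
      by (simp add: inner_prod_def scaleR_sum_right sum_prod scaleR_Pair inner_commute mult.commute)
    then show ?thesis by (simp add: euclidean_representation)
  qed
  have diff: "(\<lambda>p. ?Z e p - ?Z 1 p) \<in> tangent_fields G" if e: "e \<in> Basis" for e
  proof (rule divergence_free_polynomial_tangent)
    show "polynomial_function (\<lambda>p. ?Z e p - ?Z 1 p)" by (intro polynomial_function_diff weighted_shear_polynomial)
    have div: "has_real_divergence (?Z e) (\<lambda>p. (?m \<bullet> p) ^ n)" if "e \<bullet> e = 1" for e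
      using has_real_divergence_scalar_times_vector[OF weighted_power_has_derivative, of "(e, 0)" ?m n "(e, 0)"] that
      by (simp add: inner_prod_def)
    have "e \<bullet> e = 1" "(1 :: quat) \<bullet> 1 = 1" using e by (simp_all add: inner_same_Basis) (simp add: inner_quat_def)
    from has_real_divergence_add[OF div[OF this(1)] has_real_divergence_scale[OF div[OF this(2)], of "-1"]]
    show "has_real_divergence (\<lambda>p. ?Z e p - ?Z 1 p) (\<lambda>p. 0)" by simp
  qed
  note S = fun_subspace_tangent_fields
  have "(\<lambda>p. (1/4) *\<^sub>R ((?m \<bullet> p) ^ n *\<^sub>R (fst p, 0) - (\<Sum>e\<in>Basis. ?Z e p - ?Z 1 p))) \<in> tangent_fields G"
    by (intro fun_subspace_scale[OF S] fun_subspace_diff[OF S] fun_subspace_sum[OF S] diff overshear_real_power assms)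
  also have "(\<lambda>p. (1/4) *\<^sub>R ((?m \<bullet> p) ^ n *\<^sub>R (fst p, 0) - (\<Sum>e\<in>Basis. ?Z e p - ?Z 1 p))) = ?Z 1"
  proof
    fix p
    have "card (Basis :: quat set) = 4" by (simp add: Basis_quat_def)
    then have "(\<Sum>e\<in>(Basis :: quat set). ?Z 1 p) = 4 *\<^sub>R ?Z 1 p" by (simp only: sum_constant_scaleR) simp
    then show "(1/4) *\<^sub>R ((?m \<bullet> p) ^ n *\<^sub>R (fst p, 0) - (\<Sum>e\<in>Basis. ?Z e p - ?Z 1 p)) = ?Z 1 p"
      by (simp only: sum sum_subtractf) simp
  qed
  finally show ?thesis .
qed

lemma polynomial_tangent:
  assumes "overshears \<subseteq> G" "polynomial_function X"
  shows "X \<in> tangent_fields G"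
  by (rule polynomial_fields_in_tangent_fields[OF
        divergence_free_polynomial_tangent overshear_weighted_power[OF assms(1)] _ _ _ assms(2)])
    (simp_all add: norm_Pair norm_quat_def inner_prod_def inner_quat_def)

end

section \<open>Power series in quaternionic variables\<close>

text \<open>Vector-valued polynomials of degree at most \<open>d\<close> in one real variable, described by their components.\<close>

definition line_poly :: "nat \<Rightarrow> (real \<Rightarrow> 'a::euclidean_space) \<Rightarrow> bool" where
  "line_poly d \<phi> \<longleftrightarrow> (\<forall>e. \<exists>q. degree q \<le> d \<and> (\<forall>t. \<phi> t \<bullet> e = poly q t))"

lemma line_poly_const: "line_poly d (\<lambda>t. c)"
  unfolding line_poly_def by (intro allI exI[of _ "[:c \<bullet> e:]" for e]) simp

lemma line_poly_add:
  assumes "line_poly d f" "line_poly d g"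
  shows "line_poly d (\<lambda>t. f t + g t)"
  unfolding line_poly_def
proof
  fix e
  obtain p where p: "degree p \<le> d" "\<And>t. f t \<bullet> e = poly p t" using assms(1) unfolding line_poly_def by blast
  obtain q where q: "degree q \<le> d" "\<And>t. g t \<bullet> e = poly q t" using assms(2) unfolding line_poly_def by blast
  show "\<exists>q. degree q \<le> d \<and> (\<forall>t. (f t + g t) \<bullet> e = poly q t)"
    using p q by (intro exI[of _ "p + q"]) (simp add: inner_add_left degree_add_le)
qed

lemma line_poly_linear:
  assumes "line_poly d f" and A: "linear A"
  shows "line_poly d (\<lambda>t. A (f t))"
  unfolding line_poly_def
proof
  fix e
  obtain q where "degree q \<le> d" "\<And>t. f t \<bullet> adjoint A e = poly q t" using assms(1) unfolding line_poly_def by blast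
  then show "\<exists>q. degree q \<le> d \<and> (\<forall>t. A (f t) \<bullet> e = poly q t)"
    using adjoint_works[OF A] by (intro exI[of _ q]) simp
qed

lemma line_poly_Suc: "line_poly d f \<Longrightarrow> line_poly (Suc d) f"
  unfolding line_poly_def using le_SucI by blast

lemma line_poly_times:
  assumes "line_poly d f"
  shows "line_poly (Suc d) (\<lambda>t. t *\<^sub>R f t)"
  unfolding line_poly_def
proof
  fix e
  obtain q where "degree q \<le> d" "\<And>t. f t \<bullet> e = poly q t" using assms unfolding line_poly_def by blast
  then show "\<exists>q. degree q \<le> Suc d \<and> (\<forall>t. (t *\<^sub>R f t) \<bullet> e = poly q t)"
    by (intro exI[of _ "pCons 0 q"]) (simp add: degree_pCons_le[THEN order_trans])
qed

lemma line_poly_sum_list: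
  "(\<And>m. m \<in> set ms \<Longrightarrow> line_poly d (\<lambda>t. m (p + t *\<^sub>R b))) \<Longrightarrow> line_poly d (\<lambda>t. \<Sum>m\<leftarrow>ms. m (p + t *\<^sub>R b))"
  by (induction ms) (auto intro: line_poly_const line_poly_add)

lemma linear_quat_mult: "linear (\<lambda>x::quat. x * u * a)"
  by (rule linearI) (simp_all add: distrib_right)

lemma hmonomial_line_poly:
  assumes "hmonomial d m"
  shows "line_poly d (\<lambda>t. m (p + t *\<^sub>R b))"
  using assms
proof induction
  case (const a)
  show ?case by (simp add: line_poly_const case_prod_unfold)
next
  case (var_z d m a)
  have "(case p + t *\<^sub>R b of (z, w) \<Rightarrow> m (z, w) * z * a) =
      m (p + t *\<^sub>R b) * fst p * a + t *\<^sub>R (m (p + t *\<^sub>R b) * fst b * a)" for t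
    by (simp add: case_prod_unfold distrib_left distrib_right)
  then show ?case
    by (simp only:) (intro line_poly_add line_poly_times line_poly_Suc line_poly_linear[OF _ linear_quat_mult] var_z.IH)
next
  case (var_w d m a)
  have "(case p + t *\<^sub>R b of (z, w) \<Rightarrow> m (z, w) * w * a) =
      m (p + t *\<^sub>R b) * snd p * a + t *\<^sub>R (m (p + t *\<^sub>R b) * snd b * a)" for t
    by (simp add: case_prod_unfold distrib_left distrib_right)
  then show ?case
    by (simp only:) (intro line_poly_add line_poly_times line_poly_Suc line_poly_linear[OF _ linear_quat_mult] var_w.IH)
qed

lemma hmonomial_homogeneous: "hmonomial d m \<Longrightarrow> m (s *\<^sub>R p) = s ^ d *\<^sub>R m p"
  by (induction rule: hmonomial.induct) (simp_all add: case_prod_unfold)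

text \<open>Expanding the middle factor in the real basis of \<open>\<bbbH>\<close> reduces the noncommutative product to products of scalars and
vectors.\<close>

lemma polynomial_function_quat_product:
  assumes f: "polynomial_function (f :: 'a::real_normed_vector \<Rightarrow> quat)" and g: "polynomial_function g"
  shows "polynomial_function (\<lambda>x. f x * g x * a)"
proof -
  have "polynomial_function (\<lambda>x. \<Sum>e\<in>Basis. (g x \<bullet> e) *\<^sub>R (f x * (e * a)))"
  proof (intro polynomial_function_sum polynomial_function_mult finite_Basis)
    fix e :: quat
    show "polynomial_function (\<lambda>x. g x \<bullet> e)"
      using g bounded_linear_inner_left[of e]
      unfolding polynomial_function_def[of g] o_def real_polynomial_function_eq by blast
    have "bounded_linear (\<lambda>y. h (y * (e * a)))" if "bounded_linear h" for h :: "quat \<Rightarrow> real"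
      by (rule bounded_linear_compose[OF that bounded_linear_mult_left])
    then show "polynomial_function (\<lambda>x. f x * (e * a))"
      using f unfolding polynomial_function_def o_def by blast
  qed
  moreover have "(\<Sum>e\<in>Basis. (g x \<bullet> e) *\<^sub>R (f x * (e * a))) = f x * g x * a" for x
  proof -
    have "(\<Sum>e\<in>Basis. (g x \<bullet> e) *\<^sub>R (f x * (e * a))) = f x * (\<Sum>e\<in>Basis. (g x \<bullet> e) *\<^sub>R e) * a"
      by (simp add: sum_distrib_left sum_distrib_right mult.assoc)
    then show ?thesis by (simp add: euclidean_representation)
  qed
  ultimately show ?thesis by simp
qed

lemma hmonomial_polynomial_function: "hmonomial d m \<Longrightarrow> polynomial_function m"
proof (induction rule: hmonomial.induct)
  case (const a)
  show ?case by (simp add: case_prod_unfold)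
next
  case (var_z d m a)
  from polynomial_function_quat_product[OF var_z.IH polynomial_function_bounded_linear[OF bounded_linear_fst]]
  show ?case by (simp add: case_prod_unfold)
next
  case (var_w d m a)
  from polynomial_function_quat_product[OF var_w.IH polynomial_function_bounded_linear[OF bounded_linear_snd]]
  show ?case by (simp add: case_prod_unfold)
qed

lemma homogeneous_poly_line_poly: "homogeneous_poly d f \<Longrightarrow> line_poly d (\<lambda>t. f (p + t *\<^sub>R b))"
  unfolding homogeneous_poly_def by (auto intro: line_poly_sum_list hmonomial_line_poly)

lemma homogeneous_poly_homogeneous: "homogeneous_poly d f \<Longrightarrow> f (s *\<^sub>R p) = s ^ d *\<^sub>R f p"
proof -
  assume "homogeneous_poly d f"
  then obtain ms where ms: "\<forall>m\<in>set ms. hmonomial d m" and f: "f = (\<lambda>p. \<Sum>m\<leftarrow>ms. m p)"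
    unfolding homogeneous_poly_def by blast
  from ms have "(\<Sum>m\<leftarrow>ms. m (s *\<^sub>R p)) = s ^ d *\<^sub>R (\<Sum>m\<leftarrow>ms. m p)"
    by (induction ms) (simp_all add: hmonomial_homogeneous scaleR_add_right)
  then show ?thesis by (simp add: f)
qed

lemma homogeneous_poly_polynomial_function: "homogeneous_poly d f \<Longrightarrow> polynomial_function f"
proof -
  assume "homogeneous_poly d f"
  then obtain ms where ms: "\<forall>m\<in>set ms. hmonomial d m" and f: "f = (\<lambda>p. \<Sum>m\<leftarrow>ms. m p)"
    unfolding homogeneous_poly_def by blast
  from ms have "polynomial_function (\<lambda>p. \<Sum>m\<leftarrow>ms. m p)"
    by (induction ms) (auto intro: hmonomial_polynomial_function)
  then show ?thesis by (simp add: f)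
qed

lemma polynomial_function_Pair:
  assumes "polynomial_function f" "polynomial_function g"
  shows "polynomial_function (\<lambda>x. (f x, g x))"
proof -
  have "bounded_linear (\<lambda>a. h (a, 0))" "bounded_linear (\<lambda>a. h (0, a))"
    if "bounded_linear h" for h :: "'b \<times> 'c \<Rightarrow> real"
    by (auto intro!: bounded_linear_compose[OF that] bounded_linear_Pair bounded_linear_ident bounded_linear_zero)
  then have 1: "polynomial_function (\<lambda>x. (f x, 0 :: 'c))" "polynomial_function (\<lambda>x. (0 :: 'b, g x))"
    using assms unfolding polynomial_function_def o_def by blast+
  from polynomial_function_add[OF this] show ?thesis by simp
qed

lemma vector_field_expansion:
  assumes "vector_field X"
  obtains F where "entire_series F" "\<And>p. (\<lambda>d. F d p) sums X p" "\<And>d. polynomial_function (F d)"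
proof -
  have "fst \<circ> X \<in> Hseries" using assms unfolding vector_field_def by blast
  then obtain F1 where F1_all: "\<forall>d. homogeneous_poly d (F1 d)"
    "\<forall>p. summable (\<lambda>d. norm (F1 d p)) \<and> (\<lambda>d. F1 d p) sums (fst \<circ> X) p"
    unfolding Hseries_def by blast
  have F1: "\<And>d. homogeneous_poly d (F1 d)" "\<And>p. summable (\<lambda>d. norm (F1 d p))"
    "\<And>p. (\<lambda>d. F1 d p) sums fst (X p)"
    using F1_all unfolding o_apply by blast+
  have "snd \<circ> X \<in> Hseries" using assms unfolding vector_field_def by blast
  then obtain F2 where F2_all: "\<forall>d. homogeneous_poly d (F2 d)"
    "\<forall>p. summable (\<lambda>d. norm (F2 d p)) \<and> (\<lambda>d. F2 d p) sums (snd \<circ> X) p"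
    unfolding Hseries_def by blast
  have F2: "\<And>d. homogeneous_poly d (F2 d)" "\<And>p. summable (\<lambda>d. norm (F2 d p))"
    "\<And>p. (\<lambda>d. F2 d p) sums snd (X p)"
    using F2_all unfolding o_apply by blast+
  define F where "F d p = (F1 d p, F2 d p)" for d p
  have "entire_series F"
    unfolding entire_series_def
  proof (intro conjI allI)
    fix d p b and e :: "quat \<times> quat"
    obtain q1 where q1: "degree q1 \<le> d" "\<And>t. F1 d (p + t *\<^sub>R b) \<bullet> fst e = poly q1 t"
      using homogeneous_poly_line_poly[OF F1(1)] unfolding line_poly_def by blast
    obtain q2 where q2: "degree q2 \<le> d" "\<And>t. F2 d (p + t *\<^sub>R b) \<bullet> snd e = poly q2 t"
      using homogeneous_poly_line_poly[OF F2(1)] unfolding line_poly_def by blast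
    show "\<exists>q. degree q \<le> d \<and> (\<forall>t. F d (p + t *\<^sub>R b) \<bullet> e = poly q t)"
      using q1 q2 by (intro exI[of _ "q1 + q2"]) (simp add: F_def inner_prod_def degree_add_le)
  next
    fix d s p
    show "F d (s *\<^sub>R p) = s ^ d *\<^sub>R F d p"
      by (simp only: F_def homogeneous_poly_homogeneous[OF F1(1)] homogeneous_poly_homogeneous[OF F2(1)] scaleR_Pair)
  next
    fix p
    have "norm (F d p) \<le> norm (F1 d p) + norm (F2 d p)" for d
      unfolding F_def by (rule norm_Pair_le)
    then show "summable (\<lambda>d. norm (F d p))"
      by (intro summable_comparison_test'[OF summable_add[OF F1(2) F2(2)]]) simp
  qed
  moreover have "(\<lambda>d. F d p) sums X p" for p
    using tendsto_Pair[OF F1(3)[of p, unfolded sums_def] F2(3)[of p, unfolded sums_def]]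
    unfolding sums_def F_def sum_prod by simp
  moreover have "polynomial_function (F d)" for d
    unfolding F_def by (intro polynomial_function_Pair homogeneous_poly_polynomial_function[OF F1(1)]
        homogeneous_poly_polynomial_function[OF F2(1)])
  ultimately show ?thesis by (rule that)
qed

lemma power_series_coefficients_zero:
  fixes a :: "nat \<Rightarrow> real"
  assumes z: "\<And>s. s \<noteq> 0 \<Longrightarrow> (\<lambda>n. a n * s ^ n) sums 0"
  shows "a n = 0"
proof (induction n rule: less_induct)
  case (less n)
  have "(\<lambda>k. a (k + n) * s ^ k) sums 0" if "s \<noteq> 0" for s
  proof -
    have "(\<lambda>k. a (k + n) * s ^ (k + n)) sums (0 - (\<Sum>i<n. a i * s ^ i))"
      using sums_split_initial_segment[OF z[OF that], of n] by simp
    also have "(\<Sum>i<n. a i * s ^ i) = 0" using less by (intro sum.neutral) simp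
    finally have "(\<lambda>k. (1 / s ^ n) * (a (k + n) * s ^ (k + n))) sums ((1 / s ^ n) * (0 - 0))"
      by (rule sums_mult)
    then show ?thesis using that by (simp add: power_add field_simps)
  qed
  from powser_limit_0_strong[OF zero_less_one this]
  have "((\<lambda>s::real. 0 :: real) \<longlongrightarrow> a (0 + n)) (at 0)" by simp
  then show ?case by (simp add: tendsto_const_iff)
qed

text \<open>Summing \<open>Div X p e \<bullet> e\<close> over the basis of \<open>\<bbbH>\<close> gives the sum of the real divergences of all parts.  The divergence of
\<open>F d\<close> is homogeneous of degree \<open>d - 1\<close>, so along the ray through \<open>p\<close> one has a vanishing power
series in \<open>s\<close>.\<close>

lemma divergence_free_homogeneous_parts:
  assumes F: "entire_series F" and X: "\<And>p. (\<lambda>d. F d p) sums X p"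
    and pol: "\<And>d. polynomial_function (F d)"
    and div: "\<And>p h. Div X p h = 0"
  shows "has_real_divergence (F d) (\<lambda>x. 0)"
proof -
  have "\<exists>D. (F d has_derivative D) (at p)" for d p
    using differentiable_at_polynomial_function[OF pol] unfolding differentiable_def by blast
  then obtain D where D: "\<And>d p. (F d has_derivative D d p) (at p)" by metis
  note ser = entire_series_directional_derivative[OF F X D]
  have dz: "dz (fst \<circ> X) p h = (\<Sum>d. fst (D d p (h, 0)))" for p h
  proof -
    have "((\<lambda>t. fst ((1 / t) *\<^sub>R (X (p + t *\<^sub>R (h, 0)) - X p))) \<longlongrightarrow> fst (\<Sum>d. D d p (h, 0))) (at 0)"
      by (rule tendsto_fst[OF ser(2)])
    then have "Lim (at 0) (\<lambda>t. (1 / t) *\<^sub>R (fst (X (p + t *\<^sub>R (h, 0))) - fst (X p))) = fst (\<Sum>d. D d p (h, 0))"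
      by (intro tendsto_Lim) simp_all
    moreover have "fst (\<Sum>d. D d p (h, 0)) = (\<Sum>d. fst (D d p (h, 0)))"
      by (rule bounded_linear.suminf[OF bounded_linear_fst summable_norm_cancel[OF ser(1)]])
    moreover have "p + t *\<^sub>R (h, 0) = (fst p + t *\<^sub>R h, snd p)" for t by (simp add: prod_eq_iff)
    ultimately show ?thesis by (simp add: dz_def case_prod_unfold)
  qed
  have dw: "dw (snd \<circ> X) p h = (\<Sum>d. snd (D d p (0, h)))" for p h
  proof -
    have "((\<lambda>t. snd ((1 / t) *\<^sub>R (X (p + t *\<^sub>R (0, h)) - X p))) \<longlongrightarrow> snd (\<Sum>d. D d p (0, h))) (at 0)"
      by (rule tendsto_snd[OF ser(2)])
    then have "Lim (at 0) (\<lambda>t. (1 / t) *\<^sub>R (snd (X (p + t *\<^sub>R (0, h))) - snd (X p))) = snd (\<Sum>d. D d p (0, h))"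
      by (intro tendsto_Lim) simp_all
    moreover have "snd (\<Sum>d. D d p (0, h)) = (\<Sum>d. snd (D d p (0, h)))"
      by (rule bounded_linear.suminf[OF bounded_linear_snd summable_norm_cancel[OF ser(1)]])
    moreover have "p + t *\<^sub>R (0, h) = (fst p, snd p + t *\<^sub>R h)" for t by (simp add: prod_eq_iff)
    ultimately show ?thesis by (simp add: dw_def case_prod_unfold)
  qed
  define \<delta> where "\<delta> d p = (\<Sum>b\<in>Basis. D d p b \<bullet> b)" for d p
  have split: "\<delta> d p = (\<Sum>e\<in>Basis. (fst (D d p (e, 0)) + snd (D d p (0, e))) \<bullet> e)" for d p
  proof -
    have "\<delta> d p = (\<Sum>b\<in>(\<lambda>e. (e, 0)) ` Basis. D d p b \<bullet> b) + (\<Sum>b\<in>(\<lambda>e. (0, e)) ` Basis. D d p b \<bullet> b)"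
      unfolding \<delta>_def Basis_prod_def by (intro sum.union_disjoint) auto
    also have "\<dots> = (\<Sum>e\<in>Basis. D d p (e, 0) \<bullet> (e, 0)) + (\<Sum>e\<in>Basis. D d p (0, e) \<bullet> (0, e))"
      by (simp add: sum.reindex inj_on_def)
    finally show ?thesis by (simp add: inner_prod_def inner_add_left sum.distrib)
  qed
  have sum0: "(\<lambda>d. \<delta> d p) sums 0" for p
  proof -
    have "(\<lambda>d. (fst (D d p (e, 0)) + snd (D d p (0, e))) \<bullet> e) sums (Div X p e \<bullet> e)" for e
    proof (rule bounded_linear.sums[OF bounded_linear_inner_left])
      have 1: "(\<lambda>d. fst (D d p (e, 0))) sums (\<Sum>d. fst (D d p (e, 0)))"
        by (intro summable_sums bounded_linear.summable[OF bounded_linear_fst] summable_norm_cancel[OF ser(1)])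
      have 2: "(\<lambda>d. snd (D d p (0, e))) sums (\<Sum>d. snd (D d p (0, e)))"
        by (intro summable_sums bounded_linear.summable[OF bounded_linear_snd] summable_norm_cancel[OF ser(1)])
      show "(\<lambda>d. fst (D d p (e, 0)) + snd (D d p (0, e))) sums Div X p e"
        unfolding Div_def dz dw by (rule sums_add[OF 1 2])
    qed
    then have "(\<lambda>d. \<Sum>e\<in>Basis. (fst (D d p (e, 0)) + snd (D d p (0, e))) \<bullet> e) sums (\<Sum>e\<in>Basis. Div X p e \<bullet> e)"
      by (rule sums_sum)
    then show ?thesis by (simp add: split div)
  qed
  have scale: "s * \<delta> d (s *\<^sub>R p) = s ^ d * \<delta> d p" for s d p
  proof -
    have "((\<lambda>x. s *\<^sub>R x) has_derivative (\<lambda>h. s *\<^sub>R h)) (at p)" by (auto intro!: derivative_eq_intros)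
    from has_derivative_compose[OF this D]
    have "((\<lambda>x. F d (s *\<^sub>R x)) has_derivative (\<lambda>h. D d (s *\<^sub>R p) (s *\<^sub>R h))) (at p)" .
    moreover have "((\<lambda>x. F d (s *\<^sub>R x)) has_derivative (\<lambda>h. s ^ d *\<^sub>R D d p h)) (at p)"
      unfolding entire_series_homogeneous[OF F] by (rule has_derivative_scaleR_right[OF D])
    ultimately have eq: "(\<lambda>h. D d (s *\<^sub>R p) (s *\<^sub>R h)) = (\<lambda>h. s ^ d *\<^sub>R D d p h)" by (rule has_derivative_unique)
    have "s *\<^sub>R D d (s *\<^sub>R p) b = s ^ d *\<^sub>R D d p b" for b
      using fun_cong[OF eq, of b] linear_scale[OF has_derivative_linear[OF D]] by metis
    then have "(\<Sum>b\<in>Basis. (s *\<^sub>R D d (s *\<^sub>R p) b) \<bullet> b) = (\<Sum>b\<in>Basis. (s ^ d *\<^sub>R D d p b) \<bullet> b)" by simp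
    then show ?thesis by (simp add: \<delta>_def sum_distrib_left)
  qed
  have "\<delta> d p = 0" for p
  proof (rule power_series_coefficients_zero)
    fix s :: real
    have "(\<lambda>n. s * \<delta> n (s *\<^sub>R p)) sums (s * 0)" by (rule sums_mult[OF sum0])
    then show "(\<lambda>n. \<delta> n p * s ^ n) sums 0" by (simp add: scale mult.commute)
  qed
  then show ?thesis unfolding has_real_divergence_def \<delta>_def using D by blast
qed

text \<open>Time slices of the flow domain are intervals containing \<open>0\<close> and \<open>1\<close>.\<close>

lemma time_one_map_flow:
  assumes "time_one_map X F"
  shows "\<exists>\<Phi>. (\<forall>p. \<Phi> p 0 = p) \<and> (\<forall>p. F p = \<Phi> p 1) \<and>
    (\<forall>p. \<forall>t\<in>{0..1}. (\<Phi> p has_vector_derivative X (\<Phi> p t)) (at t within {0..1}))"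
proof -
  obtain U \<Phi> where flow: "is_flow X U \<Phi>" and U1: "UNIV \<times> {1} \<subseteq> U" and F: "F = (\<lambda>p. \<Phi> (p, 1))"
    using assms unfolding time_one_map_def by blast
  have "(p, t) \<in> U" if t: "t \<in> {0..1}" for p t
  proof -
    have I: "is_interval {t. (p, t) \<in> U}" using flow unfolding is_flow_def by blast
    have "(p, 0) \<in> U" using flow unfolding is_flow_def by blast
    moreover have "(p, 1) \<in> U" using U1 by blast
    ultimately show ?thesis using I[unfolded is_interval_1, rule_format, of 0 1 t] t by simp
  qed
  note inU = this
  have "\<forall>(p, t)\<in>U. ((\<lambda>s. \<Phi> (p, s)) has_vector_derivative X (\<Phi> (p, t))) (at t)"
    using flow unfolding is_flow_def by blast
  note deriv = this
  have "((\<lambda>s. \<Phi> (p, s)) has_vector_derivative X (\<Phi> (p, t))) (at t within {0..1})"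
    if t: "t \<in> {0..1}" for p t
    using bspec[OF deriv inU[OF t, of p]] unfolding prod.case
    by (rule has_vector_derivative_at_within)
  moreover have "\<Phi> (p, 0) = p" for p using flow unfolding is_flow_def by blast
  ultimately show ?thesis using F by (intro exI[of _ "\<lambda>p t. \<Phi> (p, t)"]) simp
qed

context shear_monoid begin

lemma time_one_map_approximable:
  fixes X :: vfield
  assumes "X \<in> tangent_fields G" "lipschitz_on_balls X" "time_one_map X F"
  shows "approximable_on_compacts F G"
proof -
  obtain \<Phi> where ini: "\<And>p. \<Phi> p 0 = p" and F: "\<And>p. F p = \<Phi> p 1"
    and sol: "\<And>p t. t \<in> {0..1} \<Longrightarrow> (\<Phi> p has_vector_derivative X (\<Phi> p t)) (at t within {0..1})"
    using time_one_map_flow[OF assms(3)] by blast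
  have "F = (\<lambda>p. \<Phi> p 1)" using F by blast
  with flow_approximable[OF assms(1,2) ini sol] show ?thesis by simp
qed

end

lemma map_monoid_finite_compositions:
  "map_monoid (finite_compositions S :: ('a::euclidean_space \<Rightarrow> 'a) set)"
proof
  show "id \<in> (finite_compositions S :: ('a \<Rightarrow> 'a) set)"
    unfolding finite_compositions_def by (intro CollectI exI[of _ "[]"]) simp
next
  fix f g :: "'a \<Rightarrow> 'a"
  have foldr_append: "foldr (\<circ>) (xs @ ys) id = foldr (\<circ>) xs id \<circ> foldr (\<circ>) ys (id :: 'a \<Rightarrow> 'a)" for xs ys
    by (induction xs) (simp_all add: comp_assoc)
  assume "f \<in> finite_compositions S" "g \<in> finite_compositions S"
  then obtain xs ys where "set xs \<subseteq> S" "set ys \<subseteq> S" "f = foldr (\<circ>) xs id" "g = foldr (\<circ>) ys id"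
    unfolding finite_compositions_def by blast
  then show "f \<circ> g \<in> finite_compositions S"
    unfolding finite_compositions_def by (intro CollectI exI[of _ "xs @ ys"]) (simp only: foldr_append set_append Un_least simp_thms)
qed

lemma subset_finite_compositions: "S \<subseteq> finite_compositions S"
proof
  fix f assume "f \<in> S"
  then show "f \<in> finite_compositions S"
    unfolding finite_compositions_def by (intro CollectI exI[of _ "[f]"]) simp
qed

lemma shear_monoid_finite_compositions: "shears \<subseteq> S \<Longrightarrow> shear_monoid (finite_compositions S)"
  using map_monoid_finite_compositions[of S] subset_finite_compositions[of S]
  by (simp add: shear_monoid_def shear_monoid_axioms_def) 

context shear_monoid begin

lemma flow_of_series_approximable:
  assumes F: "entire_series F" "\<And>p. (\<lambda>d. F d p) sums X p"
    and T: "\<And>d. F d \<in> tangent_fields G" and flow: "time_one_map X \<Psi>"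
  shows "approximable_on_compacts \<Psi> G"
proof -
  have "X \<in> tangent_fields G"
  proof (rule tangent_fields_limit[OF entire_series_sum_continuous[OF F]])
    fix R \<epsilon> :: real assume "0 < \<epsilon>"
    from entire_series_uniform_limit[OF F this, of R]
    obtain n where "\<forall>x\<in>cball 0 R. norm ((\<Sum>d<n. F d x) - X x) \<le> \<epsilon>" by blast
    moreover have "(\<lambda>x. \<Sum>d<n. F d x) \<in> tangent_fields G"
      by (intro fun_subspace_sum[OF fun_subspace_tangent_fields] T)
    ultimately show "\<exists>Y\<in>tangent_fields G. \<forall>x\<in>cball 0 R. norm (Y x - X x) \<le> \<epsilon>"
      by (intro bexI[of _ "\<lambda>x. \<Sum>d<n. F d x"])
  qed
  then show ?thesis
    by (rule time_one_map_approximable[OF _ entire_series_sum_lipschitz[OF F] flow])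
qed

lemma Aut_1_approximable:
  assumes "\<Psi> \<in> Aut_1"
  shows "approximable_on_compacts \<Psi> G"
proof -
  obtain X where X: "vector_field X" "\<And>p h. Div X p h = 0" "time_one_map X \<Psi>"
    using assms unfolding Aut_1_def by blast
  obtain F where F: "entire_series F" "\<And>p. (\<lambda>d. F d p) sums X p" "\<And>d. polynomial_function (F d)"
    using vector_field_expansion[OF X(1)] by blast
  show ?thesis
    by (rule flow_of_series_approximable[OF F(1,2) divergence_free_polynomial_tangent[OF F(3)
        divergence_free_homogeneous_parts[OF F X(2)]] X(3)])
qed

lemma Aut_V_approximable:
  assumes "overshears \<subseteq> G" "\<Psi> \<in> Aut_V"
  shows "approximable_on_compacts \<Psi> G"
proof -
  obtain X where X: "vector_field X" "time_one_map X \<Psi>"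
    using assms unfolding Aut_V_def by blast
  obtain F where F: "entire_series F" "\<And>p. (\<lambda>d. F d p) sums X p" "\<And>d. polynomial_function (F d)"
    using vector_field_expansion[OF X(1)] by blast
  show ?thesis
    by (rule flow_of_series_approximable[OF F(1,2) polynomial_tangent[OF assms(1) F(3)] X(2)])
qed

end

section \<open>Approximation by shears and overshears\<close>

theorem theorem5p3:
  shows "(\<forall>F\<in>Aut_V. approximable_on_compacts F (finite_compositions (shears \<union> overshears))) \<and>
         (\<forall>F\<in>Aut_1. approximable_on_compacts F (finite_compositions shears))"
proof (intro conjI ballI)
  have "overshears \<subseteq> finite_compositions (shears \<union> overshears)"
    using subset_finite_compositions[of "shears \<union> overshears"] by blast
  then show "approximable_on_compacts F (finite_compositions (shears \<union> overshears))" if "F \<in> Aut_V" for F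
    by (rule shear_monoid.Aut_V_approximable[OF shear_monoid_finite_compositions[OF Un_upper1] _ that])
  show "approximable_on_compacts F (finite_compositions shears)" if "F \<in> Aut_1" for F
    by (rule shear_monoid.Aut_1_approximable[OF shear_monoid_finite_compositions[OF order_refl] that])
qed

end
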